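(* Let $\Lambda=\{\lambda_j\}_{j\ge0}$ be a sequence in the open unit disk $\mathbb D$ with $\lambda_0=0$, and let $B_N$, $\beta_N$, $U_\alpha^{B_N}$, $T_{B_N}(\cdot)$ and $\mathcal E$ be the associated objects defined in the context. The following are equivalent: (a) For almost every $\alpha\in\mathbb T$, $\|\beta_N(U_\alpha^{B_N})\|\to0$ as $N\to\infty$. (b) The Lebesgue measure of $\mathcal E$ is zero, i.e. $$\sum_{j=1}^\infty\frac{1-|\lambda_j|^2}{|\zeta-\lambda_j|^2}=\infty\quad\text{for a.e. }\zeta\in\mathbb T .$$ (c) For every $\varphi\in C(\mathbb T)$ and every $f$ which is analytic on a neighbourhood of $\operatorname{conv}\mathcal R(\varphi)$, $$\lim_{N\to\infty}\operatorname{Tr}\left[T_{B_N}(\beta_N)\,f(T_{B_N}(\varphi))\right]=\int_{\mathbb T}f(\varphi(\zeta))\,\mathrm d\zeta .$$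
   Context: $\mathbb T=\partial\mathbb D$ is the unit circle, with normalized Lebesgue measure $m$, written $\mathrm d\zeta$. $H^2=H^2(\mathbb D)$ is the Hardy space, regarded as a closed subspace of $L^2(\mathbb T)$ via boundary values. $z$ denotes the identity function. For $\varphi,\psi\in L^2(\mathbb T)$, $\varphi\otimes\psi$ is the rank one operator $g\mapsto(g,\psi)\varphi$. $\|\cdot\|$ applied to an operator is the operator norm. For $\varphi\in L^\infty(\mathbb T)$, $\mathcal R(\varphi)$ is its essential range and $\operatorname{conv}\mathcal R(\varphi)$ is the closed convex hull of $\mathcal R(\varphi)$. For a sequence $\Lambda=\{\lambda_j\}_{j\ge0}$ in $\mathbb D$ with $\lambda_0=0$ and $N\ge1$, $B_N$ is the finite Blaschke product with zeros $\lambda_0,\dots,\lambda_{N-1}$: $$B_N(\zeta)=\prod_{j=0}^{N-1}\frac{\overline{\lambda_j}}{|\lambda_j|}\,\frac{\zeta-\lambda_j}{1-\overline{\lambda_j}\zeta},$$ with the convention $\overline{\lambda_j}/|\lambda_j|=1$ when $\lambda_j=0$. On $\mathbb T$ one has $|B_N'(\zeta)|=\sum_{j=0}^{N-1}\frac{1-|\lambda_j|^2}{|\zeta-\lambda_j|^2}$. Define $$\beta_N(\zeta)=\frac1{|B_N'(\zeta)|}\quad(\zeta\in\mathbb T),\qquad \mathcal E=\left\{\zeta\in\mathbb T:\ \lim_{N\to\infty}|B_N'(\zeta)|<\infty\right\}.$$ For an inner function $B$, the model space is $K_B=H^2\ominus BH^2$, and for $\varphi\in L^\infty(\mathbb T)$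 the truncated Toeplitz operator $T_B(\varphi)$ is the operator on $K_B$ given by $T_B(\varphi)g=P_B(\varphi g)$, where $P_B$ is the orthogonal projection of $L^2(\mathbb T)$ onto $K_B$. The operator $f(T_{B_N}(\varphi))$ is defined by the holomorphic functional calculus. If $B$ is inner with $B(0)=0$ and $\alpha\in\mathbb T$, the Clark unitary operator on $K_B$ is $$U_\alpha^B=T_B(z)+\alpha\,(1\otimes\overline zB),$$ a unitary rank one perturbation of $T_B(z)$. $\beta_N(U_\alpha^{B_N})$ is defined by the functional calculus for unitary operators. (For a finite Blaschke product $B$ the eigenvalues of $U_\alpha^B$ are the points $\zeta\in\mathbb T$ with $B(\zeta)=\alpha$.) *)

theory Defs
  imports "HOL-Complex_Analysis.Complex_Analysis"
begin

section \<open>The circle and its Lebesgue space\<close>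

text \<open>
  Normalized Lebesgue measure on the unit circle. Its \<open>\<sigma>\<close>-algebra is the Borel \<open>\<sigma>\<close>-algebra of
  the circle itself, so that the values of a function off the circle play no role.
\<close>

definition circ :: "complex measure" where
  "circ = distr (uniform_measure lborel {0..2 * pi}) (restrict_space borel (sphere 0 1)) cis"

lemma space_circ [simp]: "space circ = sphere 0 1"
  by (simp add: circ_def space_restrict_space)

lemma sets_circ [measurable_cong]: "sets circ = sets (restrict_space borel (sphere 0 1))"
  by (simp add: circ_def)

lemma cis_measurable_circ:
  "cis \<in> measurable (uniform_measure lborel {0..2 * pi}) (restrict_space borel (sphere 0 1))"
proof -
  have "cis \<in> borel_measurable borel"
    by (intro borel_measurable_continuous_onI continuous_intros)
  then show ?thesis
    by (intro measurable_restrict_space2) auto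
qed

lemma emeasure_circ_space: "emeasure circ (sphere 0 1) = 1"
proof -
  let ?\<mu> = "uniform_measure lborel {0..2 * pi}"
  have "emeasure circ (space circ) = emeasure ?\<mu> (cis -` space circ \<inter> space ?\<mu>)"
    using cis_measurable_circ unfolding circ_def
    by (subst emeasure_distr) (auto simp: sets_restrict_space intro!: image_eqI[of _ _ UNIV])
  also have "cis -` space circ \<inter> space ?\<mu> = UNIV"
    by auto
  also have "emeasure ?\<mu> UNIV = 1"
    by (subst emeasure_uniform_measure) (auto intro!: ennreal_divide_self)
  finally show ?thesis by simp
qed

lemma finite_measure_circ: "finite_measure circ"
  by (rule finite_measureI) (simp add: emeasure_circ_space)

interpretation circ: finite_measure circ
  by (rule finite_measure_circ)

definition sq_int :: "(complex \<Rightarrow> complex) set" where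
  "sq_int = {f \<in> borel_measurable circ. integrable circ (\<lambda>\<zeta>. (cmod (f \<zeta>))\<^sup>2)}"

definition L_inf :: "(complex \<Rightarrow> complex) set" where
  "L_inf = {f \<in> borel_measurable circ. \<exists>C. AE \<zeta> in circ. cmod (f \<zeta>) \<le> C}"

lemma sq_int_zero: "(\<lambda>_. 0) \<in> sq_int"
  by (simp add: sq_int_def)

lemma sq_int_mult_integrable:
  assumes "f \<in> sq_int" "g \<in> sq_int"
  shows "integrable circ (\<lambda>\<zeta>. f \<zeta> * cnj (g \<zeta>))"
proof (rule Bochner_Integration.integrable_bound)
  show "integrable circ (\<lambda>\<zeta>. (cmod (f \<zeta>))\<^sup>2 + (cmod (g \<zeta>))\<^sup>2)"
    using assms by (auto simp: sq_int_def)
  have "g \<in> borel_measurable circ" "f \<in> borel_measurable circ"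
    using assms by (auto simp: sq_int_def)
  moreover have "cnj \<in> borel_measurable borel"
    by (intro borel_measurable_continuous_onI continuous_intros)
  ultimately show "(\<lambda>\<zeta>. f \<zeta> * cnj (g \<zeta>)) \<in> borel_measurable circ"
    by (intro borel_measurable_times measurable_compose[of g circ borel cnj]) auto
  show "AE \<zeta> in circ. norm (f \<zeta> * cnj (g \<zeta>)) \<le> norm ((cmod (f \<zeta>))\<^sup>2 + (cmod (g \<zeta>))\<^sup>2)"
  proof (rule AE_I2)
    fix \<zeta>
    have "2 * (cmod (f \<zeta>) * cmod (g \<zeta>)) \<le> (cmod (f \<zeta>))\<^sup>2 + (cmod (g \<zeta>))\<^sup>2"
      using sum_squares_bound[of "cmod (f \<zeta>)" "cmod (g \<zeta>)"] by simp
    moreover have "0 \<le> cmod (f \<zeta>) * cmod (g \<zeta>)" by simp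
    ultimately have "cmod (f \<zeta>) * cmod (g \<zeta>) \<le> (cmod (f \<zeta>))\<^sup>2 + (cmod (g \<zeta>))\<^sup>2"
      by linarith
    then show "norm (f \<zeta> * cnj (g \<zeta>)) \<le> norm ((cmod (f \<zeta>))\<^sup>2 + (cmod (g \<zeta>))\<^sup>2)"
      by (simp add: norm_mult)
  qed
qed

lemma sq_int_add:
  assumes "f \<in> sq_int" "g \<in> sq_int"
  shows "(\<lambda>\<zeta>. f \<zeta> + g \<zeta>) \<in> sq_int"
proof -
  have [measurable]: "f \<in> borel_measurable circ" "g \<in> borel_measurable circ"
    using assms by (auto simp: sq_int_def)
  have "integrable circ (\<lambda>\<zeta>. (cmod (f \<zeta> + g \<zeta>))\<^sup>2)"
  proof (rule Bochner_Integration.integrable_bound)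
    show "integrable circ (\<lambda>\<zeta>. 2 * (cmod (f \<zeta>))\<^sup>2 + 2 * (cmod (g \<zeta>))\<^sup>2)"
      using assms by (auto simp: sq_int_def)
    show "AE \<zeta> in circ. norm ((cmod (f \<zeta> + g \<zeta>))\<^sup>2)
        \<le> norm (2 * (cmod (f \<zeta>))\<^sup>2 + 2 * (cmod (g \<zeta>))\<^sup>2)"
    proof (rule AE_I2)
      fix \<zeta>
      have "(cmod (f \<zeta> + g \<zeta>))\<^sup>2 \<le> (cmod (f \<zeta>) + cmod (g \<zeta>))\<^sup>2"
        by (intro power_mono norm_triangle_ineq) auto
      also have "\<dots> \<le> 2 * (cmod (f \<zeta>))\<^sup>2 + 2 * (cmod (g \<zeta>))\<^sup>2"
        using sum_squares_bound[of "cmod (f \<zeta>)" "cmod (g \<zeta>)"] by (simp add: power2_sum)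
      finally show "norm ((cmod (f \<zeta> + g \<zeta>))\<^sup>2)
        \<le> norm (2 * (cmod (f \<zeta>))\<^sup>2 + 2 * (cmod (g \<zeta>))\<^sup>2)" by simp
    qed
  qed measurable
  then show ?thesis by (simp add: sq_int_def)
qed

lemma sq_int_mult:
  assumes "\<phi> \<in> L_inf" "f \<in> sq_int"
  shows "(\<lambda>\<zeta>. \<phi> \<zeta> * f \<zeta>) \<in> sq_int"
proof -
  have [measurable]: "f \<in> borel_measurable circ" "\<phi> \<in> borel_measurable circ"
    using assms by (auto simp: sq_int_def L_inf_def)
  obtain C where C: "AE \<zeta> in circ. cmod (\<phi> \<zeta>) \<le> C"
    using assms by (auto simp: L_inf_def)
  have "integrable circ (\<lambda>\<zeta>. (cmod (\<phi> \<zeta> * f \<zeta>))\<^sup>2)"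
  proof (rule Bochner_Integration.integrable_bound)
    show "integrable circ (\<lambda>\<zeta>. C\<^sup>2 * (cmod (f \<zeta>))\<^sup>2)"
      using assms by (auto simp: sq_int_def)
    show "AE \<zeta> in circ. norm ((cmod (\<phi> \<zeta> * f \<zeta>))\<^sup>2) \<le> norm (C\<^sup>2 * (cmod (f \<zeta>))\<^sup>2)"
      using C by eventually_elim
        (auto simp: norm_mult power_mult_distrib intro!: mult_right_mono power_mono)
  qed measurable
  then show ?thesis by (simp add: sq_int_def)
qed

lemma const_L_inf [simp]: "(\<lambda>_. c) \<in> L_inf"
  by (auto simp: L_inf_def)

lemma sq_int_scale: "f \<in> sq_int \<Longrightarrow> (\<lambda>\<zeta>. c * f \<zeta>) \<in> sq_int"
  using sq_int_mult[of "\<lambda>_. c" f] by simp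

text \<open>Elements of \<open>L\<^sup>2\<close> are classes of square integrable functions modulo a.e. equality.\<close>

quotient_type l2_circ = "complex \<Rightarrow> complex" / partial:
  "\<lambda>f g. f \<in> sq_int \<and> g \<in> sq_int \<and> (AE \<zeta> in circ. f \<zeta> = g \<zeta>)"
proof (rule part_equivpI)
  show "\<exists>x. x \<in> sq_int \<and> x \<in> sq_int \<and> (AE \<zeta> in circ. x \<zeta> = x \<zeta>)"
    by (intro exI[of _ "\<lambda>_. 0"]) (simp add: sq_int_zero)
  show "symp (\<lambda>f g. f \<in> sq_int \<and> g \<in> sq_int \<and> (AE \<zeta> in circ. f \<zeta> = g \<zeta>))"
    by (auto simp: symp_def elim!: eventually_mono)
  show "transp (\<lambda>f g. f \<in> sq_int \<and> g \<in> sq_int \<and> (AE \<zeta> in circ. f \<zeta> = g \<zeta>))"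
    unfolding transp_def
  proof (intro allI impI conjI; (elim conjE)?)
    fix f g h :: "complex \<Rightarrow> complex"
    assume "AE \<zeta> in circ. f \<zeta> = g \<zeta>" "AE \<zeta> in circ. g \<zeta> = h \<zeta>"
    then show "AE \<zeta> in circ. f \<zeta> = h \<zeta>" by eventually_elim simp
  qed auto
qed

text \<open>The class of \<open>f\<close>; only meaningful for \<open>f \<in> sq_int\<close>.\<close>

abbreviation l2 :: "(complex \<Rightarrow> complex) \<Rightarrow> l2_circ" where
  "l2 \<equiv> abs_l2_circ"

lift_definition scaleC :: "complex \<Rightarrow> l2_circ \<Rightarrow> l2_circ" (infixr \<open>*\<^sub>C\<close> 75)
  is "\<lambda>c f \<zeta>. c * f \<zeta>"
  by (auto intro: sq_int_scale)

lift_definition cinner :: "l2_circ \<Rightarrow> l2_circ \<Rightarrow> complex"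
  is "\<lambda>f g. LINT \<zeta>|circ. f \<zeta> * cnj (g \<zeta>)"
proof -
  fix f f' g g' :: "complex \<Rightarrow> complex"
  assume *: "f \<in> sq_int \<and> f' \<in> sq_int \<and> (AE \<zeta> in circ. f \<zeta> = f' \<zeta>)"
    "g \<in> sq_int \<and> g' \<in> sq_int \<and> (AE \<zeta> in circ. g \<zeta> = g' \<zeta>)"
  show "(LINT \<zeta>|circ. f \<zeta> * cnj (g \<zeta>)) = (LINT \<zeta>|circ. f' \<zeta> * cnj (g' \<zeta>))"
  proof (rule integral_cong_AE)
    show "AE \<zeta> in circ. f \<zeta> * cnj (g \<zeta>) = f' \<zeta> * cnj (g' \<zeta>)"
      using conjunct2[OF conjunct2[OF *(1)]] conjunct2[OF conjunct2[OF *(2)]]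
      by eventually_elim simp
  qed (use * sq_int_mult_integrable in auto)
qed

text \<open>Multiplication by \<open>\<phi> \<in> L\<^sup>\<infinity>\<close>; the value for other \<open>\<phi>\<close> is a dummy.\<close>

lift_definition mult_op :: "(complex \<Rightarrow> complex) \<Rightarrow> l2_circ \<Rightarrow> l2_circ"
  is "\<lambda>\<phi> f \<zeta>. if \<phi> \<in> L_inf then \<phi> \<zeta> * f \<zeta> else 0"
proof -
  fix \<phi> f g :: "complex \<Rightarrow> complex"
  assume *: "f \<in> sq_int \<and> g \<in> sq_int \<and> (AE \<zeta> in circ. f \<zeta> = g \<zeta>)"
  show "(\<lambda>\<zeta>. if \<phi> \<in> L_inf then \<phi> \<zeta> * f \<zeta> else 0) \<in> sq_int \<and>
        (\<lambda>\<zeta>. if \<phi> \<in> L_inf then \<phi> \<zeta> * g \<zeta> else 0) \<in> sq_int \<and>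
        (AE \<zeta> in circ. (if \<phi> \<in> L_inf then \<phi> \<zeta> * f \<zeta> else 0) = (if \<phi> \<in> L_inf then \<phi> \<zeta> * g \<zeta> else 0))"
    using * by (cases "\<phi> \<in> L_inf") (auto simp: sq_int_zero intro: sq_int_mult elim: eventually_mono)
qed

instantiation l2_circ :: real_inner
begin

lift_definition zero_l2_circ :: l2_circ is "\<lambda>_. 0"
  by (simp add: sq_int_zero)

lift_definition plus_l2_circ :: "l2_circ \<Rightarrow> l2_circ \<Rightarrow> l2_circ" is "\<lambda>f g \<zeta>. f \<zeta> + g \<zeta>"
proof (intro conjI; (elim conjE)?)
  fix f f' g g' :: "complex \<Rightarrow> complex"
  assume "AE \<zeta> in circ. f \<zeta> = f' \<zeta>" "AE \<zeta> in circ. g \<zeta> = g' \<zeta>"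
  then show "AE \<zeta> in circ. f \<zeta> + g \<zeta> = f' \<zeta> + g' \<zeta>" by eventually_elim simp
qed (auto intro: sq_int_add)

definition "scaleR_l2_circ r (f :: l2_circ) = complex_of_real r *\<^sub>C f"
definition "uminus_l2_circ (f :: l2_circ) = (-1) *\<^sub>C f"
definition "minus_l2_circ (f :: l2_circ) g = f + - g"
definition "inner_l2_circ (f :: l2_circ) g = Re (cinner f g)"
definition "norm_l2_circ (f :: l2_circ) = sqrt (inner f f)"
definition "sgn_l2_circ (f :: l2_circ) = complex_of_real (inverse (norm f)) *\<^sub>C f"
definition "dist_l2_circ (f :: l2_circ) g = norm (f - g)"
definition "(uniformity :: (l2_circ \<times> l2_circ) filter) = (INF e\<in>{0 <..}. principal {(x, y). dist x y < e})"
definition "open_l2_circ (U :: l2_circ set) =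
  (\<forall>x\<in>U. eventually (\<lambda>(x', y). x' = x \<longrightarrow> y \<in> U) uniformity)"

instance
proof
  fix f g h :: l2_circ and a b :: real
  show "f + g + h = f + (g + h)"
    by transfer (auto simp: add.assoc intro: sq_int_add)
  show "f + g = g + f"
    by transfer (auto simp: add.commute intro: sq_int_add)
  show "0 + f = f"
    by transfer auto
  show "- f + f = 0"
    unfolding uminus_l2_circ_def by transfer (auto intro!: sq_int_add sq_int_scale sq_int_zero)
  show "f - g = f + - g"
    by (simp add: minus_l2_circ_def)
  show "a *\<^sub>R (f + g) = a *\<^sub>R f + a *\<^sub>R g"
    unfolding scaleR_l2_circ_def
    by transfer (auto simp: distrib_left distrib_right mult.assoc intro!: sq_int_add sq_int_scale)
  show "(a + b) *\<^sub>R f = a *\<^sub>R f + b *\<^sub>R f"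
    unfolding scaleR_l2_circ_def
    by transfer (auto simp: distrib_left distrib_right mult.assoc intro!: sq_int_add sq_int_scale)
  show "a *\<^sub>R b *\<^sub>R f = (a * b) *\<^sub>R f"
    unfolding scaleR_l2_circ_def
    by transfer (auto simp: distrib_left distrib_right mult.assoc intro!: sq_int_scale)
  show "1 *\<^sub>R f = f"
    unfolding scaleR_l2_circ_def by transfer auto
  show "sgn f = inverse (norm f) *\<^sub>R f" "dist f g = norm (f - g)"
    by (simp_all add: sgn_l2_circ_def dist_l2_circ_def scaleR_l2_circ_def)
  show "uniformity = (INF e\<in>{0 <..}. principal {(x :: l2_circ, y). dist x y < e})"
    by (rule uniformity_l2_circ_def)
  show "open U = (\<forall>x\<in>U. \<forall>\<^sub>F (x', y) in uniformity. x' = x \<longrightarrow> y \<in> U)" for U :: "l2_circ set"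
    by (rule open_l2_circ_def)
  show "inner f g = inner g f"
    unfolding inner_l2_circ_def
  proof transfer
    fix f g :: "complex \<Rightarrow> complex"
    have "(LINT \<zeta>|circ. g \<zeta> * cnj (f \<zeta>)) = (LINT \<zeta>|circ. cnj (f \<zeta> * cnj (g \<zeta>)))"
      by (intro Bochner_Integration.integral_cong) auto
    also have "\<dots> = cnj (LINT \<zeta>|circ. f \<zeta> * cnj (g \<zeta>))"
      by (rule integral_bounded_linear'[OF bounded_linear_cnj bounded_linear_cnj]) simp
    finally show "Re (LINT \<zeta>|circ. f \<zeta> * cnj (g \<zeta>)) = Re (LINT \<zeta>|circ. g \<zeta> * cnj (f \<zeta>))"
      by simp
  qed
  show "inner (f + g) h = inner f h + inner g h"
    unfolding inner_l2_circ_def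
    by transfer (simp add: algebra_simps sq_int_mult_integrable)
  show "inner (a *\<^sub>R f) g = a * inner f g"
    unfolding inner_l2_circ_def scaleR_l2_circ_def
    by transfer (simp add: mult.assoc)
  have *: "Re (LINT \<zeta>|circ. f \<zeta> * cnj (f \<zeta>)) = (LINT \<zeta>|circ. (cmod (f \<zeta>))\<^sup>2)"
    for f :: "complex \<Rightarrow> complex"
    by (simp only: complex_norm_square[symmetric] integral_complex_of_real Re_complex_of_real)
  show "0 \<le> inner f f"
    unfolding inner_l2_circ_def by transfer (simp add: *)
  show "(inner f f = 0) = (f = 0)"
    unfolding inner_l2_circ_def
  proof transfer
    fix f :: "complex \<Rightarrow> complex"
    assume "f \<in> sq_int \<and> f \<in> sq_int \<and> (AE \<zeta> in circ. f \<zeta> = f \<zeta>)"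
    then have f: "f \<in> sq_int" by blast
    then have "(LINT \<zeta>|circ. (cmod (f \<zeta>))\<^sup>2) = 0 \<longleftrightarrow> (AE \<zeta> in circ. (cmod (f \<zeta>))\<^sup>2 = 0)"
      by (intro integral_nonneg_eq_0_iff_AE) (auto simp: sq_int_def)
    then show "(Re (LINT \<zeta>|circ. f \<zeta> * cnj (f \<zeta>)) = 0) =
        (f \<in> sq_int \<and> (\<lambda>_. 0) \<in> sq_int \<and> (AE \<zeta> in circ. f \<zeta> = 0))"
      using f by (simp add: * sq_int_zero)
  qed
  show "norm f = sqrt (inner f f)"
    by (simp add: norm_l2_circ_def)
qed

end

global_interpretation cvec: vector_space scaleC
  by unfold_locales (transfer; auto simp: distrib_left distrib_right mult.assoc intro!: sq_int_add sq_int_scale)+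


section \<open>Hardy space, model spaces, truncated Toeplitz operators\<close>

text \<open>\<open>H\<^sup>2\<close> of the disc, and its copy in \<open>L\<^sup>2\<close> formed by the radial boundary values.\<close>

definition hardy_disc :: "(complex \<Rightarrow> complex) set" where
  "hardy_disc = {F. F holomorphic_on ball 0 1 \<and>
     bdd_above ((\<lambda>r. LINT \<zeta>|circ. (cmod (F (of_real r * \<zeta>)))\<^sup>2) ` {0..<1})}"

definition hardy_space :: "l2_circ set" where
  "hardy_space = {g. \<exists>F\<in>hardy_disc.
     AE \<zeta> in circ. ((\<lambda>r. F (of_real r * \<zeta>)) \<longlongrightarrow> rep_l2_circ g \<zeta>) (at_left 1)}"

text \<open>\<open>model_space B\<close> is \<open>K\<^sub>B = H\<^sup>2 \<ominus> B H\<^sup>2\<close>; the inner function \<open>B\<close> enters through its values on the circle.\<close>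

definition model_space :: "(complex \<Rightarrow> complex) \<Rightarrow> l2_circ set" where
  "model_space B = {g \<in> hardy_space. \<forall>h\<in>hardy_space. cinner g (mult_op B h) = 0}"

definition orth_proj :: "l2_circ set \<Rightarrow> l2_circ \<Rightarrow> l2_circ" where
  "orth_proj K g = (THE y. y \<in> K \<and> (\<forall>k\<in>K. cinner (g - y) k = 0))"

text \<open>
  An operator on a subspace \<open>K\<close> is represented by a function on all of \<open>l2_circ\<close>, of which only the
  restriction to \<open>K\<close> is used; the notions below take \<open>K\<close> as an explicit argument.
\<close>

definition tto :: "(complex \<Rightarrow> complex) \<Rightarrow> (complex \<Rightarrow> complex) \<Rightarrow> l2_circ \<Rightarrow> l2_circ" where
  "tto B \<phi> g = orth_proj (model_space B) (mult_op \<phi> g)"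

definition rank_one :: "l2_circ \<Rightarrow> l2_circ \<Rightarrow> l2_circ \<Rightarrow> l2_circ" where
  "rank_one u v g = cinner g v *\<^sub>C u"

definition clark_op :: "(complex \<Rightarrow> complex) \<Rightarrow> complex \<Rightarrow> l2_circ \<Rightarrow> l2_circ" where
  "clark_op B \<alpha> g = tto B (\<lambda>\<zeta>. \<zeta>) g + \<alpha> *\<^sub>C rank_one (l2 (\<lambda>_. 1)) (l2 (\<lambda>\<zeta>. cnj \<zeta> * B \<zeta>)) g"


section \<open>Norm, trace and functional calculi of operators on a subspace\<close>

definition op_norm :: "l2_circ set \<Rightarrow> (l2_circ \<Rightarrow> l2_circ) \<Rightarrow> real" where
  "op_norm K T = (SUP g\<in>{g \<in> K. norm g \<le> 1}. norm (T g))"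

definition orthonormal_basis :: "l2_circ set \<Rightarrow> l2_circ set \<Rightarrow> bool" where
  "orthonormal_basis K E \<longleftrightarrow> finite E \<and>
     (\<forall>e\<in>E. \<forall>e'\<in>E. cinner e e' = (if e = e' then 1 else 0)) \<and> cvec.span E = K"

text \<open>Trace of an operator on a finite-dimensional subspace.\<close>

definition op_trace :: "l2_circ set \<Rightarrow> (l2_circ \<Rightarrow> l2_circ) \<Rightarrow> complex" where
  "op_trace K T = (let E = (SOME E. orthonormal_basis K E) in \<Sum>e\<in>E. cinner (T e) e)"

definition op_spectrum :: "l2_circ set \<Rightarrow> (l2_circ \<Rightarrow> l2_circ) \<Rightarrow> complex set" where
  "op_spectrum K T = {w. \<not> bij_betw (\<lambda>g. w *\<^sub>C g - T g) K K}"

definition resolvent :: "l2_circ set \<Rightarrow> (l2_circ \<Rightarrow> l2_circ) \<Rightarrow> complex \<Rightarrow> l2_circ \<Rightarrow> l2_circ" where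
  "resolvent K T w = inv_into K (\<lambda>g. w *\<^sub>C g - T g)"

text \<open>
  The holomorphic (Riesz--Dunford) functional calculus
  \<open>f(T) = (2\<pi>\<i>)\<^sup>-\<^sup>1 \<integral>\<^sub>\<gamma> f(w) (w - T)\<^sup>-\<^sup>1 dw\<close>, the operator-valued integral being taken weakly.
  Here \<open>f\<close> is holomorphic on the open set \<open>U\<close> and \<open>\<gamma>\<close> is any contour that winds once around
  the spectrum within \<open>U\<close>. A single closed path can serve as \<open>\<gamma>\<close> whenever the spectrum lies in one
  component of \<open>U\<close>, in particular when it lies in a convex subset of \<open>U\<close>.
\<close>

definition surrounds :: "(real \<Rightarrow> complex) \<Rightarrow> complex set \<Rightarrow> complex set \<Rightarrow> bool" where
  "surrounds \<gamma> \<sigma> U \<longleftrightarrow> valid_path \<gamma> \<and> pathfinish \<gamma> = pathstart \<gamma> \<and> path_image \<gamma> \<subseteq> U - \<sigma> \<and>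
     (\<forall>w\<in>\<sigma>. winding_number \<gamma> w = 1) \<and> (\<forall>w. w \<notin> U \<longrightarrow> winding_number \<gamma> w = 0)"

definition holomorphic_calculus ::
  "l2_circ set \<Rightarrow> complex set \<Rightarrow> (complex \<Rightarrow> complex) \<Rightarrow> (l2_circ \<Rightarrow> l2_circ) \<Rightarrow> l2_circ \<Rightarrow> l2_circ" where
  "holomorphic_calculus K U f T g =
     (let \<gamma> = (SOME \<gamma>. surrounds \<gamma> (op_spectrum K T) U) in
        THE y. y \<in> K \<and> (\<forall>k\<in>K. cinner y k =
          contour_integral \<gamma> (\<lambda>w. f w * cinner (resolvent K T w g) k) / (2 * of_real pi * \<i>)))"

text \<open>
  The continuous functional calculus of a unitary operator \<open>U\<close> on \<open>K\<close>: \<open>h(U)\<close> is the limit of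
  \<open>p(U)\<close> as the Laurent polynomials \<open>p\<close> tend to \<open>h\<close> uniformly on the spectrum of \<open>U\<close>.
\<close>

definition op_powi :: "l2_circ set \<Rightarrow> (l2_circ \<Rightarrow> l2_circ) \<Rightarrow> int \<Rightarrow> l2_circ \<Rightarrow> l2_circ" where
  "op_powi K U k = (if 0 \<le> k then U ^^ nat k else inv_into K U ^^ nat (- k))"

definition unitary_calculus ::
  "l2_circ set \<Rightarrow> (complex \<Rightarrow> complex) \<Rightarrow> (l2_circ \<Rightarrow> l2_circ) \<Rightarrow> l2_circ \<Rightarrow> l2_circ" where
  "unitary_calculus K h U g =
     (THE y. y \<in> K \<and> (\<forall>\<epsilon>>0. \<exists>\<delta>>0. \<forall>(n::nat) c.
        (\<forall>w\<in>op_spectrum K U. cmod ((\<Sum>k\<in>{- int n..int n}. c k * w powi k) - h w) < \<delta>) \<longrightarrow>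
        norm ((\<Sum>k\<in>{- int n..int n}. c k *\<^sub>C op_powi K U k g) - y) < \<epsilon>))"


section \<open>Blaschke products and essential range\<close>

definition blaschke :: "(nat \<Rightarrow> complex) \<Rightarrow> nat \<Rightarrow> complex \<Rightarrow> complex" where
  "blaschke \<Lambda> N \<zeta> = (\<Prod>j<N. (if \<Lambda> j = 0 then 1 else cnj (\<Lambda> j) / of_real (cmod (\<Lambda> j))) *
     ((\<zeta> - \<Lambda> j) / (1 - cnj (\<Lambda> j) * \<zeta>)))"

definition beta :: "(nat \<Rightarrow> complex) \<Rightarrow> nat \<Rightarrow> complex \<Rightarrow> complex" where
  "beta \<Lambda> N \<zeta> = of_real (1 / cmod (deriv (blaschke \<Lambda> N) \<zeta>))"

text \<open>On the circle \<open>N \<mapsto> \<bar>B\<^sub>N'(\<zeta>)\<bar>\<close> is nondecreasing, so a finite limit is the same as convergence.\<close>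

definition limit_set :: "(nat \<Rightarrow> complex) \<Rightarrow> complex set" where
  "limit_set \<Lambda> = {\<zeta> \<in> sphere 0 1. convergent (\<lambda>N. cmod (deriv (blaschke \<Lambda> N) \<zeta>))}"

definition ess_range :: "(complex \<Rightarrow> complex) \<Rightarrow> complex set" where
  "ess_range \<phi> = {w. \<forall>\<epsilon>>0. emeasure circ {\<zeta> \<in> space circ. dist (\<phi> \<zeta>) w < \<epsilon>} > 0}"

end

theory Submission
  imports Defs "HOL-Computational_Algebra.Fundamental_Theorem_Algebra"
begin

text \<open>
  Everything is expressed through the reproducing kernels \<open>k\<^sub>\<zeta>\<close> of the model spaces \<open>K\<^sub>B\<close>, \<open>B = B\<^sub>N\<close>, at
  points \<open>\<zeta>\<close> of the circle. The Takenaka--Malmquist functions form an orthonormal basis of \<open>K\<^sub>B\<close>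
  (\<open>model_space_eq_span\<close>), which gives \<open>\<parallel>k\<^sub>\<zeta>\<parallel>\<^sup>2 = \<bar>B'(\<zeta>)\<bar> = 1/\<beta>\<^sub>N(\<zeta>)\<close> and the Christoffel--Darboux formula
  \<open>(1 - \<zeta>\<^sup>* z) k\<^sub>\<zeta>(z) = 1 - B(\<zeta>)\<^sup>* B(z)\<close> (\<open>kernel_eq\<close>). Membership in the Hardy space enters only through
  integrals against boundary values, which are limits of integrals over smaller circles.

  The norms. The kernels at the \<open>N\<close> points of the level set \<open>{B = \<alpha>}\<close> are an orthogonal eigenbasis of
  the Clark operator, so \<open>\<parallel>\<beta>\<^sub>N(U\<^sub>\<alpha>)\<parallel>\<close> is the largest value of \<open>\<beta>\<^sub>N\<close> on that set (\<open>clark_norm\<close>). If it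
  tends to zero for almost every \<open>\<alpha>\<close>, then the measures of the images \<open>B\<^sub>N({\<bar>B\<^sub>N'\<bar> \<le> c})\<close> tend to zero.
  As \<open>B\<^sub>N\<close> vanishes at the origin it preserves the measure of the circle, hence does not shrink closed
  sets, and \<open>{\<bar>B\<^sub>N'\<bar> \<le> c for all N}\<close> is a null set (\<open>limit_set_null_if_norms\<close>). Conversely, if the norms
  do not tend to zero for some \<open>\<alpha>\<close>, there are points \<open>\<zeta>\<^sub>N\<close> with \<open>B\<^sub>N(\<zeta>\<^sub>N) = \<alpha>\<close> and \<open>\<bar>B\<^sub>N'(\<zeta>\<^sub>N)\<bar> \<le> c\<close> for
  infinitely many \<open>N\<close>. By the Cauchy--Schwarz inequality for the kernels \<open>B\<^sub>N\<close> is \<open>c\<close>-Lipschitz on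
  \<open>{\<bar>B\<^sub>N'\<bar> \<le> c}\<close>, and at points of the exceptional set \<open>(-1)\<^sup>N B\<^sub>N\<close> converges; so \<open>\<alpha>\<close> is, up to sign, the
  value of this limit at an accumulation point of the \<open>\<zeta>\<^sub>N\<close>. The limit is Lipschitz on
  \<open>{\<bar>B\<^sub>N'\<bar> \<le> c for all N}\<close>, and a Lipschitz image of a null set is null (\<open>circ_lipschitz_null_image\<close>).

  The traces. The trace of \<open>T\<^sub>B(\<beta>\<^sub>N) X\<close> is the mean over \<open>\<zeta>\<close> of the quadratic form of \<open>X\<close> at the normalized
  kernel (\<open>trace_tto_beta\<close>). Where \<open>\<bar>B\<^sub>N'(\<zeta>)\<bar>\<close> tends to infinity the normalized kernels concentrate at
  \<open>\<zeta>\<close>, so they are approximate eigenvectors of \<open>T\<^sub>B(\<phi>)\<close> with eigenvalue \<open>\<phi>(\<zeta>)\<close>. On a contour around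
  the convex hull of the values of \<open>\<phi>\<close> the resolvents are bounded uniformly in \<open>N\<close>, which transfers this
  to \<open>f(T\<^sub>B(\<phi>))\<close> (\<open>calculus_approximate_eigenvector\<close>), and dominated convergence gives the limit
  (\<open>trace_limit\<close>). The functional calculus is defined through an unspecified contour around the spectrum;
  a matrix coefficient of the resolvent is a rational function with poles in the spectrum, and its
  integral depends only on the winding numbers (\<open>contour_integral_resolvent\<close>). For the converse,
  \<open>\<phi> = z + z\<^sup>*\<close> suffices: the form of \<open>T\<^sub>B(\<phi>\<^sup>2) - T\<^sub>B(\<phi>)\<^sup>2\<close> at \<open>k\<^sub>\<zeta>\<close> is at least \<open>1\<close>, so the difference of
  two traces with the same limit is at least the mean of \<open>\<beta>\<^sub>N\<close> (\<open>compression_square_defect\<close>).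
\<close>

section \<open>Integration over the circle\<close>

lemma circ_continuous_measurable:
  "continuous_on (sphere 0 1) f \<Longrightarrow> f \<in> borel_measurable circ"
  using borel_measurable_continuous_on_restrict[of "sphere 0 1" f]
  by (simp cong: measurable_cong_sets add: sets_circ)

lemma circ_continuous_bounded:
  fixes f :: "complex \<Rightarrow> 'b::real_normed_vector"
  assumes "continuous_on (sphere 0 1) f"
  obtains C where "C > 0" "\<And>\<zeta>. cmod \<zeta> = 1 \<Longrightarrow> norm (f \<zeta>) \<le> C"
proof -
  have "compact (f ` sphere 0 1)"
    by (rule compact_continuous_image[OF assms]) simp
  then have "bounded (f ` sphere 0 1)"
    by (rule compact_imp_bounded)
  then obtain C where "C > 0" "\<forall>y\<in>f ` sphere 0 1. norm y \<le> C"
    unfolding bounded_pos by blast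
  then show ?thesis
    by (intro that[of C]) auto
qed

lemma closed_circle_compact:
  fixes F :: "complex set"
  assumes "closed F" "F \<subseteq> sphere 0 1"
  shows "compact F"
  using closed_Int_compact[OF assms(1) compact_sphere[of 0 1]] assms(2) by (simp add: Int_absorb2)

lemma circ_AE_I: "(\<And>\<zeta>. cmod \<zeta> = 1 \<Longrightarrow> P \<zeta>) \<Longrightarrow> AE \<zeta> in circ. P \<zeta>"
  by (rule AE_I2) auto

lemma circ_bounded_integrable:
  fixes f :: "complex \<Rightarrow> 'b::{banach, second_countable_topology}"
  assumes "f \<in> borel_measurable circ" "AE \<zeta> in circ. norm (f \<zeta>) \<le> C"
  shows "integrable circ f"
  by (rule circ.integrable_const_bound[OF assms(2,1)])

lemma circ_continuous_integrable:
  fixes f :: "complex \<Rightarrow> 'b::{banach, second_countable_topology}"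
  assumes "continuous_on (sphere 0 1) f"
  shows "integrable circ f"
proof -
  obtain C where "\<And>\<zeta>. cmod \<zeta> = 1 \<Longrightarrow> norm (f \<zeta>) \<le> C"
    using circ_continuous_bounded[OF assms] by metis
  then show ?thesis
    by (intro circ_bounded_integrable[of f C] circ_continuous_measurable assms circ_AE_I)
qed

lemma continuous_sq_int:
  assumes "continuous_on (sphere 0 1) f"
  shows "f \<in> sq_int"
  unfolding sq_int_def
  using assms by (auto intro!: circ_continuous_measurable circ_continuous_integrable continuous_intros)

lemma continuous_L_inf:
  assumes "continuous_on (sphere 0 1) f"
  shows "f \<in> L_inf"
proof -
  obtain C where "\<And>\<zeta>. cmod \<zeta> = 1 \<Longrightarrow> norm (f \<zeta>) \<le> C"
    using circ_continuous_bounded[OF assms] by metis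
  then show ?thesis
    unfolding L_inf_def using assms by (auto intro!: circ_continuous_measurable circ_AE_I)
qed

lemma measure_circ: "measure circ (sphere 0 1) = 1"
  using emeasure_circ_space by (simp add: measure_def)

lemma circ_integral_mono:
  fixes f g :: "complex \<Rightarrow> real"
  assumes "integrable circ f" "integrable circ g" "\<And>\<zeta>. cmod \<zeta> = 1 \<Longrightarrow> f \<zeta> \<le> g \<zeta>"
  shows "(LINT \<zeta>|circ. f \<zeta>) \<le> (LINT \<zeta>|circ. g \<zeta>)"
  by (rule integral_mono) (use assms in auto)

lemma circ_integral_cong:
  assumes "\<And>\<zeta>. cmod \<zeta> = 1 \<Longrightarrow> f \<zeta> = g \<zeta>"
  shows "(LINT \<zeta>|circ. f \<zeta>) = (LINT \<zeta>|circ. g \<zeta>)"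
  by (rule Bochner_Integration.integral_cong) (use assms in auto)

lemma uniform_angle_density:
  "uniform_measure lborel {0..2 * pi} =
     density lborel (\<lambda>x. ennreal (indicator {0..2*pi} x / (2 * pi)))"
  unfolding uniform_measure_def
  by (intro density_cong)
    (auto simp: indicator_def divide_ennreal[symmetric] ennreal_1[symmetric] simp del: ennreal_1 intro!: AE_I2)

lemma circ_integral_angle:
  fixes f :: "complex \<Rightarrow> complex"
  assumes "continuous_on (sphere 0 1) f"
  shows "(LINT \<zeta>|circ. f \<zeta>) = integral {0..2*pi} (\<lambda>t. f (cis t)) / (2 * pi)"
proof -
  have m: "f \<in> borel_measurable (restrict_space borel (sphere 0 1))"
    using circ_continuous_measurable[OF assms] by (simp cong: measurable_cong_sets add: sets_circ)
  have c: "continuous_on A (\<lambda>t. f (cis t))" for A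
    by (rule continuous_on_compose2[OF assms]) (auto intro!: continuous_intros)
  have [measurable]: "(\<lambda>t. f (cis t)) \<in> borel_measurable borel"
    using c by (rule borel_measurable_continuous_onI)
  have "(LINT \<zeta>|circ. f \<zeta>) = (LINT t|uniform_measure lborel {0..2*pi}. f (cis t))"
    unfolding circ_def by (rule integral_distr[OF cis_measurable_circ m])
  also have "\<dots> = (LINT t|lborel. (indicator {0..2*pi} t / (2 * pi)) *\<^sub>R f (cis t))"
    unfolding uniform_angle_density by (rule integral_density) auto
  also have "\<dots> = (1 / (2 * pi)) *\<^sub>R (LINT t|lborel. indicator {0..2*pi} t *\<^sub>R f (cis t))"
    by (subst integral_scaleR_right[symmetric]) simp
  also have "(LINT t|lborel. indicator {0..2*pi} t *\<^sub>R f (cis t)) = integral {0..2*pi} (\<lambda>t. f (cis t))"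
    using set_borel_integral_eq_integral(2)[OF borel_integrable_atLeastAtMost'[OF c]]
    unfolding set_lebesgue_integral_def by simp
  finally show ?thesis by (simp add: scaleR_conv_of_real)
qed

lemma circ_integral_contour:
  assumes "continuous_on (sphere 0 1) F"
    and "((\<lambda>u. F u / u) has_contour_integral I) (circlepath 0 1)"
  shows "(LINT \<zeta>|circ. F \<zeta>) = I / (2 * of_real pi * \<i>)"
proof -
  have "((\<lambda>t. F (cis t) / cis t * \<i> * cis t) has_integral I) {0..2*pi}"
    using assms(2) unfolding circlepath_def
    by (subst (asm) has_contour_integral_part_circlepath_iff) (auto simp: pi_gt_zero)
  then have "((\<lambda>t. \<i> * F (cis t)) has_integral I) {0..2*pi}"
    by (simp add: field_simps cis_neq_zero)
  from has_integral_mult_right[OF this, of "-\<i>"]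
  have "((\<lambda>t. F (cis t)) has_integral (- \<i> * I)) {0..2*pi}"
    by (simp add: mult.assoc[symmetric])
  then show ?thesis
    using circ_integral_angle[OF assms(1)] by (simp add: integral_unique field_simps)
qed

lemma circ_emeasure_angle:
  assumes "A \<in> sets circ"
  shows "emeasure circ A = emeasure lborel ({0..2*pi} \<inter> cis -` A) / ennreal (2 * pi)"
proof -
  have m: "cis \<in> measurable (uniform_measure lborel {0..2 * pi}) (restrict_space borel (sphere 0 1))"
    by (rule cis_measurable_circ)
  have A: "A \<in> sets (restrict_space borel (sphere 0 1))"
    using assms by (simp add: sets_circ)
  have "cis -` A \<in> sets lborel"
    using measurable_sets[OF m A] by simp
  then show ?thesis
    unfolding circ_def emeasure_distr[OF m A] by (simp add: emeasure_uniform_measure)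
qed

lemma circ_sets_iff: "A \<in> sets circ \<longleftrightarrow> A \<subseteq> sphere 0 1 \<and> A \<in> sets borel"
  by (simp add: sets_circ sets_restrict_space_iff conj_commute)

lemma circ_null_iff_angle:
  assumes "A \<in> sets circ"
  shows "A \<in> null_sets circ \<longleftrightarrow> {0..2*pi} \<inter> cis -` A \<in> null_sets lborel"
proof -
  have "{0..2*pi} \<inter> cis -` A \<in> sets lborel"
    using measurable_sets[OF cis_measurable_circ, of A] assms by (auto simp: sets_circ)
  then show ?thesis
    using assms by (auto simp: null_sets_def circ_emeasure_angle ennreal_divide_eq_0_iff)
qed

lemma circ_open_not_null:
  assumes "open V" "cmod z = 1" "z \<in> V"
  shows "emeasure circ (sphere 0 1 \<inter> V) > 0"
proof (rule ccontr)
  let ?A = "sphere 0 1 \<inter> V"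
  assume "\<not> 0 < emeasure circ ?A"
  then have "?A \<in> null_sets circ"
    using assms by (auto simp: null_sets_def circ_sets_iff)
  then have null: "{0..2*pi} \<inter> cis -` ?A \<in> null_sets lborel"
    by (subst (asm) circ_null_iff_angle) (use assms in \<open>auto simp: circ_sets_iff\<close>)
  obtain t where t: "0 \<le> t" "t < 2 * pi" "z = cis t"
    using assms(2) Arg2pi_eq[of z] by (metis Arg2pi cis_conv_exp mult_1 of_real_1)
  have op: "open (cis -` V)"
    by (intro open_vimage assms continuous_intros)
  then obtain e where e: "e > 0" "ball t e \<subseteq> cis -` V"
    using t assms(3) unfolding open_contains_ball by blast
  define s where "s = min (t + e) (2 * pi)"
  have "{t<..<s} \<subseteq> {0..2*pi} \<inter> cis -` ?A"
    using t e by (auto simp: s_def dist_real_def)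
  then have "{t<..<s} \<in> null_sets lborel"
    using null_sets_subset[OF null] by auto
  then show False
    using t e(1) by (auto simp: null_sets_def s_def)
qed

section \<open>The inner product of square integrable functions\<close>

lemma l2_eqI: "f \<in> sq_int \<Longrightarrow> g \<in> sq_int \<Longrightarrow> (\<And>\<zeta>. cmod \<zeta> = 1 \<Longrightarrow> f \<zeta> = g \<zeta>) \<Longrightarrow> l2 f = l2 g"
  by (rule Quotient3_rel_abs[OF Quotient3_l2_circ]) (auto intro: circ_AE_I)

lemma l2_eq_AE: "f \<in> sq_int \<Longrightarrow> g \<in> sq_int \<Longrightarrow> (AE \<zeta> in circ. f \<zeta> = g \<zeta>) \<Longrightarrow> l2 f = l2 g"
  by (rule Quotient3_rel_abs[OF Quotient3_l2_circ]) auto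

lemma rep_sq_int [simp]: "rep_l2_circ g \<in> sq_int"
  using Quotient3_rep_reflp[OF Quotient3_l2_circ, of g] by simp

lemma l2_rep [simp]: "l2 (rep_l2_circ g) = g"
  by (rule Quotient3_abs_rep[OF Quotient3_l2_circ])

lemma rep_l2: "f \<in> sq_int \<Longrightarrow> AE \<zeta> in circ. rep_l2_circ (l2 f) \<zeta> = f \<zeta>"
  using rep_abs_rsp_left[OF Quotient3_l2_circ, of f f] by auto

lemma cinner_l2: "f \<in> sq_int \<Longrightarrow> g \<in> sq_int \<Longrightarrow> cinner (l2 f) (l2 g) = (LINT \<zeta>|circ. f \<zeta> * cnj (g \<zeta>))"
  by (rule cinner.abs_eq) auto

lemma add_l2: "f \<in> sq_int \<Longrightarrow> g \<in> sq_int \<Longrightarrow> l2 f + l2 g = l2 (\<lambda>\<zeta>. f \<zeta> + g \<zeta>)"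
  by (rule plus_l2_circ.abs_eq) auto

lemma scaleC_l2: "f \<in> sq_int \<Longrightarrow> c *\<^sub>C l2 f = l2 (\<lambda>\<zeta>. c * f \<zeta>)"
  by (rule scaleC.abs_eq) auto

lemma zero_l2: "0 = l2 (\<lambda>_. 0)"
  by (simp add: zero_l2_circ_def)

lemma mult_op_l2: "\<phi> \<in> L_inf \<Longrightarrow> f \<in> sq_int \<Longrightarrow> mult_op \<phi> (l2 f) = l2 (\<lambda>\<zeta>. \<phi> \<zeta> * f \<zeta>)"
  by (subst mult_op.abs_eq) auto

lemma sq_int_sum: "(\<And>i. i \<in> I \<Longrightarrow> f i \<in> sq_int) \<Longrightarrow> (\<lambda>\<zeta>. \<Sum>i\<in>I. f i \<zeta>) \<in> sq_int"
  by (induction I rule: infinite_finite_induct) (auto simp: sq_int_zero intro: sq_int_add)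

lemma sum_l2: "(\<And>i. i \<in> I \<Longrightarrow> f i \<in> sq_int) \<Longrightarrow> (\<Sum>i\<in>I. l2 (f i)) = l2 (\<lambda>\<zeta>. \<Sum>i\<in>I. f i \<zeta>)"
  by (induction I rule: infinite_finite_induct) (auto simp: zero_l2 add_l2 sq_int_sum)

lemma cinner_add_left: "cinner (f + g) h = cinner f h + cinner g h"
  by transfer (simp add: algebra_simps sq_int_mult_integrable)

lemma cinner_scale_left: "cinner (c *\<^sub>C f) h = c * cinner f h"
  by transfer (simp add: mult.assoc)

lemma cinner_commute: "cinner g f = cnj (cinner f g)"
proof transfer
  fix f g :: "complex \<Rightarrow> complex"
  have "(LINT \<zeta>|circ. g \<zeta> * cnj (f \<zeta>)) = (LINT \<zeta>|circ. cnj (f \<zeta> * cnj (g \<zeta>)))"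
    by (intro Bochner_Integration.integral_cong) auto
  also have "\<dots> = cnj (LINT \<zeta>|circ. f \<zeta> * cnj (g \<zeta>))"
    by (rule integral_bounded_linear'[OF bounded_linear_cnj bounded_linear_cnj]) simp
  finally show "(LINT \<zeta>|circ. g \<zeta> * cnj (f \<zeta>)) = cnj (LINT \<zeta>|circ. f \<zeta> * cnj (g \<zeta>))" .
qed

lemma uminus_scaleC: "- (f :: l2_circ) = (-1) *\<^sub>C f"
  by (rule uminus_l2_circ_def)

lemma cinner_add_right: "cinner h (f + g) = cinner h f + cinner h g"
  by (metis cinner_add_left cinner_commute complex_cnj_add)

lemma cinner_scale_right: "cinner h (c *\<^sub>C f) = cnj c * cinner h f"
  by (metis cinner_scale_left cinner_commute complex_cnj_mult)

lemma cinner_zero_left [simp]: "cinner 0 h = 0"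
  using cinner_add_left[of 0 0 h] by simp

lemma cinner_zero_right [simp]: "cinner h 0 = 0"
  by (metis cinner_zero_left cinner_commute complex_cnj_zero)

lemma cinner_minus_left: "cinner (- f) h = - cinner f h"
  unfolding uminus_scaleC cinner_scale_left by simp

lemma cinner_diff_left: "cinner (f - g) h = cinner f h - cinner g h"
  using cinner_add_left[of f "- g" h] by (simp add: cinner_minus_left)

lemma cinner_diff_right: "cinner h (f - g) = cinner h f - cinner h g"
  by (metis cinner_diff_left cinner_commute complex_cnj_diff)

lemma cinner_sum_left: "cinner (\<Sum>i\<in>I. f i) h = (\<Sum>i\<in>I. cinner (f i) h)"
  by (induction I rule: infinite_finite_induct) (auto simp: cinner_add_left)

lemma cinner_sum_right: "cinner h (\<Sum>i\<in>I. f i) = (\<Sum>i\<in>I. cinner h (f i))"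
  by (induction I rule: infinite_finite_induct) (auto simp: cinner_add_right)

lemma cinner_self: "cinner f f = of_real ((norm f)\<^sup>2)"
proof -
  have "Im (cinner f f) = 0"
    using arg_cong[OF cinner_commute[of f f], of Im] by simp
  moreover have "(norm f)\<^sup>2 = Re (cinner f f)"
    by (metis inner_l2_circ_def power2_norm_eq_inner)
  ultimately show ?thesis
    by (simp add: complex_eq_iff)
qed

lemma norm_scaleC: "norm (c *\<^sub>C f) = cmod c * norm f"
proof -
  have "complex_of_real ((norm (c *\<^sub>C f))\<^sup>2) = of_real ((cmod c * norm f)\<^sup>2)"
    unfolding cinner_self[symmetric] cinner_scale_left cinner_scale_right
    using complex_norm_square[of c] by (simp add: cinner_self power_mult_distrib mult_ac)
  then have "(norm (c *\<^sub>C f))\<^sup>2 = (cmod c * norm f)\<^sup>2"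
    using of_real_eq_iff by blast
  then show ?thesis
    by (simp add: power2_eq_iff_nonneg)
qed

lemma cinner_Cauchy_Schwarz: "cmod (cinner f g) \<le> norm f * norm g"
proof (cases "cinner f g = 0")
  case False
  define u where "u = cnj (sgn (cinner f g))"
  have "cmod u = 1"
    using False by (simp add: u_def norm_sgn)
  have "u * cinner f g = of_real (cmod (cinner f g))"
    unfolding u_def using False
    by (simp add: sgn_eq field_simps complex_norm_square[symmetric] power2_eq_square)
  then have "cmod (cinner f g) = Re (cinner (u *\<^sub>C f) g)"
    by (simp add: cinner_scale_left)
  also have "\<dots> \<le> norm (u *\<^sub>C f) * norm g"
    using norm_cauchy_schwarz[of "u *\<^sub>C f" g] by (simp add: inner_l2_circ_def)
  finally show ?thesis
    using \<open>cmod u = 1\<close> by (simp add: norm_scaleC)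
qed simp

lemma norm_l2_sq:
  assumes "f \<in> sq_int"
  shows "(norm (l2 f))\<^sup>2 = (LINT \<zeta>|circ. (cmod (f \<zeta>))\<^sup>2)"
proof -
  have "complex_of_real ((norm (l2 f))\<^sup>2) = of_real (LINT \<zeta>|circ. (cmod (f \<zeta>))\<^sup>2)"
    unfolding cinner_self[symmetric] cinner_l2[OF assms assms]
    by (simp only: complex_norm_square[symmetric] integral_complex_of_real)
  then show ?thesis
    using of_real_eq_iff by blast
qed

lemma scaleC_diff_right: "c *\<^sub>C (f - g) = c *\<^sub>C f - c *\<^sub>C g"
  by (rule cvec.scale_right_diff_distrib)

section \<open>Boundary values of Hardy functions\<close>

definition disc_algebra :: "(complex \<Rightarrow> complex) set" where
  "disc_algebra = {F. continuous_on (cball 0 1) F \<and> F holomorphic_on ball 0 1}"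

lemma norm_add_square_le:
  "(norm (a + b :: 'a::real_normed_vector))\<^sup>2 \<le> 2 * (norm a)\<^sup>2 + 2 * (norm b)\<^sup>2"
proof -
  have "(norm (a + b))\<^sup>2 \<le> (norm a + norm b)\<^sup>2"
    by (intro power_mono norm_triangle_ineq) auto
  then show ?thesis
    using sum_squares_bound[of "norm a" "norm b"] by (simp add: power2_sum)
qed

lemma dilation_LIMSEQ: "(\<lambda>n. 1 - 1 / real (Suc n)) \<longlonglongrightarrow> 1"
  using tendsto_diff[OF tendsto_const LIMSEQ_inverse_real_of_nat, of 1]
  by (simp add: inverse_eq_divide)

lemma disc_algebra_const [intro]: "(\<lambda>_. c) \<in> disc_algebra"
  by (auto simp: disc_algebra_def)

lemma disc_algebra_id [intro]: "(\<lambda>z. z) \<in> disc_algebra"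
  by (auto simp: disc_algebra_def intro: continuous_intros holomorphic_intros)

lemma disc_algebra_add [intro]:
  "F \<in> disc_algebra \<Longrightarrow> G \<in> disc_algebra \<Longrightarrow> (\<lambda>z. F z + G z) \<in> disc_algebra"
  by (auto simp: disc_algebra_def intro!: continuous_intros holomorphic_intros)

lemma disc_algebra_mult [intro]:
  "F \<in> disc_algebra \<Longrightarrow> G \<in> disc_algebra \<Longrightarrow> (\<lambda>z. F z * G z) \<in> disc_algebra"
  by (auto simp: disc_algebra_def intro!: continuous_intros holomorphic_intros)

lemma disc_algebra_power [intro]: "F \<in> disc_algebra \<Longrightarrow> (\<lambda>z. F z ^ n) \<in> disc_algebra"
  by (auto simp: disc_algebra_def intro!: continuous_intros holomorphic_intros)

lemma poly_disc_algebra [intro, simp]: "poly p \<in> disc_algebra"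
  by (auto simp: disc_algebra_def intro!: continuous_intros holomorphic_intros)

lemma disc_algebra_sphere: "F \<in> disc_algebra \<Longrightarrow> continuous_on (sphere 0 1) F"
  by (auto simp: disc_algebra_def elim: continuous_on_subset)

lemma disc_algebra_sq_int [intro]: "F \<in> disc_algebra \<Longrightarrow> F \<in> sq_int"
  by (intro continuous_sq_int disc_algebra_sphere)

lemma disc_algebra_L_inf [intro]: "F \<in> disc_algebra \<Longrightarrow> F \<in> L_inf"
  by (intro continuous_L_inf disc_algebra_sphere)

lemma disc_algebra_mean_value:
  assumes "F \<in> disc_algebra"
  shows "(LINT \<zeta>|circ. F \<zeta>) = F 0"
proof -
  have "((\<lambda>u. F u / (u - 0)) has_contour_integral (2 * of_real pi * \<i> * F 0)) (circlepath 0 1)"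
    using assms by (intro Cauchy_integral_circlepath) (auto simp: disc_algebra_def)
  then show ?thesis
    using circ_integral_contour[OF disc_algebra_sphere[OF assms]] by simp
qed

lemma cnj_on_sphere: "cmod \<zeta> = 1 \<Longrightarrow> cnj \<zeta> = 1 / \<zeta>"
  by (metis complex_div_cnj div_by_1 mult_1 of_real_1 one_power2)

lemma cnj_mult_on_sphere: "cmod \<zeta> = 1 \<Longrightarrow> \<zeta> * cnj \<zeta> = 1"
  by (metis complex_norm_square of_real_1 one_power2)

lemma disc_algebra_coeff:
  assumes "F \<in> disc_algebra"
  shows "(LINT \<zeta>|circ. F \<zeta> * cnj (\<zeta> ^ n)) = (deriv ^^ n) F 0 / fact n"
proof -
  have c: "continuous_on (sphere 0 1) (\<lambda>\<zeta>. F \<zeta> * cnj (\<zeta> ^ n))"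
    by (intro continuous_intros disc_algebra_sphere assms)
  have "((\<lambda>u. F u / (u - 0) ^ Suc n) has_contour_integral
      (2 * of_real pi * \<i>) / fact n * (deriv ^^ n) F 0) (circlepath 0 1)"
    using Cauchy_has_contour_integral_higher_derivative_circlepath[of 0 1 F 0 n] assms
    by (simp add: disc_algebra_def)
  then have "((\<lambda>u. F u * cnj (u ^ n) / u) has_contour_integral
      (2 * of_real pi * \<i>) / fact n * (deriv ^^ n) F 0) (circlepath 0 1)"
    by (rule has_contour_integral_eq) (auto simp: cnj_on_sphere field_simps)
  from circ_integral_contour[OF c this] show ?thesis by simp
qed

lemma radial_tendsto:
  assumes "continuous_on (cball 0 1) F" "cmod \<zeta> = 1"
  shows "((\<lambda>r. F (of_real r * \<zeta>)) \<longlongrightarrow> F \<zeta>) (at_left 1)"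
proof -
  have "((\<lambda>r. of_real r * \<zeta>) \<longlongrightarrow> of_real 1 * \<zeta>) (at_left (1::real))"
    by (intro tendsto_intros)
  moreover have ev: "\<forall>\<^sub>F r in at_left (1::real). of_real r * \<zeta> \<in> cball 0 1"
    using eventually_at_left_real[OF zero_less_one] by eventually_elim (auto simp: norm_mult assms)
  ultimately show ?thesis
    using assms continuous_on_tendsto_compose[OF assms(1), of "\<lambda>r. of_real r * \<zeta>" \<zeta> "at_left 1"]
    by simp
qed

lemma disc_algebra_hardy [intro]:
  assumes "F \<in> disc_algebra"
  shows "l2 F \<in> hardy_space"
proof -
  have c: "continuous_on (cball 0 1) F" and h: "F holomorphic_on ball 0 1"
    using assms by (auto simp: disc_algebra_def)
  have "bounded (F ` cball 0 1)"
    by (intro compact_imp_bounded compact_continuous_image c) auto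
  then obtain C where "\<forall>x\<in>F ` cball 0 1. cmod x \<le> C"
    unfolding bounded_iff by blast
  then have C: "cmod (F z) \<le> C" if "cmod z \<le> 1" for z
    using that by auto
  have "(LINT \<zeta>|circ. (cmod (F (of_real r * \<zeta>)))\<^sup>2) \<le> C\<^sup>2" if r: "r \<in> {0..<1}" for r :: real
  proof -
    have "continuous_on (sphere 0 1) (\<lambda>\<zeta>. F (of_real r * \<zeta>))"
      using r by (intro continuous_on_compose2[OF c] continuous_intros) (auto simp: norm_mult)
    then have "(LINT \<zeta>|circ. (cmod (F (of_real r * \<zeta>)))\<^sup>2) \<le> (LINT \<zeta>|circ. C\<^sup>2)"
      using r by (intro circ_integral_mono circ_continuous_integrable continuous_intros power_mono C)
        (auto simp: norm_mult)
    then show ?thesis by (simp add: measure_circ)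
  qed
  then have "F \<in> hardy_disc"
    unfolding hardy_disc_def using h by (auto intro!: bdd_aboveI2[where M = "C\<^sup>2"])
  moreover have "AE \<zeta> in circ. ((\<lambda>r. F (of_real r * \<zeta>)) \<longlongrightarrow> rep_l2_circ (l2 F) \<zeta>) (at_left 1)"
    using rep_l2[OF disc_algebra_sq_int[OF assms]] AE_space
    by eventually_elim (use radial_tendsto[OF c] in auto)
  ultimately show ?thesis
    unfolding hardy_space_def by blast
qed

lemma hardy_dilate_disc_algebra:
  assumes "F \<in> hardy_disc" "0 \<le> r" "r < 1"
  shows "(\<lambda>z. F (of_real r * z)) \<in> disc_algebra"
proof -
  have sub: "(\<lambda>z. of_real r * z) ` cball 0 1 \<subseteq> ball (0::complex) 1"
  proof (rule image_subsetI)
    fix z :: complex assume "z \<in> cball 0 1"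
    then have "\<bar>r\<bar> * cmod z \<le> r * 1"
      using assms by (intro mult_mono) auto
    then show "of_real r * z \<in> ball 0 1"
      using assms by (simp add: norm_mult)
  qed
  have h: "F holomorphic_on ball 0 1"
    using assms by (simp add: hardy_disc_def)
  then have "F holomorphic_on (\<lambda>z. of_real r * z) ` cball 0 1"
    using sub holomorphic_on_subset by blast
  then have "(F \<circ> (\<lambda>z. of_real r * z)) holomorphic_on cball 0 1"
    by (intro holomorphic_on_compose holomorphic_intros)
  then show ?thesis
    unfolding disc_algebra_def comp_def
    using holomorphic_on_imp_continuous_on holomorphic_on_subset ball_subset_cball by blast
qed

text \<open>
  The dilates \<open>F(r \<zeta>)\<close> are bounded in \<open>L\<^sup>2\<close> and converge a.e. to the boundary function, and on a
  probability space this forces convergence in \<open>L\<^sup>1\<close>: truncated at height \<open>M\<close> the differences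
  tend to zero by dominated convergence, and what the truncation removes is at most \<open>1/M\<close> times
  an \<open>L\<^sup>2\<close> bound. Hence integrals against boundary values are limits of integrals of functions
  analytic across the circle.
\<close>

lemma hardy_boundary_weak_limit:
  assumes F: "F \<in> hardy_disc" and h: "h \<in> sq_int"
    and lim: "AE \<zeta> in circ. ((\<lambda>r. F (of_real r * \<zeta>)) \<longlongrightarrow> h \<zeta>) (at_left 1)"
    and \<psi>: "continuous_on (sphere 0 1) \<psi>"
  shows "(\<lambda>n. LINT \<zeta>|circ. F (of_real (1 - 1 / real (Suc n)) * \<zeta>) * \<psi> \<zeta>)
    \<longlonglongrightarrow> (LINT \<zeta>|circ. h \<zeta> * \<psi> \<zeta>)"
proof -
  define r where "r n = 1 - 1 / real (Suc n)" for n
  have r: "0 \<le> r n" "r n < 1" for n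
    by (auto simp: r_def)
  have "r \<longlonglongrightarrow> 1"
    unfolding r_def by (rule dilation_LIMSEQ)
  then have r_lim: "filterlim r (at_left 1) sequentially"
    by (intro filterlim_at_withinI) (auto simp: r less_imp_neq)
  define G where "G n \<zeta> = F (of_real (r n) * \<zeta>)" for n \<zeta>
  define D where "D n \<zeta> = cmod (G n \<zeta> - h \<zeta>)" for n \<zeta>
  have Gc: "continuous_on (sphere 0 1) (G n)" for n
    unfolding G_def using disc_algebra_sphere[OF hardy_dilate_disc_algebra[OF F r]] .
  have [measurable]: "h \<in> borel_measurable circ" "G n \<in> borel_measurable circ" for n
    using h circ_continuous_measurable[OF Gc] by (auto simp: sq_int_def)
  have [measurable]: "D n \<in> borel_measurable circ" for n
    unfolding D_def by measurable
  obtain C where C: "\<And>n. (LINT \<zeta>|circ. (cmod (G n \<zeta>))\<^sup>2) \<le> C"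
    using F r unfolding hardy_disc_def bdd_above_def G_def by fastforce
  have hi: "integrable circ (\<lambda>\<zeta>. (cmod (h \<zeta>))\<^sup>2)"
    using h by (simp add: sq_int_def)
  have Gi: "integrable circ (\<lambda>\<zeta>. (cmod (G n \<zeta>))\<^sup>2)" for n
    using continuous_sq_int[OF Gc] by (simp add: sq_int_def)
  define Q where "Q = 2 * C + 2 * (LINT \<zeta>|circ. (cmod (h \<zeta>))\<^sup>2)"
  have D2: "(D n \<zeta>)\<^sup>2 \<le> 2 * (cmod (G n \<zeta>))\<^sup>2 + 2 * (cmod (h \<zeta>))\<^sup>2" for n \<zeta>
    using norm_add_square_le[of "G n \<zeta>" "- h \<zeta>"] by (simp add: D_def)
  have D2i: "integrable circ (\<lambda>\<zeta>. (D n \<zeta>)\<^sup>2)" for n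
    by (rule Bochner_Integration.integrable_bound[of _ "\<lambda>\<zeta>. 2 * (cmod (G n \<zeta>))\<^sup>2 + 2 * (cmod (h \<zeta>))\<^sup>2"])
      (use D2 hi Gi in auto)
  have D2int: "(LINT \<zeta>|circ. (D n \<zeta>)\<^sup>2) \<le> Q" for n
  proof -
    have "(LINT \<zeta>|circ. (D n \<zeta>)\<^sup>2) \<le> (LINT \<zeta>|circ. 2 * (cmod (G n \<zeta>))\<^sup>2 + 2 * (cmod (h \<zeta>))\<^sup>2)"
      using D2 D2i hi Gi by (intro integral_mono) auto
    also have "\<dots> \<le> Q"
      using C[of n] hi Gi by (simp add: Q_def)
    finally show ?thesis .
  qed
  have D_lim: "AE \<zeta> in circ. (\<lambda>n. D n \<zeta>) \<longlonglongrightarrow> 0"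
    using lim
  proof eventually_elim
    case (elim \<zeta>)
    then have "(\<lambda>n. G n \<zeta>) \<longlonglongrightarrow> h \<zeta>"
      unfolding G_def using filterlim_compose[OF _ r_lim] by blast
    then show ?case
      unfolding D_def using tendsto_norm_zero LIM_zero by blast
  qed
  have lin: "x \<le> 1 + x\<^sup>2" for x :: real
    using zero_le_power2[of "x - 1/2"] zero_le_power2[of x]
    by (simp add: power2_eq_square algebra_simps)
  have Di: "integrable circ (D n)" for n
    by (rule Bochner_Integration.integrable_bound[of _ "\<lambda>\<zeta>. 1 + (D n \<zeta>)\<^sup>2"])
      (use D2i lin in \<open>auto simp: D_def\<close>)
  have "(\<lambda>n. LINT \<zeta>|circ. D n \<zeta>) \<longlonglongrightarrow> 0"
  proof (rule LIMSEQ_I)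
    fix e :: real assume e: "e > 0"
    have "Q \<ge> 0"
      using D2int[of 0] by (rule order_trans[rotated]) simp
    \<comment> \<open>High enough that the part above the truncation contributes less than \<open>e/2\<close>.\<close>
    define M where "M = 2 * (Q + 1) / e"
    have M: "M > 0" "Q / M < e / 2"
      using e \<open>Q \<ge> 0\<close> by (auto simp: M_def field_simps)
    have "(\<lambda>n. LINT \<zeta>|circ. min (D n \<zeta>) M) \<longlonglongrightarrow> (LINT \<zeta>|circ. 0 :: real)"
    proof (rule integral_dominated_convergence[where w = "\<lambda>_. M"])
      show "AE \<zeta> in circ. (\<lambda>n. min (D n \<zeta>) M) \<longlonglongrightarrow> 0"
        using D_lim
      proof eventually_elim
        case (elim \<zeta>)
        then show ?case
          using tendsto_min[OF elim tendsto_const, of M] M by simp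
      qed
      show "AE \<zeta> in circ. norm (min (D n \<zeta>) M) \<le> M" for n
        using M by (auto simp: D_def)
    qed auto
    then have "\<forall>\<^sub>F n in sequentially. (LINT \<zeta>|circ. min (D n \<zeta>) M) < e / 2"
      using e by (intro order_tendstoD(2)) auto
    then obtain N where N: "\<And>n. n \<ge> N \<Longrightarrow> (LINT \<zeta>|circ. min (D n \<zeta>) M) < e / 2"
      by (auto simp: eventually_sequentially)
    have "norm ((LINT \<zeta>|circ. D n \<zeta>) - 0) < e" if "n \<ge> N" for n
    proof -
      have pt: "D n \<zeta> \<le> min (D n \<zeta>) M + (D n \<zeta>)\<^sup>2 / M" for \<zeta>
      proof (cases "D n \<zeta> \<le> M")
        case False
        then have "D n \<zeta> * M \<le> (D n \<zeta>)\<^sup>2"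
          using M by (simp add: power2_eq_square mult_left_mono)
        then have "D n \<zeta> \<le> (D n \<zeta>)\<^sup>2 / M"
          using M by (simp add: field_simps)
        moreover have "0 \<le> min (D n \<zeta>) M"
          using M by (simp add: D_def)
        ultimately show ?thesis by linarith
      qed (use M in simp)
      have mi: "integrable circ (\<lambda>\<zeta>. min (D n \<zeta>) M)"
        using M by (intro circ_bounded_integrable[where C = M]) (auto simp: D_def)
      have "(LINT \<zeta>|circ. D n \<zeta>) \<le> (LINT \<zeta>|circ. min (D n \<zeta>) M + (D n \<zeta>)\<^sup>2 / M)"
        using pt Di D2i mi by (intro integral_mono) auto
      also have "\<dots> = (LINT \<zeta>|circ. min (D n \<zeta>) M) + (LINT \<zeta>|circ. (D n \<zeta>)\<^sup>2) / M"
        using D2i mi by simp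
      also have "\<dots> < e / 2 + Q / M"
        using N[OF that] D2int[of n] M by (intro add_less_le_mono divide_right_mono) auto
      also have "\<dots> < e" using M(2) by linarith
      finally show ?thesis
        by (simp add: D_def)
    qed
    then show "\<exists>N. \<forall>n\<ge>N. norm ((LINT \<zeta>|circ. D n \<zeta>) - 0) < e" by blast
  qed
  obtain B where B: "\<And>\<zeta>. cmod \<zeta> = 1 \<Longrightarrow> cmod (\<psi> \<zeta>) \<le> B"
    using circ_continuous_bounded[OF \<psi>] by metis
  have [measurable]: "\<psi> \<in> borel_measurable circ"
    using \<psi> by (rule circ_continuous_measurable)
  have hpi: "integrable circ (\<lambda>\<zeta>. h \<zeta> * \<psi> \<zeta>)"
    using sq_int_mult_integrable[OF h continuous_sq_int[of "\<lambda>\<zeta>. cnj (\<psi> \<zeta>)"]] \<psi>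
    by (simp add: continuous_on_cnj)
  have Gpi: "integrable circ (\<lambda>\<zeta>. G n \<zeta> * \<psi> \<zeta>)" for n
    by (intro circ_continuous_integrable continuous_intros Gc \<psi>)
  have "(\<lambda>n. (LINT \<zeta>|circ. G n \<zeta> * \<psi> \<zeta>) - (LINT \<zeta>|circ. h \<zeta> * \<psi> \<zeta>)) \<longlonglongrightarrow> 0"
  proof (rule Lim_null_comparison)
    show "\<forall>\<^sub>F n in sequentially. norm ((LINT \<zeta>|circ. G n \<zeta> * \<psi> \<zeta>) - (LINT \<zeta>|circ. h \<zeta> * \<psi> \<zeta>))
        \<le> B * (LINT \<zeta>|circ. D n \<zeta>)"
    proof (intro always_eventually allI)
      fix n
      have "norm ((LINT \<zeta>|circ. G n \<zeta> * \<psi> \<zeta>) - (LINT \<zeta>|circ. h \<zeta> * \<psi> \<zeta>))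
          = norm (LINT \<zeta>|circ. G n \<zeta> * \<psi> \<zeta> - h \<zeta> * \<psi> \<zeta>)"
        using hpi Gpi by simp
      also have "\<dots> \<le> (LINT \<zeta>|circ. norm (G n \<zeta> * \<psi> \<zeta> - h \<zeta> * \<psi> \<zeta>))"
        by (rule integral_norm_bound)
      also have "\<dots> \<le> (LINT \<zeta>|circ. B * D n \<zeta>)"
      proof (rule circ_integral_mono)
        fix \<zeta> assume "cmod \<zeta> = 1"
        then have "cmod (\<psi> \<zeta>) * D n \<zeta> \<le> B * D n \<zeta>"
          by (intro mult_right_mono B) (auto simp: D_def)
        moreover have "norm (G n \<zeta> * \<psi> \<zeta> - h \<zeta> * \<psi> \<zeta>) = cmod (\<psi> \<zeta>) * D n \<zeta>"
          by (simp add: D_def norm_mult[symmetric] algebra_simps)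
        ultimately show "norm (G n \<zeta> * \<psi> \<zeta> - h \<zeta> * \<psi> \<zeta>) \<le> B * D n \<zeta>"
          by simp
      qed (use hpi Gpi Di in auto)
      finally show "norm ((LINT \<zeta>|circ. G n \<zeta> * \<psi> \<zeta>) - (LINT \<zeta>|circ. h \<zeta> * \<psi> \<zeta>))
        \<le> B * (LINT \<zeta>|circ. D n \<zeta>)" by simp
    qed
    show "(\<lambda>n. B * (LINT \<zeta>|circ. D n \<zeta>)) \<longlonglongrightarrow> 0"
      using tendsto_mult_right_zero[OF \<open>(\<lambda>n. LINT \<zeta>|circ. D n \<zeta>) \<longlonglongrightarrow> 0\<close>] .
  qed
  then show ?thesis
    unfolding G_def r_def by (rule LIM_zero_cancel)
qed

lemma hardy_spaceE:
  assumes "h \<in> hardy_space"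
  obtains F where "F \<in> hardy_disc"
    "AE \<zeta> in circ. ((\<lambda>r. F (of_real r * \<zeta>)) \<longlongrightarrow> rep_l2_circ h \<zeta>) (at_left 1)"
  using assms unfolding hardy_space_def by blast

lemma cinner_rep_l2:
  assumes "continuous_on (sphere 0 1) \<psi>"
  shows "cinner h (l2 \<psi>) = (LINT \<zeta>|circ. rep_l2_circ h \<zeta> * cnj (\<psi> \<zeta>))"
  using cinner_l2[OF rep_sq_int[of h] continuous_sq_int[OF assms]] by simp

text \<open>
  The inner product is the mean of \<open>\<zeta> \<psi>(\<zeta>) h(\<zeta>)\<close>, the boundary function of an analytic function that
  vanishes at the origin.
\<close>

lemma hardy_orthogonal_coanalytic:
  assumes "h \<in> hardy_space" "\<psi> \<in> disc_algebra"
  shows "cinner h (l2 (\<lambda>\<zeta>. cnj (\<zeta> * \<psi> \<zeta>))) = 0"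
proof -
  obtain F where F: "F \<in> hardy_disc"
    and lim: "AE \<zeta> in circ. ((\<lambda>r. F (of_real r * \<zeta>)) \<longlongrightarrow> rep_l2_circ h \<zeta>) (at_left 1)"
    using assms(1) by (rule hardy_spaceE)
  have c: "continuous_on (sphere 0 1) (\<lambda>\<zeta>. \<zeta> * \<psi> \<zeta>)"
    by (intro continuous_intros disc_algebra_sphere assms)
  have z: "(LINT \<zeta>|circ. F (of_real (1 - 1 / real (Suc n)) * \<zeta>) * (\<zeta> * \<psi> \<zeta>)) = 0" for n
  proof -
    have "(\<lambda>\<zeta>. F (of_real (1 - 1 / real (Suc n)) * \<zeta>)) \<in> disc_algebra"
      by (rule hardy_dilate_disc_algebra[OF F]) auto
    then have "(\<lambda>\<zeta>. F (of_real (1 - 1 / real (Suc n)) * \<zeta>) * (\<zeta> * \<psi> \<zeta>)) \<in> disc_algebra"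
      by (intro disc_algebra_mult disc_algebra_id assms)
    from disc_algebra_mean_value[OF this] show ?thesis by simp
  qed
  have "(LINT \<zeta>|circ. rep_l2_circ h \<zeta> * (\<zeta> * \<psi> \<zeta>)) = 0"
    using hardy_boundary_weak_limit[OF F rep_sq_int lim c] unfolding z
    by (simp add: LIMSEQ_const_iff)
  then show ?thesis
    using cinner_rep_l2[OF continuous_on_cnj[OF c], of h] by simp
qed

text \<open>
  The inner products with the powers of \<open>\<zeta>\<close> are limits of Taylor coefficients of dilates of the
  analytic function behind \<open>h\<close>, so they determine that function.
\<close>

lemma hardy_eq_0I:
  assumes "h \<in> hardy_space" "\<And>n. cinner h (l2 (\<lambda>\<zeta>. \<zeta> ^ n)) = 0"
  shows "h = 0"
proof -
  obtain F where F: "F \<in> hardy_disc"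
    and lim: "AE \<zeta> in circ. ((\<lambda>r. F (of_real r * \<zeta>)) \<longlongrightarrow> rep_l2_circ h \<zeta>) (at_left 1)"
    using assms(1) by (rule hardy_spaceE)
  have hol: "F holomorphic_on ball 0 1"
    using F by (simp add: hardy_disc_def)
  have "(deriv ^^ n) F 0 = 0" for n
  proof -
    have c: "continuous_on (sphere 0 1) (\<lambda>\<zeta>::complex. \<zeta> ^ n)"
      "continuous_on (sphere 0 1) (\<lambda>\<zeta>::complex. cnj (\<zeta> ^ n))"
      by (intro continuous_intros)+
    define r where "r m = 1 - 1 / real (Suc m)" for m
    have r: "0 \<le> r m" "r m < 1" for m
      by (auto simp: r_def)
    have "r \<longlonglongrightarrow> 1"
      unfolding r_def by (rule dilation_LIMSEQ)
    have der: "(deriv ^^ n) (\<lambda>z. F (of_real (r m) * z)) 0 = of_real (r m) ^ n * (deriv ^^ n) F 0" for m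
    proof -
      have "of_real (r m) * z \<in> ball 0 1" if "z \<in> ball 0 1" for z :: complex
      proof -
        have "r m * cmod z \<le> 1 * cmod z"
          using r[of m] by (intro mult_right_mono) auto
        then show ?thesis
          using that r[of m] by (simp add: norm_mult)
      qed
      from higher_deriv_compose_linear[OF hol open_ball[of 0 1] open_ball _ this, where z = 0 and n = n]
      show ?thesis by simp
    qed
    have "(\<lambda>m. LINT \<zeta>|circ. F (of_real (r m) * \<zeta>) * cnj (\<zeta> ^ n))
        \<longlonglongrightarrow> (LINT \<zeta>|circ. rep_l2_circ h \<zeta> * cnj (\<zeta> ^ n))"
      unfolding r_def by (rule hardy_boundary_weak_limit[OF F rep_sq_int lim c(2)])
    also have "(LINT \<zeta>|circ. rep_l2_circ h \<zeta> * cnj (\<zeta> ^ n)) = 0"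
      using assms(2)[of n] cinner_rep_l2[OF c(1)] by simp
    finally have "(\<lambda>m. of_real (r m) ^ n * (deriv ^^ n) F 0 / fact n) \<longlonglongrightarrow> 0"
      by (simp only: disc_algebra_coeff[OF hardy_dilate_disc_algebra[OF F r]] der)
    moreover have "(\<lambda>m. of_real (r m) ^ n * (deriv ^^ n) F 0 / fact n)
        \<longlonglongrightarrow> of_real 1 ^ n * (deriv ^^ n) F 0 / fact n"
      by (intro tendsto_intros \<open>r \<longlonglongrightarrow> 1\<close>) simp
    ultimately show ?thesis
      using LIMSEQ_unique by fastforce
  qed
  then have F0: "F w = 0" if "w \<in> ball 0 1" for w
    using holomorphic_fun_eq_0_on_ball[OF hol that] by simp
  have "AE \<zeta> in circ. rep_l2_circ h \<zeta> = 0"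
    using lim AE_space
  proof eventually_elim
    case (elim \<zeta>)
    have "\<forall>\<^sub>F r in at_left (1::real). F (of_real r * \<zeta>) = 0"
      using eventually_at_left_real[OF zero_less_one] by eventually_elim (use elim F0 in \<open>auto simp: norm_mult\<close>)
    then have "((\<lambda>r. F (of_real r * \<zeta>)) \<longlongrightarrow> 0) (at_left 1)"
      by (rule tendsto_eventually)
    then show ?case
      using elim tendsto_unique trivial_limit_at_left_real by blast
  qed
  then have "l2 (rep_l2_circ h) = l2 (\<lambda>_. 0)"
    by (intro l2_eq_AE) (auto simp: sq_int_zero)
  then show ?thesis by (simp add: zero_l2)
qed

lemma hardy_space_add:
  assumes "g \<in> hardy_space" "h \<in> hardy_space"
  shows "g + h \<in> hardy_space"
proof -
  obtain F where F: "F \<in> hardy_disc"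
    and limF: "AE \<zeta> in circ. ((\<lambda>r. F (of_real r * \<zeta>)) \<longlongrightarrow> rep_l2_circ g \<zeta>) (at_left 1)"
    using assms(1) by (rule hardy_spaceE)
  obtain G where G: "G \<in> hardy_disc"
    and limG: "AE \<zeta> in circ. ((\<lambda>r. G (of_real r * \<zeta>)) \<longlongrightarrow> rep_l2_circ h \<zeta>) (at_left 1)"
    using assms(2) by (rule hardy_spaceE)
  obtain A where A: "\<And>r. r \<in> {0..<1} \<Longrightarrow> (LINT \<zeta>|circ. (cmod (F (of_real r * \<zeta>)))\<^sup>2) \<le> A"
    using F unfolding hardy_disc_def bdd_above_def by (auto simp del: atLeastLessThan_iff)
  obtain B where B: "\<And>r. r \<in> {0..<1} \<Longrightarrow> (LINT \<zeta>|circ. (cmod (G (of_real r * \<zeta>)))\<^sup>2) \<le> B"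
    using G unfolding hardy_disc_def bdd_above_def by (auto simp del: atLeastLessThan_iff)
  have "(LINT \<zeta>|circ. (cmod (F (of_real r * \<zeta>) + G (of_real r * \<zeta>)))\<^sup>2) \<le> 2 * A + 2 * B"
    if r: "r \<in> {0..<1}" for r
  proof -
    have c: "continuous_on (sphere 0 1) (\<lambda>\<zeta>. F (of_real r * \<zeta>))"
      "continuous_on (sphere 0 1) (\<lambda>\<zeta>. G (of_real r * \<zeta>))"
      using r by (auto intro!: disc_algebra_sphere hardy_dilate_disc_algebra F G)
    have i: "integrable circ (\<lambda>\<zeta>. (cmod (F (of_real r * \<zeta>)))\<^sup>2)"
      "integrable circ (\<lambda>\<zeta>. (cmod (G (of_real r * \<zeta>)))\<^sup>2)"
      using c by (auto intro!: circ_continuous_integrable continuous_intros)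
    have "(LINT \<zeta>|circ. (cmod (F (of_real r * \<zeta>) + G (of_real r * \<zeta>)))\<^sup>2)
        \<le> (LINT \<zeta>|circ. 2 * (cmod (F (of_real r * \<zeta>)))\<^sup>2 + 2 * (cmod (G (of_real r * \<zeta>)))\<^sup>2)"
      using c by (intro circ_integral_mono circ_continuous_integrable continuous_intros norm_add_square_le)
    also have "\<dots> \<le> 2 * A + 2 * B"
      using A[OF r] B[OF r] i by simp
    finally show ?thesis .
  qed
  then have "(\<lambda>z. F z + G z) \<in> hardy_disc"
    unfolding hardy_disc_def using F G
    by (auto simp: hardy_disc_def intro!: holomorphic_intros bdd_aboveI2[where M = "2 * A + 2 * B"])
  moreover have "AE \<zeta> in circ. rep_l2_circ (g + h) \<zeta> = rep_l2_circ g \<zeta> + rep_l2_circ h \<zeta>"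
    using rep_l2[OF sq_int_add[OF rep_sq_int rep_sq_int], of g h] add_l2[OF rep_sq_int rep_sq_int, of g h]
    by simp
  then have "AE \<zeta> in circ. ((\<lambda>r. F (of_real r * \<zeta>) + G (of_real r * \<zeta>))
      \<longlongrightarrow> rep_l2_circ (g + h) \<zeta>) (at_left 1)"
    using limF limG by eventually_elim (auto intro: tendsto_add)
  ultimately show ?thesis
    unfolding hardy_space_def by (intro CollectI bexI[of _ "\<lambda>z. F z + G z"])
qed

lemma mult_op_disc_algebra_hardy:
  assumes "F \<in> disc_algebra" "G \<in> disc_algebra"
  shows "mult_op F (l2 G) = l2 (\<lambda>z. F z * G z)" "mult_op F (l2 G) \<in> hardy_space"
  using assms by (auto simp: mult_op_l2 disc_algebra_L_inf disc_algebra_sq_int)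

section \<open>Operators on a finite-dimensional subspace\<close>

text \<open>Operators on \<open>K\<close> are functions on all of \<open>l2_circ\<close> whose values off \<open>K\<close> carry no information.\<close>

definition lin_on :: "l2_circ set \<Rightarrow> (l2_circ \<Rightarrow> l2_circ) \<Rightarrow> bool" where
  "lin_on K T \<longleftrightarrow> (\<forall>g\<in>K. T g \<in> K) \<and> (\<forall>g\<in>K. \<forall>h\<in>K. T (g + h) = T g + T h) \<and>
     (\<forall>g\<in>K. \<forall>c. T (c *\<^sub>C g) = c *\<^sub>C T g)"

lemma lin_onD:
  assumes "lin_on K T"
  shows "g \<in> K \<Longrightarrow> T g \<in> K" "g \<in> K \<Longrightarrow> h \<in> K \<Longrightarrow> T (g + h) = T g + T h"
    "g \<in> K \<Longrightarrow> T (c *\<^sub>C g) = c *\<^sub>C T g"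
  using assms unfolding lin_on_def by auto

text \<open>
  The index set is arbitrary, because a model space is used both with its Takenaka--Malmquist
  basis, which is indexed by the zeros, and with bases of reproducing kernels, which are indexed
  by points of the circle.
\<close>

locale onb =
  fixes I :: "'i set" and e :: "'i \<Rightarrow> l2_circ" and K :: "l2_circ set"
  assumes fin: "finite I"
    and orth: "\<And>i j. i \<in> I \<Longrightarrow> j \<in> I \<Longrightarrow> cinner (e i) (e j) = (if i = j then 1 else 0)"
    and span: "K = cvec.span (e ` I)"
begin

lemma subspace: "cvec.subspace K"
  by (simp add: span)

lemma basis_in [simp]: "i \<in> I \<Longrightarrow> e i \<in> K"
  by (auto simp: span intro: cvec.span_base)

lemma zero_in [simp]: "0 \<in> K"
  using subspace by (rule cvec.subspace_0)

lemma add_in: "g \<in> K \<Longrightarrow> h \<in> K \<Longrightarrow> g + h \<in> K"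
  using subspace by (rule cvec.subspace_add)

lemma diff_in: "g \<in> K \<Longrightarrow> h \<in> K \<Longrightarrow> g - h \<in> K"
  using subspace by (rule cvec.subspace_diff)

lemma scale_in: "g \<in> K \<Longrightarrow> c *\<^sub>C g \<in> K"
  using subspace by (rule cvec.subspace_scale)

lemma sum_in: "(\<And>j. j \<in> J \<Longrightarrow> f j \<in> K) \<Longrightarrow> (\<Sum>j\<in>J. f j) \<in> K"
  using subspace by (rule cvec.subspace_sum)

lemma comb_in [simp]: "(\<Sum>i\<in>I. c i *\<^sub>C e i) \<in> K"
  by (intro sum_in scale_in) auto

lemma coeff_comb: "j \<in> I \<Longrightarrow> cinner (\<Sum>i\<in>I. c i *\<^sub>C e i) (e j) = c j"
  using fin by (simp add: cinner_sum_left cinner_scale_left orth if_distrib[of "(*) _"] cong: if_cong)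

lemma expand: "g \<in> K \<Longrightarrow> (\<Sum>i\<in>I. cinner g (e i) *\<^sub>C e i) = g"
proof -
  let ?A = "{g. (\<Sum>i\<in>I. cinner g (e i) *\<^sub>C e i) = g}"
  have "cvec.subspace ?A"
    by (rule cvec.subspaceI)
      (simp_all add: cinner_add_left cinner_scale_left cvec.scale_left_distrib sum.distrib
        cvec.scale_scale[symmetric] cvec.scale_sum_right[symmetric] del: cvec.scale_scale)
  moreover have "e ` I \<subseteq> ?A"
  proof clarify
    fix j assume j: "j \<in> I"
    have "(\<Sum>i\<in>I. cinner (e j) (e i) *\<^sub>C e i) = (\<Sum>i\<in>I. if i = j then e i else 0)"
      using j by (intro sum.cong) (auto simp: orth)
    then show "(\<Sum>i\<in>I. cinner (e j) (e i) *\<^sub>C e i) = e j"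
      using fin j by simp
  qed
  ultimately have "K \<subseteq> ?A"
    unfolding span by (intro cvec.span_minimal)
  then show "g \<in> K \<Longrightarrow> ?thesis" by auto
qed

lemma cinner_expand:
  assumes "g \<in> K"
  shows "cinner g h = (\<Sum>i\<in>I. cinner g (e i) * cnj (cinner h (e i)))"
  by (subst expand[OF assms, symmetric])
    (simp add: cinner_sum_left cinner_scale_left cinner_commute[of "e _" h])

lemma norm_comb: "(norm (\<Sum>i\<in>I. c i *\<^sub>C e i))\<^sup>2 = (\<Sum>i\<in>I. (cmod (c i))\<^sup>2)"
proof -
  let ?g = "\<Sum>i\<in>I. c i *\<^sub>C e i"
  have "complex_of_real ((norm ?g)\<^sup>2) = (\<Sum>i\<in>I. cinner ?g (e i) * cnj (cinner ?g (e i)))"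
    unfolding cinner_self[symmetric] by (rule cinner_expand) simp
  also have "\<dots> = of_real (\<Sum>i\<in>I. (cmod (c i))\<^sup>2)"
    unfolding of_real_sum by (intro sum.cong refl) (simp only: coeff_comb complex_norm_square)
  finally show ?thesis
    using of_real_eq_iff by blast
qed

lemma parseval: "g \<in> K \<Longrightarrow> (norm g)\<^sup>2 = (\<Sum>i\<in>I. (cmod (cinner g (e i)))\<^sup>2)"
  using norm_comb[of "\<lambda>i. cinner g (e i)"] by (simp add: expand)

lemma eqI_basis:
  assumes "g \<in> K" "h \<in> K" "\<And>i. i \<in> I \<Longrightarrow> cinner g (e i) = cinner h (e i)"
  shows "g = h"
  using expand[OF assms(1)] expand[OF assms(2)] assms(3) by (metis (no_types, lifting) sum.cong)

lemma eqI_cinner: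
  assumes "g \<in> K" "h \<in> K" "\<And>k. k \<in> K \<Longrightarrow> cinner g k = cinner h k"
  shows "g = h"
  using assms by (intro eqI_basis) auto

lemma cinner_projection:
  assumes "k \<in> K"
  shows "cinner (\<Sum>i\<in>I. cinner g (e i) *\<^sub>C e i) k = cinner g k" (is "cinner ?p k = _")
proof -
  have "cinner k ?p = (\<Sum>i\<in>I. cinner k (e i) * cnj (cinner ?p (e i)))"
    by (rule cinner_expand[OF assms])
  also have "\<dots> = (\<Sum>i\<in>I. cinner k (e i) * cnj (cinner g (e i)))"
    by (intro sum.cong) (auto simp: coeff_comb)
  also have "\<dots> = cinner k g"
    by (rule cinner_expand[OF assms, symmetric])
  finally show ?thesis
    by (metis cinner_commute)
qed

lemma orth_proj_eq: "orth_proj K g = (\<Sum>i\<in>I. cinner g (e i) *\<^sub>C e i)" (is "_ = ?p")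
  unfolding orth_proj_def
proof (rule the_equality)
  have p: "cinner ?p k = cinner g k" if "k \<in> K" for k
    using that by (rule cinner_projection)
  then show "?p \<in> K \<and> (\<forall>k\<in>K. cinner (g - ?p) k = 0)"
    by (simp add: cinner_diff_left)
  show "y = ?p" if "y \<in> K \<and> (\<forall>k\<in>K. cinner (g - y) k = 0)" for y
    using that p by (intro eqI_cinner) (auto simp: cinner_diff_left)
qed

lemma orth_proj_in [simp]: "orth_proj K g \<in> K"
  by (simp add: orth_proj_eq)

lemma cinner_orth_proj: "k \<in> K \<Longrightarrow> cinner (orth_proj K g) k = cinner g k"
  by (simp add: orth_proj_eq cinner_projection)

lemma independent: "cvec.independent (e ` I)" and inj_basis: "inj_on e I"
proof -
  show inj: "inj_on e I"
    by (rule inj_onI) (metis orth zero_neq_one)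
  show "cvec.independent (e ` I)"
  proof (rule cvec.independent_if_scalars_zero)
    fix c x assume s: "(\<Sum>x\<in>e ` I. c x *\<^sub>C x) = 0" and x: "x \<in> e ` I"
    then obtain j where j: "j \<in> I" "x = e j" by auto
    have "(\<Sum>i\<in>I. c (e i) *\<^sub>C e i) = 0"
      using s inj by (simp add: sum.reindex)
    then show "c x = 0"
      using coeff_comb[OF j(1), of "\<lambda>i. c (e i)"] j by simp
  qed (use fin in auto)
qed

lemma lin_on_sum:
  assumes "lin_on K T" "finite J" "\<And>j. j \<in> J \<Longrightarrow> f j \<in> K"
  shows "T (\<Sum>j\<in>J. c j *\<^sub>C f j) = (\<Sum>j\<in>J. c j *\<^sub>C T (f j))"
  using assms(2,3)
proof (induction J rule: finite_induct)
  case empty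
  show ?case using lin_onD(3)[OF assms(1) zero_in, of 0] by simp
next
  case (insert j J)
  then show ?case
    by (simp add: lin_onD[OF assms(1)] scale_in sum_in)
qed

lemma lin_on_diff:
  assumes "lin_on K T" "g \<in> K" "h \<in> K"
  shows "T (g - h) = T g - T h"
proof -
  have "T (g + (-1) *\<^sub>C h) = T g + (-1) *\<^sub>C T h"
    using assms by (simp only: lin_onD[OF assms(1)] scale_in)
  then show ?thesis by simp
qed

lemma span_if_card:
  assumes ind: "cvec.independent C" and C: "finite C" "C \<subseteq> K" "card C = card I"
  shows "cvec.span C = K"
proof
  show "cvec.span C \<subseteq> K"
    using C(2) subspace by (rule cvec.span_minimal)
  show "K \<subseteq> cvec.span C"
  proof (rule ccontr)
    assume "\<not> K \<subseteq> cvec.span C"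
    then obtain y where y: "y \<in> K" "y \<notin> cvec.span C" by auto
    have "cvec.independent (insert y C)"
      using ind y by (simp add: cvec.independent_insert)
    moreover have "insert y C \<subseteq> cvec.span (e ` I)"
      using y C(2) by (simp add: span)
    ultimately have "card (insert y C) \<le> card (e ` I)"
      using cvec.independent_span_bound[of "e ` I" "insert y C"] fin by auto
    moreover have "y \<notin> C"
      by (rule contrapos_nn[OF y(2)]) (rule cvec.span_base)
    ultimately show False
      using C inj_basis by (simp add: card_image)
  qed
qed

text \<open>
  Composed with the projection onto \<open>K\<close>, \<open>T\<close> becomes linear on the whole space, so it maps the
  basis to an independent family, which spans \<open>K\<close> because it has the right number of elements.
\<close>

lemma lin_on_inj_imp_bij:
  assumes T: "lin_on K T" and ker: "\<And>g. g \<in> K \<Longrightarrow> T g = 0 \<Longrightarrow> g = 0"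
  shows "bij_betw T K K"
proof -
  interpret vp: vector_space_pair scaleC scaleC
    by unfold_locales
  have inj: "inj_on T K"
  proof (rule inj_onI)
    fix g h assume "g \<in> K" "h \<in> K" "T g = T h"
    then show "g = h"
      using ker[of "g - h"] lin_on_diff[OF T] diff_in by simp
  qed
  let ?T = "\<lambda>g. T (orth_proj K g)"
  have PK: "orth_proj K g = g" if "g \<in> K" for g
    using that by (simp add: orth_proj_eq expand)
  have lin: "Vector_Spaces.linear scaleC scaleC ?T"
  proof (unfold_locales)
    show "?T (g + h) = ?T g + ?T h" for g h
      by (subst lin_onD(2)[OF T, symmetric])
        (simp_all add: orth_proj_eq cinner_add_left cvec.scale_left_distrib sum.distrib)
    show "?T (c *\<^sub>C g) = c *\<^sub>C ?T g" for c g
      by (subst lin_onD(3)[OF T, symmetric])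
        (simp_all add: orth_proj_eq cinner_scale_left cvec.scale_sum_right)
  qed
  let ?B = "?T ` (e ` I)"
  have inj': "inj_on ?T (cvec.span (e ` I))"
    using inj PK unfolding span[symmetric] inj_on_def by simp
  then have indB: "cvec.independent ?B"
    by (intro vp.linear_independent_injective_image[OF lin independent])
  have injE: "inj_on ?T (e ` I)"
    using inj' by (rule inj_on_subset) (rule cvec.span_superset)
  have BK: "?B \<subseteq> K"
    using lin_onD(1)[OF T] by auto
  have "card ?B = card I"
    using injE inj_basis by (simp add: card_image)
  then have "K \<subseteq> cvec.span ?B"
    using span_if_card[OF indB _ BK] fin by simp
  moreover have "cvec.span ?B = ?T ` K"
    using vp.linear_span_image[OF lin, of "e ` I"] span by simp
  moreover have "?T ` K = T ` K"
    using PK by auto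
  ultimately show ?thesis
    using inj lin_onD(1)[OF T] by (auto simp: bij_betw_def)
qed

lemma orthonormal_basis_image: "orthonormal_basis K (e ` I)"
  unfolding orthonormal_basis_def using fin orth inj_basis span
  by (auto simp: inj_on_eq_iff)

text \<open>
  The trace is defined through an arbitrarily chosen orthonormal basis. Expanding the vectors of
  one basis in the other shows that the choice is immaterial.
\<close>

lemma op_trace_eq:
  assumes T: "lin_on K T"
  shows "op_trace K T = (\<Sum>i\<in>I. cinner (T (e i)) (e i))"
proof -
  define E where "E = (SOME E. orthonormal_basis K E)"
  have "orthonormal_basis K E"
    unfolding E_def using orthonormal_basis_image by (rule someI)
  then interpret E: onb E "\<lambda>x. x" K
    by unfold_locales (auto simp: orthonormal_basis_def)
  have "op_trace K T = (\<Sum>u\<in>E. cinner (T u) u)"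
    by (simp add: op_trace_def E_def[symmetric])
  also have "\<dots> = (\<Sum>u\<in>E. \<Sum>i\<in>I. cinner (T u) (e i) * cnj (cinner u (e i)))"
    by (intro sum.cong refl cinner_expand lin_onD(1)[OF T]) auto
  also have "\<dots> = (\<Sum>i\<in>I. \<Sum>u\<in>E. cinner (e i) u * cinner (T u) (e i))"
    by (subst sum.swap) (simp add: cinner_commute[of "e _"] mult.commute)
  also have "\<dots> = (\<Sum>i\<in>I. cinner (T (\<Sum>u\<in>E. cinner (e i) u *\<^sub>C u)) (e i))"
    by (intro sum.cong refl, subst lin_on_sum[OF T E.fin])
      (auto simp: cinner_sum_left cinner_scale_left)
  also have "\<dots> = (\<Sum>i\<in>I. cinner (T (e i)) (e i))"
    by (simp add: E.expand)
  finally show ?thesis .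
qed

end

section \<open>Model spaces of finite Blaschke products\<close>

definition blaschke_sign :: "complex \<Rightarrow> complex" where
  "blaschke_sign a = (if a = 0 then 1 else cnj a / of_real (cmod a))"

definition blaschke_factor :: "complex \<Rightarrow> complex \<Rightarrow> complex" where
  "blaschke_factor a z = blaschke_sign a * ((z - a) / (1 - cnj a * z))"

lemma norm_blaschke_sign [simp]: "cmod (blaschke_sign a) = 1"
  by (simp add: blaschke_sign_def norm_divide)

lemma blaschke_sign_nonzero [simp]: "blaschke_sign a \<noteq> 0"
  by (metis norm_blaschke_sign norm_zero zero_neq_one)

lemma blaschke_0 [simp]: "blaschke \<Lambda> 0 z = 1"
  by (simp add: blaschke_def)

lemma blaschke_Suc: "blaschke \<Lambda> (Suc N) z = blaschke \<Lambda> N z * blaschke_factor (\<Lambda> N) z"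
  by (simp add: blaschke_def blaschke_factor_def blaschke_sign_def)

lemma blaschke_denominator_nonzero:
  assumes "cmod a < 1" "cmod z \<le> 1"
  shows "1 - cnj a * z \<noteq> 0"
proof
  assume "1 - cnj a * z = 0"
  then have "cmod a * cmod z = 1"
    by (metis complex_mod_cnj eq_iff_diff_eq_0 norm_mult norm_one)
  moreover have "cmod a * cmod z \<le> cmod a * 1"
    using assms by (intro mult_left_mono) auto
  ultimately show False using assms by simp
qed

lemma cauchy_kernel_disc_algebra [intro]:
  "cmod a < 1 \<Longrightarrow> (\<lambda>z. c / (1 - cnj a * z)) \<in> disc_algebra"
  unfolding disc_algebra_def using blaschke_denominator_nonzero[of a]
  by (auto intro!: continuous_intros holomorphic_intros)

lemma blaschke_factor_disc_algebra [intro]: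
  assumes "cmod a < 1"
  shows "blaschke_factor a \<in> disc_algebra"
proof -
  have "(\<lambda>z. (z + (- a)) * (blaschke_sign a / (1 - cnj a * z))) \<in> disc_algebra"
    by (intro disc_algebra_mult disc_algebra_add disc_algebra_const disc_algebra_id
        cauchy_kernel_disc_algebra assms)
  then show ?thesis
    by (simp add: blaschke_factor_def[abs_def] mult_ac)
qed

lemma one_minus_on_sphere:
  assumes "cmod z = 1"
  shows "1 - a * cnj z = (z - a) / z" "1 - cnj a * z = z * cnj (z - a)"
proof -
  have "z \<noteq> 0" using assms by auto
  then show "1 - a * cnj z = (z - a) / z" "1 - cnj a * z = z * cnj (z - a)"
    by (auto simp: cnj_on_sphere[OF assms] field_simps)
qed

lemma norm_one_minus_on_sphere: "cmod z = 1 \<Longrightarrow> cmod (1 - cnj a * z) = cmod (z - a)"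
  by (simp only: one_minus_on_sphere norm_mult complex_mod_cnj mult_1)

lemma sphere_diff_nonzero: "cmod a < 1 \<Longrightarrow> cmod z = 1 \<Longrightarrow> z - a \<noteq> 0"
  by auto

lemma norm_blaschke_factor:
  assumes "cmod a < 1" "cmod z = 1"
  shows "cmod (blaschke_factor a z) = 1"
  using sphere_diff_nonzero[OF assms]
  by (simp add: blaschke_factor_def norm_mult norm_divide norm_one_minus_on_sphere[OF assms(2)])

text \<open>The \<open>j\<close>-th Takenaka--Malmquist function.\<close>

definition tm_fun :: "(nat \<Rightarrow> complex) \<Rightarrow> nat \<Rightarrow> complex \<Rightarrow> complex" where
  "tm_fun \<Lambda> j z = of_real (sqrt (1 - (cmod (\<Lambda> j))\<^sup>2)) / (1 - cnj (\<Lambda> j) * z) * blaschke \<Lambda> j z"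

text \<open>A sum of Poisson kernels at the zeros, which on the circle is the value of \<open>\<bar>B\<^sub>N'\<bar>\<close>.\<close>

definition angular :: "(nat \<Rightarrow> complex) \<Rightarrow> nat \<Rightarrow> complex \<Rightarrow> real" where
  "angular \<Lambda> N z = (\<Sum>j<N. (1 - (cmod (\<Lambda> j))\<^sup>2) / (cmod (z - \<Lambda> j))\<^sup>2)"

locale blaschke_zeros =
  fixes \<Lambda> :: "nat \<Rightarrow> complex"
  assumes zeros: "\<And>j. cmod (\<Lambda> j) < 1"
begin

abbreviation "B \<equiv> blaschke \<Lambda>"
abbreviation "tm \<equiv> tm_fun \<Lambda>"
abbreviation "K N \<equiv> model_space (blaschke \<Lambda> N)"

lemma one_minus_zeros: "0 < 1 - (cmod (\<Lambda> j))\<^sup>2"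
  using zeros[of j] by (simp add: power_less_one_iff abs_square_less_1)

lemma blaschke_disc_algebra [intro, simp]: "B N \<in> disc_algebra"
proof (induction N)
  case 0
  then show ?case by (simp add: blaschke_def[abs_def] disc_algebra_const)
next
  case (Suc N)
  have "(\<lambda>z. B N z * blaschke_factor (\<Lambda> N) z) \<in> disc_algebra"
    by (intro disc_algebra_mult Suc blaschke_factor_disc_algebra zeros)
  then show ?case
    by (simp add: blaschke_Suc[abs_def])
qed

lemma norm_blaschke: "cmod z = 1 \<Longrightarrow> cmod (B N z) = 1"
  by (induction N) (auto simp: blaschke_Suc norm_mult norm_blaschke_factor zeros)

lemma tm_disc_algebra [intro, simp]: "tm j \<in> disc_algebra"
  unfolding tm_fun_def[abs_def] by (intro disc_algebra_mult cauchy_kernel_disc_algebra zeros blaschke_disc_algebra)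

lemma tm_sq_int [simp]: "tm j \<in> sq_int"
  by auto

lemma norm_tm:
  assumes "cmod z = 1"
  shows "(cmod (tm j z))\<^sup>2 = (1 - (cmod (\<Lambda> j))\<^sup>2) / (cmod (z - \<Lambda> j))\<^sup>2"
  using one_minus_zeros[of j] assms
  by (simp add: tm_fun_def norm_mult norm_divide norm_blaschke norm_one_minus_on_sphere power_divide)

text \<open>
  On the circle \<open>B\<^sub>N e\<^sub>j\<^sup>*\<close> is again analytic and vanishes at the origin: the conjugate of \<open>B\<^sub>j\<close> cancels
  the first factors of \<open>B\<^sub>N\<close>, and the conjugate Cauchy kernel has its pole cancelled by the
  factor with zero \<open>\<lambda>\<^sub>j\<close>.
\<close>

lemma blaschke_cnj_tm:
  assumes "j < N"
  obtains \<psi> where "\<psi> \<in> disc_algebra" "\<And>z. cmod z = 1 \<Longrightarrow> B N z * cnj (tm j z) = z * \<psi> z"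
  using assms
proof (induction N arbitrary: thesis)
  case (Suc N)
  show ?case
  proof (cases "j < N")
    case True
    then obtain \<psi> where \<psi>: "\<psi> \<in> disc_algebra" "\<And>z. cmod z = 1 \<Longrightarrow> B N z * cnj (tm j z) = z * \<psi> z"
      using Suc.IH by metis
    show ?thesis
    proof (rule Suc.prems(1))
      show "(\<lambda>z. \<psi> z * blaschke_factor (\<Lambda> N) z) \<in> disc_algebra"
        using \<psi> zeros by blast
      show "B (Suc N) z * cnj (tm j z) = z * (\<psi> z * blaschke_factor (\<Lambda> N) z)" if "cmod z = 1" for z
        using \<psi>(2)[OF that] by (simp add: blaschke_Suc mult_ac)
    qed
  next
    case False
    then have j: "j = N" using Suc.prems by simp
    define s where "s = complex_of_real (sqrt (1 - (cmod (\<Lambda> N))\<^sup>2))"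
    define c where "c = blaschke_sign (\<Lambda> N) * s"
    show ?thesis
    proof (rule Suc.prems(1))
      show "(\<lambda>z. c / (1 - cnj (\<Lambda> N) * z)) \<in> disc_algebra"
        using zeros by blast
      fix z assume z: "cmod z = 1"
      have nz: "z \<noteq> 0" "z - \<Lambda> N \<noteq> 0"
        using z sphere_diff_nonzero[OF zeros z] by auto
      have "cnj (tm j z) = s / (1 - \<Lambda> N * cnj z) * cnj (B N z)"
        by (simp add: tm_fun_def j s_def)
      also have "1 - \<Lambda> N * cnj z = (z - \<Lambda> N) / z"
        by (rule one_minus_on_sphere[OF z])
      finally have t: "cnj (tm j z) = s * z / (z - \<Lambda> N) * cnj (B N z)"
        by simp
      have "B (Suc N) z * cnj (tm j z) = (B N z * cnj (B N z)) * (blaschke_factor (\<Lambda> N) z * (s * z / (z - \<Lambda> N)))"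
        by (simp add: t blaschke_Suc)
      also have "B N z * cnj (B N z) = 1"
        by (rule cnj_mult_on_sphere[OF norm_blaschke[OF z]])
      also have "blaschke_factor (\<Lambda> N) z * (s * z / (z - \<Lambda> N)) = z * (c / (1 - cnj (\<Lambda> N) * z))"
        using nz by (simp add: blaschke_factor_def c_def)
      finally show "B (Suc N) z * cnj (tm j z) = z * (c / (1 - cnj (\<Lambda> N) * z))"
        by simp
    qed
  qed
qed simp

lemma tm_orthogonal_range:
  assumes "j < N" "h \<in> hardy_space"
  shows "cinner (l2 (tm j)) (mult_op (B N) h) = 0"
proof -
  obtain \<psi> where \<psi>: "\<psi> \<in> disc_algebra" "\<And>z. cmod z = 1 \<Longrightarrow> B N z * cnj (tm j z) = z * \<psi> z"
    using blaschke_cnj_tm[OF assms(1)] by metis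
  have c: "continuous_on (sphere 0 1) (\<lambda>z. cnj (z * \<psi> z))"
    by (intro continuous_intros disc_algebra_sphere \<psi>)
  have BL: "B N \<in> L_inf" by auto
  have m: "mult_op (B N) h = l2 (\<lambda>z. B N z * rep_l2_circ h z)"
    using mult_op_l2[OF BL rep_sq_int, of h] by simp
  have "cinner (mult_op (B N) h) (l2 (tm j)) = (LINT z|circ. (B N z * rep_l2_circ h z) * cnj (tm j z))"
    unfolding m by (intro cinner_l2 sq_int_mult BL) auto
  also have "\<dots> = (LINT z|circ. rep_l2_circ h z * cnj (cnj (z * \<psi> z)))"
    by (intro circ_integral_cong) (simp add: \<psi>(2)[symmetric])
  also have "\<dots> = cinner h (l2 (\<lambda>z. cnj (z * \<psi> z)))"
    by (rule cinner_rep_l2[OF c, symmetric])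
  also have "\<dots> = 0"
    by (rule hardy_orthogonal_coanalytic[OF assms(2) \<psi>(1)])
  finally show ?thesis
    using cinner_commute[of "l2 (tm j)" "mult_op (B N) h"] by simp
qed

text \<open>
  With \<open>k\<close> the Cauchy kernel of the zero, \<open>\<bar>e\<^sub>j\<bar>\<^sup>2 = k + k\<^sup>* - 1\<close> is a Poisson kernel, and \<open>k\<close> has mean
  \<open>k(0) = 1\<close>.
\<close>

lemma tm_norm_1: "cinner (l2 (tm j)) (l2 (tm j)) = 1"
proof -
  define k where "k z = 1 / (1 - cnj (\<Lambda> j) * z)" for z
  have k: "k \<in> disc_algebra"
    unfolding k_def[abs_def] using zeros by blast
  have pt: "tm j z * cnj (tm j z) = k z + cnj (k z) - 1" if z: "cmod z = 1" for z
  proof -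
    let ?a = "cnj (\<Lambda> j) * z" and ?s = "complex_of_real (sqrt (1 - (cmod (\<Lambda> j))\<^sup>2))"
    have nz: "1 - ?a \<noteq> 0" "1 - cnj ?a \<noteq> 0"
      using blaschke_denominator_nonzero[OF zeros, of z j] z
      by (auto simp: complex_eq_iff)
    have aa: "?a * cnj ?a = of_real ((cmod (\<Lambda> j))\<^sup>2)"
      unfolding complex_norm_square[symmetric] using z by (simp add: norm_mult)
    have ss: "?s * ?s = 1 - ?a * cnj ?a"
      unfolding aa using one_minus_zeros[of j]
      by (simp add: of_real_mult[symmetric] del: of_real_mult)
    have "tm j z * cnj (tm j z) = ((?s * ?s) / ((1 - ?a) * (1 - cnj ?a))) * (B j z * cnj (B j z))"
      by (simp add: tm_fun_def)
    also have "B j z * cnj (B j z) = 1"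
      by (rule cnj_mult_on_sphere[OF norm_blaschke[OF z]])
    also have "(?s * ?s) / ((1 - ?a) * (1 - cnj ?a)) * 1 = 1 / (1 - ?a) + 1 / (1 - cnj ?a) - 1"
      unfolding ss using nz by (simp add: divide_simps) (simp add: algebra_simps)
    finally show ?thesis
      by (simp add: k_def)
  qed
  have ki: "integrable circ k" "integrable circ (\<lambda>z. cnj (k z))"
    by (intro circ_continuous_integrable continuous_intros disc_algebra_sphere k)+
  have mv: "(LINT z|circ. k z) = 1"
    using disc_algebra_mean_value[OF k] by (simp add: k_def)
  have "(LINT z|circ. cnj (k z)) = cnj (LINT z|circ. k z)"
    by (rule integral_bounded_linear[OF bounded_linear_cnj ki(1)])
  then have "(LINT z|circ. k z + cnj (k z) - 1) = 1"
    using ki by (simp add: mv measure_circ)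
  moreover have "cinner (l2 (tm j)) (l2 (tm j)) = (LINT z|circ. k z + cnj (k z) - 1)"
    by (subst cinner_l2) (auto intro: circ_integral_cong pt)
  ultimately show ?thesis by simp
qed

lemma tm_orthonormal: "cinner (l2 (tm i)) (l2 (tm j)) = (if i = j then 1 else 0)"
proof -
  have *: "cinner (l2 (tm i)) (l2 (tm j)) = 0" if "i < j" for i j
  proof -
    define g where "g z = of_real (sqrt (1 - (cmod (\<Lambda> j))\<^sup>2)) / (1 - cnj (\<Lambda> j) * z)" for z
    have g: "g \<in> disc_algebra"
      unfolding g_def[abs_def] using zeros by blast
    have "l2 (tm j) = mult_op (B j) (l2 g)"
      using mult_op_disc_algebra_hardy(1)[OF blaschke_disc_algebra g, of j]
      by (simp add: tm_fun_def[abs_def] g_def mult.commute)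
    then show ?thesis
      using tm_orthogonal_range[OF that disc_algebra_hardy[OF g]] by simp
  qed
  show ?thesis
    using *[of i j] *[of j i] tm_norm_1[of i] cinner_commute[of "l2 (tm i)" "l2 (tm j)"]
    by (cases i j rule: linorder_cases) auto
qed

text \<open>
  A multiple of the Cauchy kernel matches \<open>q\<close> at the zero \<open>\<lambda>\<^sub>N\<close>; the difference is then divisible by
  the Blaschke factor, with a polynomial as quotient.
\<close>

lemma poly_blaschke_step:
  fixes q :: "complex poly"
  obtains c q' where "\<And>z. cmod z \<le> 1 \<Longrightarrow>
    poly q z = c * (of_real (sqrt (1 - (cmod (\<Lambda> N))\<^sup>2)) / (1 - cnj (\<Lambda> N) * z)) + blaschke_factor (\<Lambda> N) z * poly q' z"
proof -
  let ?l = "\<Lambda> N" and ?s = "complex_of_real (sqrt (1 - (cmod (\<Lambda> N))\<^sup>2))"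
  define v where "v = poly q ?l * (1 - cnj ?l * ?l)"
  define p where "p = q * [:1, - cnj ?l:] - [:v:]"
  have "poly p ?l = 0"
    by (simp add: p_def v_def algebra_simps)
  then obtain r where r: "p = [:- ?l, 1:] * r"
    unfolding poly_eq_0_iff_dvd by (auto simp: dvd_def)
  have s: "?s \<noteq> 0"
    using one_minus_zeros[of N] by simp
  show ?thesis
  proof (rule that[of "v / ?s" "smult (1 / blaschke_sign ?l) r"])
    fix z assume "cmod z \<le> 1"
    then have nz: "1 - cnj ?l * z \<noteq> 0"
      by (rule blaschke_denominator_nonzero[OF zeros])
    have "poly p z = poly ([:- ?l, 1:] * r) z"
      by (simp add: r)
    then have "poly q z * (1 - cnj ?l * z) = v + (z - ?l) * poly r z"
      by (simp add: p_def algebra_simps)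
    then have "poly q z = (v + (z - ?l) * poly r z) / (1 - cnj ?l * z)"
      using nz by (simp add: field_simps)
    then show "poly q z = v / ?s * (?s / (1 - cnj ?l * z)) +
        blaschke_factor ?l z * poly (smult (1 / blaschke_sign ?l) r) z"
      using s by (simp add: blaschke_factor_def add_divide_distrib)
  qed
qed

lemma poly_decomposition:
  fixes q :: "complex poly"
  shows "\<exists>c q'. \<forall>z. cmod z \<le> 1 \<longrightarrow> poly q z = (\<Sum>j<N. c j * tm j z) + B N z * poly q' z"
proof (induction N)
  case 0
  show ?case by (intro exI[of _ q] exI) simp
next
  case (Suc N)
  then obtain c q' where q': "\<And>z. cmod z \<le> 1 \<Longrightarrow> poly q z = (\<Sum>j<N. c j * tm j z) + B N z * poly q' z"
    by blast
  obtain a q'' where q'': "\<And>z. cmod z \<le> 1 \<Longrightarrow> poly q' z =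
      a * (of_real (sqrt (1 - (cmod (\<Lambda> N))\<^sup>2)) / (1 - cnj (\<Lambda> N) * z)) + blaschke_factor (\<Lambda> N) z * poly q'' z"
    using poly_blaschke_step by metis
  have "poly q z = (\<Sum>j<Suc N. (c(N := a)) j * tm j z) + B (Suc N) z * poly q'' z" if "cmod z \<le> 1" for z
  proof -
    have "(\<Sum>j<N. (c(N := a)) j * tm j z) = (\<Sum>j<N. c j * tm j z)"
      by (intro sum.cong) auto
    then show ?thesis
      using q'[OF that] q''[OF that]
      by (simp add: blaschke_Suc tm_fun_def algebra_simps)
  qed
  then show ?case by blast
qed

lemma tm_comb_l2: "(\<Sum>j<N. c j *\<^sub>C l2 (tm j)) = l2 (\<lambda>z. \<Sum>j<N. c j * tm j z)"
  by (simp add: scaleC_l2 sum_l2 sq_int_scale)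

lemma tm_comb_disc_algebra: "(\<lambda>z. \<Sum>j<N. c j * tm j z) \<in> disc_algebra"
  by (induction N)
    (auto simp: disc_algebra_const intro!: disc_algebra_add disc_algebra_mult[OF disc_algebra_const])

text \<open>
  The Takenaka--Malmquist functions are complete because every polynomial is a combination of them
  up to an element of \<open>B\<^sub>N H\<^sup>2\<close>: what is orthogonal to both has vanishing Taylor coefficients.
\<close>

lemma model_space_eq_span: "K N = cvec.span ((\<lambda>j. l2 (tm j)) ` {..<N})"
proof
  let ?e = "\<lambda>j. l2 (tm j)"
  interpret S: onb "{..<N}" ?e "cvec.span (?e ` {..<N})"
    by unfold_locales (auto simp: tm_orthonormal)
  show "cvec.span (?e ` {..<N}) \<subseteq> K N"
  proof
    fix g assume "g \<in> cvec.span (?e ` {..<N})"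
    then obtain c where g: "g = (\<Sum>j<N. c j *\<^sub>C ?e j)"
      using S.expand by metis
    have "g \<in> hardy_space"
      unfolding g tm_comb_l2 by (rule disc_algebra_hardy[OF tm_comb_disc_algebra])
    then show "g \<in> K N"
      unfolding model_space_def
      by (auto simp: g cinner_sum_left cinner_scale_left tm_orthogonal_range)
  qed
  show "K N \<subseteq> cvec.span (?e ` {..<N})"
  proof
    fix g assume g: "g \<in> K N"
    define a where "a j = - cinner g (?e j)" for j
    define d where "d = g + (\<Sum>j<N. a j *\<^sub>C ?e j)"
    have y: "(\<Sum>j<N. a j *\<^sub>C ?e j) \<in> K N"
      using \<open>cvec.span (?e ` {..<N}) \<subseteq> K N\<close> S.comb_in by blast
    have dh: "d \<in> hardy_space"
      unfolding d_def using g y by (intro hardy_space_add) (auto simp: model_space_def)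
    have dB: "cinner d (mult_op (B N) h) = 0" if "h \<in> hardy_space" for h
      using that g y unfolding d_def cinner_add_left by (auto simp: model_space_def)
    have de: "cinner d (?e j) = 0" if "j < N" for j
      using that S.coeff_comb[of j a] by (simp add: d_def cinner_add_left a_def)
    have "cinner d (l2 (\<lambda>z. z ^ n)) = 0" for n
    proof -
      obtain c q where cq: "\<And>z. cmod z \<le> 1 \<Longrightarrow> z ^ n = (\<Sum>j<N. c j * tm j z) + B N z * poly q z"
        using poly_decomposition[of "monom 1 n" N] by (auto simp: poly_monom)
      have "l2 (\<lambda>z. z ^ n) = l2 (\<lambda>z. (\<Sum>j<N. c j * tm j z) + B N z * poly q z)"
        by (intro l2_eqI disc_algebra_sq_int disc_algebra_add disc_algebra_mult tm_comb_disc_algebra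
            blaschke_disc_algebra poly_disc_algebra disc_algebra_power disc_algebra_id) (simp add: cq)
      also have "\<dots> = (\<Sum>j<N. c j *\<^sub>C ?e j) + mult_op (B N) (l2 (poly q))"
        unfolding tm_comb_l2 mult_op_disc_algebra_hardy(1)[OF blaschke_disc_algebra poly_disc_algebra]
        by (intro add_l2[symmetric] disc_algebra_sq_int disc_algebra_mult tm_comb_disc_algebra
            blaschke_disc_algebra poly_disc_algebra)
      finally show ?thesis
        using dB[OF disc_algebra_hardy[OF poly_disc_algebra[of q]]]
        by (simp add: cinner_add_right cinner_sum_right cinner_scale_right de)
    qed
    then have "d = 0"
      using dh by (intro hardy_eq_0I)
    then have "g = - (\<Sum>j<N. a j *\<^sub>C ?e j)"
      unfolding d_def by (simp add: eq_neg_iff_add_eq_0)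
    then show "g \<in> cvec.span (?e ` {..<N})"
      using S.comb_in[of a] cvec.span_neg by auto
  qed
qed

sublocale K: onb "{..<N}" "\<lambda>j. l2 (tm j)" "K N" for N
  by unfold_locales (auto simp: tm_orthonormal model_space_eq_span)

lemma blaschke_range_orthogonal:
  assumes "g \<in> K N" "F \<in> disc_algebra"
  shows "cinner g (l2 (\<lambda>z. B N z * F z)) = 0"
  using assms disc_algebra_hardy[OF assms(2)]
  by (auto simp: model_space_def mult_op_disc_algebra_hardy(1)[OF blaschke_disc_algebra assms(2), symmetric])

text \<open>The reproducing kernel of \<open>K\<^sub>B\<close>, as a function and as a vector.\<close>

definition kernel :: "nat \<Rightarrow> complex \<Rightarrow> complex \<Rightarrow> complex" where
  "kernel N w z = (\<Sum>j<N. cnj (tm j w) * tm j z)"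

definition kvec :: "nat \<Rightarrow> complex \<Rightarrow> l2_circ" where
  "kvec N w = (\<Sum>j<N. cnj (tm j w) *\<^sub>C l2 (tm j))"

lemma kernel_disc_algebra [intro, simp]: "kernel N w \<in> disc_algebra"
  unfolding kernel_def[abs_def] by (rule tm_comb_disc_algebra)

lemma kvec_l2: "kvec N w = l2 (kernel N w)"
  unfolding kvec_def kernel_def[abs_def] by (rule tm_comb_l2)

lemma kvec_in [simp]: "kvec N w \<in> K N"
  unfolding kvec_def by (rule K.comb_in)

lemma cinner_kvec: "cinner (\<Sum>j<N. c j *\<^sub>C l2 (tm j)) (kvec N w) = (\<Sum>j<N. c j * tm j w)"
  unfolding kvec_def cinner_sum_right cinner_scale_right
  by (intro sum.cong) (auto simp: K.coeff_comb)

text \<open>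
  The Christoffel--Darboux formula. It telescopes: if \<open>b\<close> is the Blaschke factor of
  \<open>\<lambda>\<^sub>N\<close>, the \<open>N\<close>-th term contributes \<open>B\<^sub>N(w)\<^sup>* B\<^sub>N(z) (1 - b(w)\<^sup>* b(z))\<close>.
\<close>

lemma kernel_eq:
  assumes "cmod w \<le> 1" "cmod z \<le> 1"
  shows "(1 - cnj w * z) * kernel N w z = 1 - cnj (B N w) * B N z"
proof (induction N)
  case 0
  then show ?case by (simp add: kernel_def)
next
  case (Suc N)
  let ?l = "\<Lambda> N" and ?s = "complex_of_real (sqrt (1 - (cmod (\<Lambda> N))\<^sup>2))"
  let ?u = "blaschke_sign ?l"
  have nz: "1 - cnj ?l * z \<noteq> 0" "1 - ?l * cnj w \<noteq> 0"
    using blaschke_denominator_nonzero[OF zeros assms(2)] blaschke_denominator_nonzero[OF zeros assms(1), of N]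
    by (auto simp: complex_eq_iff)
  have ss: "?s * ?s = 1 - ?l * cnj ?l"
    using one_minus_zeros[of N]
    by (simp add: of_real_mult[symmetric] complex_norm_square[symmetric] del: of_real_mult)
  have uu: "cnj ?u * ?u = 1"
    using complex_norm_square[of ?u] by (simp add: mult.commute)
  have "(1 - cnj w * z) * ((?s * ?s) / ((1 - ?l * cnj w) * (1 - cnj ?l * z))) =
      1 - ((cnj w - cnj ?l) * (z - ?l)) / ((1 - ?l * cnj w) * (1 - cnj ?l * z))"
    unfolding ss using nz by (simp add: divide_simps) (simp add: algebra_simps)
  also have "\<dots> = 1 - cnj (blaschke_factor ?l w) * blaschke_factor ?l z"
  proof -
    have "cnj (blaschke_factor ?l w) * blaschke_factor ?l z =
        (cnj ?u * ?u) * (((cnj w - cnj ?l) * (z - ?l)) / ((1 - ?l * cnj w) * (1 - cnj ?l * z)))"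
      by (simp add: blaschke_factor_def)
    then show ?thesis by (simp add: uu)
  qed
  finally have step: "(1 - cnj w * z) * ((?s * ?s) / ((1 - ?l * cnj w) * (1 - cnj ?l * z))) =
      1 - cnj (blaschke_factor ?l w) * blaschke_factor ?l z" .
  have "cnj (tm N w) * tm N z =
      ((?s * ?s) / ((1 - ?l * cnj w) * (1 - cnj ?l * z))) * (cnj (B N w) * B N z)"
    by (simp add: tm_fun_def)
  then have "(1 - cnj w * z) * kernel (Suc N) w z = (1 - cnj (B N w) * B N z) +
      ((1 - cnj w * z) * ((?s * ?s) / ((1 - ?l * cnj w) * (1 - cnj ?l * z)))) * (cnj (B N w) * B N z)"
    using Suc by (simp add: kernel_def distrib_left mult.assoc)
  then show ?case
    unfolding step by (simp add: blaschke_Suc algebra_simps)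
qed

lemma norm_kvec:
  assumes "cmod w = 1"
  shows "(norm (kvec N w))\<^sup>2 = angular \<Lambda> N w"
  unfolding kvec_def K.norm_comb angular_def using assms by (simp add: norm_tm)

lemma angular_mono: "M \<le> N \<Longrightarrow> angular \<Lambda> M w \<le> angular \<Lambda> N w"
  unfolding angular_def using one_minus_zeros
  by (intro sum_mono2) (auto intro!: divide_nonneg_nonneg simp: less_imp_le)

text \<open>Logarithmic differentiation: on the circle \<open>z B'/B\<close> is a sum of Poisson kernels.\<close>

lemma blaschke_has_derivative:
  assumes z: "cmod z = 1"
  shows "(B N has_field_derivative cnj z * B N z * of_real (angular \<Lambda> N z)) (at z)"
proof (induction N)
  case 0
  then show ?case by (simp add: angular_def blaschke_def[abs_def])
next
  case (Suc N)
  let ?l = "\<Lambda> N" and ?u = "blaschke_sign (\<Lambda> N)"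
  have nz: "1 - cnj ?l * z \<noteq> 0" "z - ?l \<noteq> 0" "z \<noteq> 0"
    using blaschke_denominator_nonzero[OF zeros, of z N] z sphere_diff_nonzero[OF zeros z] by auto
  have zc: "z * cnj z = 1"
    by (rule cnj_mult_on_sphere[OF z])
  define b' where "b' = ?u * ((1 * (1 - cnj ?l * z) - (z - ?l) * (- cnj ?l)) / ((1 - cnj ?l * z) * (1 - cnj ?l * z)))"
  have d: "(blaschke_factor ?l has_field_derivative b') (at z)"
    unfolding blaschke_factor_def[abs_def] b'_def using nz
    by (auto intro!: derivative_eq_intros) (simp add: algebra_simps)
  have b': "b' = cnj z * blaschke_factor ?l z * of_real ((1 - (cmod ?l)\<^sup>2) / (cmod (z - ?l))\<^sup>2)"
  proof -
    have "of_real ((1 - (cmod ?l)\<^sup>2) / (cmod (z - ?l))\<^sup>2) =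
        (1 - ?l * cnj ?l) / ((z - ?l) * cnj (z - ?l))"
      by (simp only: of_real_divide of_real_diff of_real_1 complex_norm_square)
    also have "cnj (z - ?l) = cnj z * (1 - cnj ?l * z)"
      by (simp add: one_minus_on_sphere(2)[OF z] zc mult.assoc[symmetric] mult.commute[of "cnj z"])
    finally have "cnj z * blaschke_factor ?l z * of_real ((1 - (cmod ?l)\<^sup>2) / (cmod (z - ?l))\<^sup>2)
       = cnj z * (?u * ((z - ?l) / (1 - cnj ?l * z))) * ((1 - ?l * cnj ?l) / ((z - ?l) * (cnj z * (1 - cnj ?l * z))))"
      by (simp add: blaschke_factor_def)
    also have "\<dots> = ?u * ((1 - ?l * cnj ?l) / ((1 - cnj ?l * z) * (1 - cnj ?l * z)))"
      using nz by (simp add: divide_simps)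
    also have "\<dots> = b'"
      unfolding b'_def by (simp add: algebra_simps)
    finally show ?thesis by simp
  qed
  have "((\<lambda>z. B N z * blaschke_factor ?l z) has_field_derivative
      (cnj z * B N z * of_real (angular \<Lambda> N z)) * blaschke_factor ?l z + b' * B N z) (at z)"
    by (rule DERIV_mult[OF Suc d])
  then show ?case
    unfolding b' by (simp add: blaschke_Suc[abs_def] angular_def algebra_simps)
qed

lemma angular_nonneg: "0 \<le> angular \<Lambda> N w"
  unfolding angular_def using one_minus_zeros
  by (intro sum_nonneg) (auto intro!: divide_nonneg_nonneg simp: less_imp_le)

lemma norm_deriv_blaschke:
  assumes "cmod z = 1"
  shows "cmod (deriv (B N) z) = angular \<Lambda> N z"
  using DERIV_imp_deriv[OF blaschke_has_derivative[OF assms]] assms angular_nonneg[of N z]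
  by (simp add: norm_mult norm_blaschke)

lemma beta_eq: "cmod z = 1 \<Longrightarrow> beta \<Lambda> N z = of_real (1 / angular \<Lambda> N z)"
  by (simp add: beta_def norm_deriv_blaschke)

end

section \<open>The functional calculus of a diagonal operator\<close>

lemma polynomial_interpolation:
  fixes h :: "complex \<Rightarrow> complex"
  assumes "finite S"
  shows "\<exists>p. \<forall>s\<in>S. poly p s = h s"
  using assms
proof (induction S)
  case empty
  show ?case by simp
next
  case (insert a S)
  then obtain p where p: "\<And>s. s \<in> S \<Longrightarrow> poly p s = h s" by blast
  define q where "q = (\<Prod>s\<in>S. [:- s, 1:])"
  have qS: "poly q s = 0" if "s \<in> S" for s
    using that insert.hyps by (auto simp: q_def poly_prod)
  have qa: "poly q a \<noteq> 0"
    using insert.hyps by (auto simp: q_def poly_prod)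
  show ?case
    by (rule exI[of _ "p + smult ((h a - poly p a) / poly q a) q"]) (use p qS qa in auto)
qed

lemma laurent_interpolation:
  fixes h :: "complex \<Rightarrow> complex"
  assumes "finite S"
  obtains n :: nat and c where "\<And>w. w \<in> S \<Longrightarrow> (\<Sum>k\<in>{- int n..int n}. c k * w powi k) = h w"
proof -
  obtain p where p: "\<And>s. s \<in> S \<Longrightarrow> poly p s = h s"
    using polynomial_interpolation[OF assms] by blast
  let ?n = "degree p"
  define c where "c k = (if 0 \<le> k then coeff p (nat k) else 0)" for k :: int
  have "(\<Sum>k\<in>{- int ?n..int ?n}. c k * w powi k) = poly p w" for w
  proof -
    have "(\<Sum>k\<in>{- int ?n..int ?n}. c k * w powi k) = (\<Sum>k\<in>int ` {..?n}. c k * w powi k)"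
    proof (rule sum.mono_neutral_right)
      show "\<forall>i\<in>{- int ?n..int ?n} - int ` {..?n}. c i * w powi i = 0"
      proof
        fix i assume i: "i \<in> {- int ?n..int ?n} - int ` {..?n}"
        then have "i < 0"
          by (auto simp: image_iff) (metis atMost_iff int_nat_eq nat_le_iff not_less)
        then show "c i * w powi i = 0" by (simp add: c_def)
      qed
    qed auto
    also have "\<dots> = (\<Sum>i\<le>?n. coeff p i * w ^ i)"
      by (simp add: sum.reindex c_def)
    finally show ?thesis by (simp add: poly_altdef)
  qed
  then show ?thesis
    using p that[of c ?n] by simp
qed

context onb
begin

definition diag :: "('i \<Rightarrow> complex) \<Rightarrow> l2_circ \<Rightarrow> l2_circ" where
  "diag c g = (\<Sum>i\<in>I. (c i * cinner g (e i)) *\<^sub>C e i)"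

lemma diag_in [simp]: "diag c g \<in> K"
  unfolding diag_def by (rule comb_in)

lemma diag_coeff: "i \<in> I \<Longrightarrow> cinner (diag c g) (e i) = c i * cinner g (e i)"
  unfolding diag_def by (rule coeff_comb)

lemma diag_cong: "(\<And>i. i \<in> I \<Longrightarrow> c i = d i) \<Longrightarrow> diag c g = diag d g"
  unfolding diag_def by (rule sum.cong) auto

lemma diag_diag: "diag c (diag d g) = diag (\<lambda>i. c i * d i) g"
  by (rule eqI_basis) (auto simp: diag_coeff)

lemma diag_1: "g \<in> K \<Longrightarrow> diag (\<lambda>_. 1) g = g"
  by (simp add: diag_def expand)

lemma diag_basis: "i \<in> I \<Longrightarrow> diag c (e i) = c i *\<^sub>C e i"
  by (rule eqI_basis) (auto simp: diag_coeff cinner_scale_left orth scale_in)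

lemma lin_on_diag:
  assumes "\<And>g. g \<in> K \<Longrightarrow> T g = diag c g"
  shows "lin_on K T"
proof -
  have "diag c (g + h) = diag c g + diag c h" for g h
    by (rule eqI_basis) (auto simp: diag_coeff cinner_add_left distrib_left intro: add_in)
  moreover have "diag c (a *\<^sub>C g) = a *\<^sub>C diag c g" for a g
    by (rule eqI_basis) (auto simp: diag_coeff cinner_scale_left mult.left_commute intro: scale_in)
  ultimately show ?thesis
    unfolding lin_on_def by (simp add: assms add_in scale_in)
qed

lemma norm_diag_le:
  assumes "\<And>i. i \<in> I \<Longrightarrow> cmod (c i) \<le> M" "0 \<le> M" "g \<in> K"
  shows "norm (diag c g) \<le> M * norm g"
proof (rule power2_le_imp_le)
  have "(norm (diag c g))\<^sup>2 = (\<Sum>i\<in>I. (cmod (c i))\<^sup>2 * (cmod (cinner g (e i)))\<^sup>2)"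
    by (simp add: parseval diag_coeff norm_mult power_mult_distrib)
  also have "\<dots> \<le> (\<Sum>i\<in>I. M\<^sup>2 * (cmod (cinner g (e i)))\<^sup>2)"
    using assms by (intro sum_mono mult_right_mono power_mono) auto
  also have "\<dots> = (M * norm g)\<^sup>2"
    using assms(3) by (simp add: power_mult_distrib parseval sum_distrib_left)
  finally show "(norm (diag c g))\<^sup>2 \<le> (M * norm g)\<^sup>2" .
qed (use assms in auto)

lemma basis_nonzero: "i \<in> I \<Longrightarrow> e i \<noteq> 0"
  using orth[of i i] by auto

lemma norm_basis: "i \<in> I \<Longrightarrow> norm (e i) = 1"
  using orth[of i i] cinner_self[of "e i"]
  by (metis norm_ge_zero of_real_1 of_real_eq_iff one_power2 power2_eq_imp_eq zero_le_one)

lemma lin_on_eigenbasis: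
  assumes "lin_on K U" "\<And>i. i \<in> I \<Longrightarrow> U (e i) = z i *\<^sub>C e i" "g \<in> K"
  shows "U g = diag z g"
proof -
  have "U g = U (\<Sum>i\<in>I. cinner g (e i) *\<^sub>C e i)"
    by (simp add: expand assms)
  also have "\<dots> = (\<Sum>i\<in>I. cinner g (e i) *\<^sub>C U (e i))"
    by (rule lin_on_sum[OF assms(1) fin]) simp
  also have "\<dots> = diag z g"
    unfolding diag_def by (rule sum.cong) (auto simp: assms(2) mult.commute)
  finally show ?thesis .
qed

lemma op_spectrum_diag:
  assumes U: "\<And>g. g \<in> K \<Longrightarrow> U g = diag z g"
  shows "op_spectrum K U = z ` I"
proof -
  have bij: "bij_betw (\<lambda>g. w *\<^sub>C g - U g) K K" if "w \<notin> z ` I" for w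
  proof (rule lin_on_inj_imp_bij)
    have D: "w *\<^sub>C g - U g = diag (\<lambda>i. w - z i) g" if "g \<in> K" for g
      using that by (intro eqI_basis diff_in scale_in)
        (auto simp: U diag_coeff cinner_diff_left cinner_scale_left algebra_simps)
    show "lin_on K (\<lambda>g. w *\<^sub>C g - U g)"
      by (rule lin_on_diag[OF D])
    fix g assume g: "g \<in> K" "w *\<^sub>C g - U g = 0"
    have "(w - z i) * cinner g (e i) = 0" if "i \<in> I" for i
      using g D[OF g(1)] diag_coeff[OF that, of "\<lambda>i. w - z i" g] by simp
    moreover have "w - z i \<noteq> 0" if "i \<in> I" for i
      using that \<open>w \<notin> z ` I\<close> by auto
    ultimately show "g = 0"
      by (intro eqI_basis g) auto
  qed
  have "\<not> bij_betw (\<lambda>g. z i *\<^sub>C g - U g) K K" if i: "i \<in> I" for i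
  proof
    assume "bij_betw (\<lambda>g. z i *\<^sub>C g - U g) K K"
    then have inj: "inj_on (\<lambda>g. z i *\<^sub>C g - U g) K"
      by (simp add: bij_betw_def)
    have "U 0 = 0"
      by (simp add: U diag_def)
    then have "z i *\<^sub>C e i - U (e i) = z i *\<^sub>C 0 - U 0"
      using i by (simp add: U diag_basis)
    then have "e i = 0"
      using inj_onD[OF inj, of "e i" 0] i by simp
    then show False
      using basis_nonzero[OF i] by simp
  qed
  with bij show ?thesis
    unfolding op_spectrum_def by auto
qed

lemma op_powi_diag:
  assumes U: "\<And>g. g \<in> K \<Longrightarrow> U g = diag z g" and z: "\<And>i. i \<in> I \<Longrightarrow> z i \<noteq> 0" and g: "g \<in> K"
  shows "op_powi K U k g = diag (\<lambda>i. z i powi k) g"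
proof -
  have pow: "(V ^^ n) g = diag (\<lambda>i. c i ^ n) g"
    if "\<And>g. g \<in> K \<Longrightarrow> V g = diag c g" for V c n
    by (induction n) (auto simp: diag_1 g that diag_diag mult.commute)
  have inj: "inj_on U K"
  proof (rule inj_onI)
    fix f g assume fg: "f \<in> K" "g \<in> K" "U f = U g"
    have "z i * cinner f (e i) = z i * cinner g (e i)" if "i \<in> I" for i
      using fg diag_coeff[OF that, of z] by (metis U)
    then show "f = g"
      using z by (intro eqI_basis fg) auto
  qed
  have inv: "inv_into K U f = diag (\<lambda>i. inverse (z i)) f" if "f \<in> K" for f
  proof (rule inv_into_f_eq[OF inj])
    have "U (diag (\<lambda>i. inverse (z i)) f) = diag (\<lambda>i. z i * inverse (z i)) f"
      by (simp add: U diag_diag)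
    also have "\<dots> = diag (\<lambda>_. 1) f"
      by (rule diag_cong) (simp add: z)
    finally show "U (diag (\<lambda>i. inverse (z i)) f) = f"
      by (simp add: diag_1 that)
  qed simp
  show ?thesis
    unfolding op_powi_def using pow[OF U] pow[OF inv]
    by (auto simp: power_int_def)
qed

text \<open>
  Laurent polynomials interpolate any function on the finite spectrum, which makes the limit
  in the definition unique.
\<close>

lemma unitary_calculus_diag:
  assumes U: "\<And>g. g \<in> K \<Longrightarrow> U g = diag z g" and z: "\<And>i. i \<in> I \<Longrightarrow> z i \<noteq> 0" and g: "g \<in> K"
  shows "unitary_calculus K h U g = diag (\<lambda>i. h (z i)) g"
proof -
  let ?L = "\<lambda>n c. \<Sum>k\<in>{- int n..int n}. c k *\<^sub>C op_powi K U k g"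
  let ?C = "\<lambda>\<delta> \<epsilon> y. \<forall>(n::nat) c.
        (\<forall>w\<in>op_spectrum K U. cmod ((\<Sum>k\<in>{- int n..int n}. c k * w powi k) - h w) < \<delta>) \<longrightarrow>
        norm (?L n c - y) < \<epsilon>"
  let ?P = "\<lambda>y. y \<in> K \<and> (\<forall>\<epsilon>>0. \<exists>\<delta>>0. ?C \<delta> \<epsilon> y)"
  have L: "?L n c = diag (\<lambda>i. \<Sum>k\<in>{- int n..int n}. c k * z i powi k) g" for n c
    by (rule eqI_basis)
      (auto simp: op_powi_diag[OF U z g] sum_in scale_in diag_coeff cinner_sum_left cinner_scale_left
        sum_distrib_right mult.assoc)
  have diff: "norm (diag a g - diag b g) \<le> M * norm g"
    if "\<And>i. i \<in> I \<Longrightarrow> cmod (a i - b i) \<le> M" "0 \<le> M" for a b M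
  proof -
    have "diag a g - diag b g = diag (\<lambda>i. a i - b i) g"
      by (rule eqI_basis) (auto simp: diag_coeff cinner_diff_left algebra_simps intro: diff_in)
    then show ?thesis
      using norm_diag_le[OF that(1,2) g] by simp
  qed
  have P: "?P (diag (\<lambda>i. h (z i)) g)"
  proof (intro conjI allI impI)
    fix \<epsilon> :: real assume \<epsilon>: "\<epsilon> > 0"
    define \<delta> where "\<delta> = \<epsilon> / (norm g + 1)"
    have ng: "0 < norm g + 1"
      by (rule add_nonneg_pos) auto
    have \<delta>: "\<delta> > 0" "\<delta> * norm g < \<epsilon>"
      using \<epsilon> ng by (auto simp: \<delta>_def field_simps)
    show "\<exists>\<delta>>0. ?C \<delta> \<epsilon> (diag (\<lambda>i. h (z i)) g)"
    proof (intro exI conjI allI impI)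
      show "\<delta> > 0" by fact
      fix n :: nat and c
      assume "\<forall>w\<in>op_spectrum K U. cmod ((\<Sum>k\<in>{- int n..int n}. c k * w powi k) - h w) < \<delta>"
      then have "norm (?L n c - diag (\<lambda>i. h (z i)) g) \<le> \<delta> * norm g"
        unfolding L using \<delta> by (intro diff) (auto simp: op_spectrum_diag[OF U] less_imp_le)
      then show "norm (?L n c - diag (\<lambda>i. h (z i)) g) < \<epsilon>"
        using \<delta>(2) by linarith
    qed
  qed simp
  obtain n :: nat and c where nc: "\<And>w. w \<in> z ` I \<Longrightarrow> (\<Sum>k\<in>{- int n..int n}. c k * w powi k) = h w"
    by (rule laurent_interpolation[of "z ` I" h]) (use fin in auto)
  have close: "norm (?L n c - y) < \<epsilon>" if Py: "?P y" and e: "\<epsilon> > 0" for y \<epsilon>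
  proof -
    obtain \<delta> where \<delta>: "\<delta> > 0" "?C \<delta> \<epsilon> y"
      using Py[THEN conjunct2, THEN spec, THEN mp, OF e] by (elim exE conjE)
    have "\<forall>w\<in>op_spectrum K U. cmod ((\<Sum>k\<in>{- int n..int n}. c k * w powi k) - h w) < \<delta>"
      using nc \<delta>(1) by (auto simp: op_spectrum_diag[OF U])
    then show ?thesis
      by (rule \<delta>(2)[THEN spec, THEN spec, THEN mp])
  qed
  have uniq: "y = ?L n c" if "?P y" for y
  proof (rule ccontr)
    assume "y \<noteq> ?L n c"
    then have "0 < norm (?L n c - y)" by auto
    then show False
      using close[OF that] by blast
  qed
  show ?thesis
    unfolding unitary_calculus_def
  proof (rule the_equality)
    show "?P (diag (\<lambda>i. h (z i)) g)" by (rule P)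
    show "y = diag (\<lambda>i. h (z i)) g" if "?P y" for y
      using uniq[OF that] uniq[OF P] by (rule trans_sym)
  qed
qed

lemma op_norm_diag:
  assumes T: "\<And>g. g \<in> K \<Longrightarrow> T g = diag c g"
  shows "i \<in> I \<Longrightarrow> cmod (c i) \<le> op_norm K T"
    and "(\<And>i. i \<in> I \<Longrightarrow> cmod (c i) \<le> M) \<Longrightarrow> 0 \<le> M \<Longrightarrow> op_norm K T \<le> M"
    and "0 \<le> op_norm K T"
proof -
  let ?S = "{g \<in> K. norm g \<le> 1}"
  have le: "norm (T g) \<le> M" if "\<And>i. i \<in> I \<Longrightarrow> cmod (c i) \<le> M" "0 \<le> M" "g \<in> ?S" for M g
  proof -
    have "norm (T g) \<le> M * norm g"
      using that norm_diag_le[of c M g] by (simp add: T)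
    also have "\<dots> \<le> M * 1"
      using that by (intro mult_left_mono) auto
    finally show ?thesis by simp
  qed
  have "cmod (c i) \<le> (\<Sum>i\<in>I. cmod (c i))" if "i \<in> I" for i
    using that fin by (intro member_le_sum) auto
  then have bdd: "bdd_above ((\<lambda>g. norm (T g)) ` ?S)"
    by (intro bdd_aboveI2[where M = "\<Sum>i\<in>I. cmod (c i)"] le) (auto intro: sum_nonneg)
  have up: "norm (T g) \<le> op_norm K T" if "g \<in> ?S" for g
    unfolding op_norm_def by (rule cSUP_upper[OF that bdd])
  show "cmod (c i) \<le> op_norm K T" if "i \<in> I"
    using up[of "e i"] that by (simp add: norm_basis T diag_basis norm_scaleC)
  show "0 \<le> op_norm K T"
    using up[of 0] order_trans[OF norm_ge_zero] by fastforce
  show "op_norm K T \<le> M" if "\<And>i. i \<in> I \<Longrightarrow> cmod (c i) \<le> M" "0 \<le> M"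
  proof -
    have "0 \<in> ?S" by simp
    then show ?thesis
      unfolding op_norm_def using le[OF that] by (intro cSUP_least) blast+
  qed
qed

end

section \<open>Truncated Toeplitz operators and Clark unitary operators\<close>

lemma mult_op_trivial: "\<phi> \<notin> L_inf \<Longrightarrow> mult_op \<phi> g = 0"
  by transfer (simp add: sq_int_zero)

lemma mult_op_rep: "\<phi> \<in> L_inf \<Longrightarrow> mult_op \<phi> g = l2 (\<lambda>\<zeta>. \<phi> \<zeta> * rep_l2_circ g \<zeta>)"
  using mult_op_l2[OF _ rep_sq_int, of \<phi> g] by simp

lemma mult_op_add: "mult_op \<phi> (g + h) = mult_op \<phi> g + mult_op \<phi> h"
proof (cases "\<phi> \<in> L_inf")
  case True
  have "g + h = l2 (\<lambda>\<zeta>. rep_l2_circ g \<zeta> + rep_l2_circ h \<zeta>)"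
    using add_l2[OF rep_sq_int rep_sq_int, of g h] by simp
  then have "mult_op \<phi> (g + h) = l2 (\<lambda>\<zeta>. \<phi> \<zeta> * (rep_l2_circ g \<zeta> + rep_l2_circ h \<zeta>))"
    using mult_op_l2[OF True sq_int_add[OF rep_sq_int rep_sq_int], of g h] by simp
  then show ?thesis
    by (simp add: mult_op_rep[OF True] add_l2 sq_int_mult[OF True] distrib_left)
qed (simp add: mult_op_trivial)

lemma mult_op_scale: "mult_op \<phi> (c *\<^sub>C g) = c *\<^sub>C mult_op \<phi> g"
proof (cases "\<phi> \<in> L_inf")
  case True
  have "c *\<^sub>C g = l2 (\<lambda>\<zeta>. c * rep_l2_circ g \<zeta>)"
    using scaleC_l2[OF rep_sq_int, of c g] by simp
  then have "mult_op \<phi> (c *\<^sub>C g) = l2 (\<lambda>\<zeta>. \<phi> \<zeta> * (c * rep_l2_circ g \<zeta>))"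
    using mult_op_l2[OF True sq_int_scale[OF rep_sq_int], of c g] by simp
  then show ?thesis
    by (simp add: mult_op_rep[OF True] scaleC_l2 sq_int_mult[OF True] mult.left_commute)
qed (simp add: mult_op_trivial)

context blaschke_zeros
begin

lemma tto_in [simp]: "tto (B N) \<phi> g \<in> K N"
  unfolding tto_def by (rule K.orth_proj_in)

lemma cinner_tto: "k \<in> K N \<Longrightarrow> cinner (tto (B N) \<phi> g) k = cinner (mult_op \<phi> g) k"
  unfolding tto_def by (rule K.cinner_orth_proj)

lemma tto_lin_on: "lin_on (K N) (tto (B N) \<phi>)"
  unfolding lin_on_def
  by (auto intro!: K.eqI_cinner[where N = N] K.add_in K.scale_in
      simp: cinner_tto mult_op_add mult_op_scale cinner_add_left cinner_scale_left)

lemma cinner_kvec_kvec: "cinner (kvec N w) (kvec N z) = kernel N w z"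
  using cinner_kvec[where N = N and c = "\<lambda>j. cnj (tm j w)" and w = z] by (simp add: kvec_def kernel_def)

end

lemma blaschke_denominator_identity:
  "(cmod (1 - cnj a * z))\<^sup>2 - (cmod (z - a))\<^sup>2 = (1 - (cmod z)\<^sup>2) * (1 - (cmod a)\<^sup>2)"
proof -
  have "complex_of_real ((cmod (1 - cnj a * z))\<^sup>2 - (cmod (z - a))\<^sup>2) =
      of_real ((1 - (cmod z)\<^sup>2) * (1 - (cmod a)\<^sup>2))"
    unfolding of_real_diff of_real_mult of_real_1 complex_norm_square by (simp add: algebra_simps)
  then show ?thesis
    using of_real_eq_iff by blast
qed

locale blaschke_zeros_0 = blaschke_zeros +
  assumes zero_0: "\<Lambda> 0 = 0"
begin

definition num :: "nat \<Rightarrow> complex poly" where "num N = (\<Prod>j<N. [:- \<Lambda> j, 1:])"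
definition den :: "nat \<Rightarrow> complex poly" where "den N = (\<Prod>j<N. [:1, - cnj (\<Lambda> j):])"
definition sgn_prod :: "nat \<Rightarrow> complex" where "sgn_prod N = (\<Prod>j<N. blaschke_sign (\<Lambda> j))"

lemma blaschke_quotient: "B N z = sgn_prod N * (poly (num N) z / poly (den N) z)"
  unfolding num_def den_def sgn_prod_def poly_prod prod_dividef[symmetric] prod.distrib[symmetric]
  by (simp add: blaschke_def blaschke_sign_def mult.commute)

lemma norm_sgn_prod [simp]: "cmod (sgn_prod N) = 1"
  by (simp add: sgn_prod_def prod_norm[symmetric])

lemma den_nonzero: "cmod z \<le> 1 \<Longrightarrow> poly (den N) z \<noteq> 0"
  using blaschke_denominator_nonzero[OF zeros, of z]
  by (auto simp: den_def poly_prod mult.commute)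

lemma poly_num_Suc: "poly (num (Suc N)) z = poly (num N) z * (z - \<Lambda> N)"
  by (simp add: num_def algebra_simps)

lemma poly_den_Suc: "poly (den (Suc N)) z = poly (den N) z * (1 - cnj (\<Lambda> N) * z)"
  by (simp add: den_def algebra_simps)

lemma degree_num: "degree (num N) = N"
  unfolding num_def by (subst degree_prod_eq_sum_degree) auto

lemma degree_den: "N \<ge> 1 \<Longrightarrow> degree (den N) < N"
proof -
  assume N: "N \<ge> 1"
  have "degree (den N) \<le> (\<Sum>j<N. degree [:1, - cnj (\<Lambda> j):])"
    unfolding den_def by (rule degree_prod_sum_le[unfolded comp_def]) simp
  also have "\<dots> \<le> (\<Sum>j<N. if j = 0 then 0 else 1)"
    by (intro sum_mono) (auto simp: zero_0)
  also have "\<dots> < N"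
    using N by (cases N) (simp_all add: sum.lessThan_Suc_shift del: sum.lessThan_Suc)
  finally show ?thesis .
qed

lemma norm_num_less_den:
  assumes "N \<ge> 1" "cmod z < 1"
  shows "cmod (poly (num N) z) < cmod (poly (den N) z)"
  using assms(1)
proof (induction N rule: nat_induct_at_least)
  case base
  then show ?case using assms by (simp add: num_def den_def zero_0)
next
  case (Suc N)
  have sgn: "0 \<le> (1 - (cmod z)\<^sup>2) * (1 - (cmod (\<Lambda> N))\<^sup>2)"
    using one_minus_zeros[of N] power_le_one[of "cmod z" 2] assms(2) norm_ge_zero[of z]
    by (intro mult_nonneg_nonneg) linarith+
  have le: "cmod (z - \<Lambda> N) \<le> cmod (1 - cnj (\<Lambda> N) * z)"
    by (rule power2_le_imp_le[OF _ norm_ge_zero])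
      (use sgn blaschke_denominator_identity[of "\<Lambda> N" z] in linarith)
  have "cmod (poly (num N) z) * cmod (z - \<Lambda> N) \<le> cmod (poly (num N) z) * cmod (1 - cnj (\<Lambda> N) * z)"
    by (intro mult_left_mono le) simp
  also have "\<dots> < cmod (poly (den N) z) * cmod (1 - cnj (\<Lambda> N) * z)"
    using Suc blaschke_denominator_nonzero[OF zeros, of z N] assms by (intro mult_strict_right_mono) auto
  finally show ?case
    by (simp add: poly_num_Suc poly_den_Suc norm_mult)
qed

lemma norm_den_less_num:
  assumes "N \<ge> 1" "cmod z > 1"
  shows "cmod (poly (den N) z) < cmod (poly (num N) z)"
  using assms(1)
proof (induction N rule: nat_induct_at_least)
  case base
  then show ?case using assms by (simp add: num_def den_def zero_0)
next
  case (Suc N)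
  have sgn: "(1 - (cmod z)\<^sup>2) * (1 - (cmod (\<Lambda> N))\<^sup>2) \<le> 0"
    using one_minus_zeros[of N] one_le_power[of "cmod z" 2] assms(2)
    by (intro mult_nonpos_nonneg) linarith+
  have le: "cmod (1 - cnj (\<Lambda> N) * z) \<le> cmod (z - \<Lambda> N)"
    by (rule power2_le_imp_le[OF _ norm_ge_zero])
      (use sgn blaschke_denominator_identity[of "\<Lambda> N" z] in linarith)
  have "cmod (poly (den N) z) * cmod (1 - cnj (\<Lambda> N) * z) \<le> cmod (poly (den N) z) * cmod (z - \<Lambda> N)"
    by (intro mult_left_mono le) simp
  also have "\<dots> < cmod (poly (num N) z) * cmod (z - \<Lambda> N)"
  proof (intro mult_strict_right_mono)
    show "0 < cmod (z - \<Lambda> N)"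
      using zeros[of N] assms by auto
  qed (use Suc in auto)
  finally show ?case
    by (simp add: poly_num_Suc poly_den_Suc norm_mult)
qed

lemma blaschke_at_0: "N \<ge> 1 \<Longrightarrow> B N 0 = 0"
proof (induction N rule: nat_induct_at_least)
  case base
  have "blaschke_factor (\<Lambda> 0) 0 = 0"
    by (simp add: blaschke_factor_def zero_0)
  then show ?case
    using blaschke_Suc[of \<Lambda> 0 0] by simp
next
  case (Suc N)
  then show ?case by (simp add: blaschke_Suc)
qed

definition level :: "nat \<Rightarrow> complex \<Rightarrow> complex set" where
  "level N \<alpha> = {\<zeta>. cmod \<zeta> = 1 \<and> B N \<zeta> = \<alpha>}"

lemma tm_0 [simp]: "tm 0 z = 1"
  by (simp add: tm_fun_def zero_0)

lemma angular_ge_1: "N \<ge> 1 \<Longrightarrow> cmod z = 1 \<Longrightarrow> 1 \<le> angular \<Lambda> N z"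
  using angular_mono[of 1 N z] by (simp add: angular_def zero_0)

text \<open>
  The level set is the zero set of a polynomial of degree \<open>N\<close>. Its zeros lie on the circle,
  because \<open>\<bar>B\<bar>\<close> is less than \<open>1\<close> inside and greater outside, and they are simple since \<open>B'\<close> does
  not vanish on the circle.
\<close>

lemma card_level:
  assumes N: "N \<ge> 1" and \<alpha>: "cmod \<alpha> = 1"
  shows "finite (level N \<alpha>)" "card (level N \<alpha>) = N"
proof -
  define p where "p = smult (sgn_prod N) (num N) + smult (- \<alpha>) (den N)"
  have u0: "sgn_prod N \<noteq> 0"
    by (metis norm_sgn_prod norm_zero zero_neq_one)
  have deg: "degree p = N"
    unfolding p_def using degree_den[OF N] u0 degree_num[of N]
    by (subst degree_add_eq_left) (auto intro: le_less_trans[OF degree_smult_le])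
  then have p0: "p \<noteq> 0"
    using N by auto
  have pz: "poly p z = sgn_prod N * poly (num N) z - \<alpha> * poly (den N) z" for z
    by (simp add: p_def)
  have on: "cmod z = 1" if "poly p z = 0" for z
  proof -
    have "sgn_prod N * poly (num N) z = \<alpha> * poly (den N) z"
      using that by (simp add: pz)
    then have "cmod (sgn_prod N * poly (num N) z) = cmod (\<alpha> * poly (den N) z)"
      by simp
    then have "cmod (poly (num N) z) = cmod (poly (den N) z)"
      using \<alpha> by (simp add: norm_mult)
    then show ?thesis
      using norm_num_less_den[OF N, of z] norm_den_less_num[OF N, of z] by fastforce
  qed
  have roots: "{z. poly p z = 0} = level N \<alpha>"
  proof -
    have "poly p z = 0 \<longleftrightarrow> B N z = \<alpha>" if "cmod z = 1" for z
      using den_nonzero[of z N] that by (simp add: pz blaschke_quotient field_simps)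
    then show ?thesis
      using on by (auto simp: level_def)
  qed
  have "rsquarefree p"
    unfolding rsquarefree_roots
  proof (intro allI notI, elim conjE)
    fix z assume z: "poly p z = 0" "poly (pderiv p) z = 0"
    have z1: "cmod z = 1" using on z by blast
    have d0: "poly (den N) z \<noteq> 0" using den_nonzero z1 by simp
    have "((\<lambda>w. poly p w / poly (den N) w) has_field_derivative 0) (at z)"
      using DERIV_divide[OF poly_DERIV[of p z] poly_DERIV[of "den N" z] d0] z by simp
    then have "((\<lambda>w. \<alpha> + poly p w / poly (den N) w) has_field_derivative 0) (at z)"
      using DERIV_add[OF DERIV_const] by fastforce
    moreover have "\<forall>\<^sub>F w in nhds z. \<alpha> + poly p w / poly (den N) w = B N w"
    proof -
      have "open {w. poly (den N) w \<noteq> 0}"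
        by (intro open_Collect_neq continuous_intros)
      then have "\<forall>\<^sub>F w in nhds z. poly (den N) w \<noteq> 0"
        using d0 by (auto simp: eventually_nhds intro!: exI[of _ "{w. poly (den N) w \<noteq> 0}"])
      then show ?thesis
        by eventually_elim (simp add: pz blaschke_quotient field_simps)
    qed
    ultimately have "(B N has_field_derivative 0) (at z)"
      by (subst (asm) DERIV_cong_ev[OF refl _ refl])
    then have "cnj z * B N z * of_real (angular \<Lambda> N z) = 0"
      using DERIV_unique blaschke_has_derivative[OF z1] by blast
    then show False
      using angular_ge_1[OF N z1] z1 norm_blaschke[OF z1, of N] by auto
  qed
  then have "smult (lead_coeff p) (\<Prod>z\<in>level N \<alpha>. [:- z, 1:]) = p"
    using complex_poly_decompose_rsquarefree roots by metis
  then have "degree p = degree (\<Prod>z\<in>level N \<alpha>. [:- z, 1:])"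
    using p0 by (metis degree_smult_eq leading_coeff_0_iff)
  also have "\<dots> = card (level N \<alpha>)"
    by (subst degree_prod_eq_sum_degree) auto
  finally show "card (level N \<alpha>) = N"
    by (simp add: deg)
  then show "finite (level N \<alpha>)"
    using N card.infinite by fastforce
qed

lemma const_1_in: "N \<ge> 1 \<Longrightarrow> l2 (\<lambda>_. 1) \<in> K N"
  using K.basis_in[of 0 N] ext[of "tm 0" "\<lambda>_. 1", OF tm_0] by simp

lemma clark_lin_on:
  assumes "N \<ge> 1"
  shows "lin_on (K N) (clark_op (B N) \<alpha>)"
  unfolding lin_on_def clark_op_def rank_one_def
  using lin_onD[OF tto_lin_on[of N "\<lambda>\<zeta>. \<zeta>"]] const_1_in[OF assms]
  by (auto simp: cinner_add_left cinner_scale_left cvec.scale_left_distrib cvec.scale_right_distrib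
      mult_ac intro!: K.add_in K.scale_in)

text \<open>
  By the Christoffel--Darboux formula \<open>z k\<^sub>\<zeta> = \<zeta> k\<^sub>\<zeta> - \<zeta> + \<zeta> \<alpha>\<^sup>* B\<close>. The projection onto \<open>K\<^sub>B\<close> removes
  the last term, and the rank one perturbation compensates the constant \<open>-\<zeta>\<close>.
\<close>

lemma clark_eigenvector:
  assumes N: "N \<ge> 1" and \<zeta>: "\<zeta> \<in> level N \<alpha>"
  shows "clark_op (B N) \<alpha> (kvec N \<zeta>) = \<zeta> *\<^sub>C kvec N \<zeta>"
proof -
  let ?one = "l2 (\<lambda>_. 1)"
  have z1: "cmod \<zeta> = 1" and Bz: "B N \<zeta> = \<alpha>"
    using \<zeta> by (auto simp: level_def)
  have one: "(\<lambda>_. 1 :: complex) \<in> sq_int"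
    by (rule disc_algebra_sq_int) auto
  have a1: "\<alpha> * cnj \<alpha> = 1"
    using cnj_mult_on_sphere[OF norm_blaschke[OF z1, of N]] Bz by simp
  have pt: "z * kernel N \<zeta> z = \<zeta> * kernel N \<zeta> z + (- \<zeta>) * 1 + (\<zeta> * cnj \<alpha>) * B N z"
    if "cmod z = 1" for z
  proof -
    have "\<zeta> * ((1 - cnj \<zeta> * z) * kernel N \<zeta> z) = \<zeta> * (1 - cnj \<alpha> * B N z)"
      using kernel_eq[of \<zeta> z N] z1 that Bz by simp
    then have "\<zeta> * kernel N \<zeta> z - (\<zeta> * cnj \<zeta>) * z * kernel N \<zeta> z = \<zeta> * (1 - cnj \<alpha> * B N z)"
      by (simp add: algebra_simps)
    then show ?thesis
      by (simp add: cnj_mult_on_sphere[OF z1] algebra_simps)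
  qed
  have zk: "l2 (\<lambda>z. z * kernel N \<zeta> z) =
      \<zeta> *\<^sub>C kvec N \<zeta> + (- \<zeta>) *\<^sub>C ?one + (\<zeta> * cnj \<alpha>) *\<^sub>C l2 (B N)"
  proof -
    have s: "(\<lambda>z. \<zeta> * kernel N \<zeta> z) \<in> sq_int" "(\<lambda>_. (- \<zeta>) * 1) \<in> sq_int"
      "(\<lambda>z. (\<zeta> * cnj \<alpha>) * B N z) \<in> sq_int"
      by (intro sq_int_scale disc_algebra_sq_int kernel_disc_algebra blaschke_disc_algebra
          disc_algebra_const)+
    have "l2 (\<lambda>z. z * kernel N \<zeta> z) = l2 (\<lambda>z. \<zeta> * kernel N \<zeta> z + (- \<zeta>) * 1 + (\<zeta> * cnj \<alpha>) * B N z)"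
      by (intro l2_eqI disc_algebra_sq_int disc_algebra_add disc_algebra_mult kernel_disc_algebra
          disc_algebra_const disc_algebra_id blaschke_disc_algebra) (rule pt)
    also have "\<dots> = l2 (\<lambda>z. \<zeta> * kernel N \<zeta> z) + l2 (\<lambda>_. (- \<zeta>) * 1) + l2 (\<lambda>z. (\<zeta> * cnj \<alpha>) * B N z)"
      unfolding add_l2[OF s(1,2)] add_l2[OF sq_int_add[OF s(1,2)] s(3)] ..
    also have "\<dots> = \<zeta> *\<^sub>C kvec N \<zeta> + (- \<zeta>) *\<^sub>C ?one + (\<zeta> * cnj \<alpha>) *\<^sub>C l2 (B N)"
      unfolding kvec_l2 using one by (simp only: scaleC_l2 disc_algebra_sq_int kernel_disc_algebra blaschke_disc_algebra)
    finally show ?thesis .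
  qed
  have gB: "cinner g (l2 (B N)) = 0" if "g \<in> K N" for g
    using blaschke_range_orthogonal[OF that, of "\<lambda>_. 1"] by (simp add: disc_algebra_const)
  have Bg: "cinner (l2 (B N)) g = 0" if "g \<in> K N" for g
    using gB[OF that] cinner_commute[of g "l2 (B N)"] by simp
  have BB: "cinner (l2 (B N)) (l2 (B N)) = 1"
  proof -
    have "cinner (l2 (B N)) (l2 (B N)) = (LINT z|circ. B N z * cnj (B N z))"
      by (rule cinner_l2) auto
    also have "\<dots> = (LINT z|circ. 1)"
      by (intro circ_integral_cong cnj_mult_on_sphere norm_blaschke)
    finally show ?thesis by (simp add: measure_circ)
  qed
  have "cinner (kvec N \<zeta>) (l2 (\<lambda>z. cnj z * B N z)) = (LINT z|circ. kernel N \<zeta> z * cnj (cnj z * B N z))"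
    unfolding kvec_l2
    by (intro cinner_l2 continuous_sq_int continuous_intros disc_algebra_sphere
        kernel_disc_algebra blaschke_disc_algebra)
  also have "\<dots> = (LINT z|circ. (z * kernel N \<zeta> z) * cnj (B N z))"
    by (intro circ_integral_cong) simp
  also have "\<dots> = cinner (l2 (\<lambda>z. z * kernel N \<zeta> z)) (l2 (B N))"
    by (rule cinner_l2[symmetric]) (auto intro!: disc_algebra_sq_int disc_algebra_mult)
  also have "\<dots> = \<zeta> * cnj \<alpha>"
    unfolding zk using gB const_1_in[OF N] BB by (simp add: cinner_add_left cinner_scale_left cinner_minus_left cinner_diff_left)
  finally have c: "cinner (kvec N \<zeta>) (l2 (\<lambda>z. cnj z * B N z)) = \<zeta> * cnj \<alpha>" .
  have m: "mult_op (\<lambda>\<zeta>. \<zeta>) (kvec N \<zeta>) = l2 (\<lambda>z. z * kernel N \<zeta> z)"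
    unfolding kvec_l2 by (rule mult_op_l2) auto
  show ?thesis
  proof (rule K.eqI_cinner)
    show "clark_op (B N) \<alpha> (kvec N \<zeta>) \<in> K N"
      using lin_onD(1)[OF clark_lin_on[OF N]] by simp
    show "\<zeta> *\<^sub>C kvec N \<zeta> \<in> K N"
      by (simp add: K.scale_in)
    fix k assume k: "k \<in> K N"
    have "cinner (clark_op (B N) \<alpha> (kvec N \<zeta>)) k =
        cinner (l2 (\<lambda>z. z * kernel N \<zeta> z)) k + \<alpha> * ((\<zeta> * cnj \<alpha>) * cinner ?one k)"
      unfolding clark_op_def rank_one_def cinner_add_left cinner_scale_left cinner_tto[OF k] m c ..
    also have "\<dots> = \<zeta> * cinner (kvec N \<zeta>) k - \<zeta> * cinner ?one k + (\<alpha> * cnj \<alpha>) * \<zeta> * cinner ?one k"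
      unfolding zk by (simp add: cinner_add_left cinner_scale_left cinner_minus_left cinner_diff_left Bg[OF k])
    finally show "cinner (clark_op (B N) \<alpha> (kvec N \<zeta>)) k = cinner (\<zeta> *\<^sub>C kvec N \<zeta>) k"
      by (simp add: a1 cinner_scale_left)
  qed
qed

text \<open>
  The same formula makes kernels at different points of a level set orthogonal, and there are as
  many of them as the dimension of the model space.
\<close>

lemma clark_eigenbasis:
  assumes N: "N \<ge> 1" and \<alpha>: "cmod \<alpha> = 1"
  shows "onb (level N \<alpha>) (\<lambda>\<zeta>. of_real (1 / norm (kvec N \<zeta>)) *\<^sub>C kvec N \<zeta>) (K N)"
    (is "onb ?Z ?u _")
proof -
  have pos: "norm (kvec N \<zeta>) > 0" if "\<zeta> \<in> ?Z" for \<zeta>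
    using norm_kvec[of \<zeta> N] angular_ge_1[OF N, of \<zeta>] that by (auto simp: level_def)
  have orth: "cinner (?u z) (?u w) = (if z = w then 1 else 0)" if zw: "z \<in> ?Z" "w \<in> ?Z" for z w
  proof (cases "z = w")
    case True
    then show ?thesis
      using pos[OF zw(1)]
      by (simp add: cinner_self norm_scaleC norm_divide)
  next
    case False
    have z: "cmod z = 1" "cmod w = 1" "B N z = \<alpha>" "B N w = \<alpha>"
      using zw by (auto simp: level_def)
    have "cnj z * w \<noteq> 1"
      using False z by (auto simp: cnj_on_sphere field_simps)
    moreover have "(1 - cnj z * w) * kernel N z w = 0"
      using kernel_eq[of z w N] z \<alpha> cnj_mult_on_sphere[OF \<alpha>] by (simp add: mult.commute)
    ultimately have "kernel N z w = 0" by simp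
    then show ?thesis
      using False by (simp add: cinner_scale_left cinner_scale_right cinner_kvec_kvec)
  qed
  have inK: "?u ` ?Z \<subseteq> K N"
    by (auto intro: K.scale_in)
  interpret S: onb ?Z ?u "cvec.span (?u ` ?Z)"
    using card_level[OF N \<alpha>] orth by unfold_locales auto
  have "cvec.span (?u ` ?Z) = K N"
    using card_level[OF N \<alpha>] inK S.independent S.inj_basis
    by (intro K.span_if_card) (auto simp: card_image)
  then show ?thesis
    using S.onb_axioms by simp
qed

text \<open>The spectral theorem turns the norm of \<open>\<beta>\<^sub>N(U\<^sub>\<alpha>)\<close> into the largest \<open>\<beta>\<^sub>N\<close> on a level set.\<close>

lemma clark_norm:
  fixes \<alpha> :: complex
  defines "M N \<equiv> op_norm (K N) (unitary_calculus (K N) (beta \<Lambda> N) (clark_op (B N) \<alpha>))"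
  assumes N: "N \<ge> 1" and \<alpha>: "cmod \<alpha> = 1"
  shows "0 \<le> M N"
    and "\<zeta> \<in> level N \<alpha> \<Longrightarrow> 1 / angular \<Lambda> N \<zeta> \<le> M N"
    and "(\<And>\<zeta>. \<zeta> \<in> level N \<alpha> \<Longrightarrow> 1 / angular \<Lambda> N \<zeta> \<le> c) \<Longrightarrow> 0 \<le> c \<Longrightarrow> M N \<le> c"
proof -
  let ?u = "\<lambda>\<zeta>. of_real (1 / norm (kvec N \<zeta>)) *\<^sub>C kvec N \<zeta>"
  interpret S: onb "level N \<alpha>" ?u "K N"
    by (rule clark_eigenbasis[OF N \<alpha>])
  have U: "clark_op (B N) \<alpha> g = S.diag (\<lambda>\<zeta>. \<zeta>) g" if "g \<in> K N" for g
  proof (rule S.lin_on_eigenbasis[OF clark_lin_on[OF N] _ that])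
    fix \<zeta> assume "\<zeta> \<in> level N \<alpha>"
    then show "clark_op (B N) \<alpha> (?u \<zeta>) = \<zeta> *\<^sub>C ?u \<zeta>"
      using clark_eigenvector[OF N] lin_onD(3)[OF clark_lin_on[OF N] kvec_in]
      by (simp add: mult.commute)
  qed
  have calc: "unitary_calculus (K N) (beta \<Lambda> N) (clark_op (B N) \<alpha>) g = S.diag (beta \<Lambda> N) g"
    if "g \<in> K N" for g
    by (rule S.unitary_calculus_diag[OF U _ that]) (auto simp: level_def)
  have beta: "cmod (beta \<Lambda> N \<zeta>) = 1 / angular \<Lambda> N \<zeta>" if "\<zeta> \<in> level N \<alpha>" for \<zeta>
    using that beta_eq[of \<zeta> N] angular_nonneg[of N \<zeta>] by (simp add: level_def norm_divide)
  note * = S.op_norm_diag[of "unitary_calculus (K N) (beta \<Lambda> N) (clark_op (B N) \<alpha>)", OF calc]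
  show "0 \<le> M N"
    unfolding M_def by (rule *(3))
  show "1 / angular \<Lambda> N \<zeta> \<le> M N" if "\<zeta> \<in> level N \<alpha>"
    using *(1)[OF _ that] beta[OF that] by (simp add: M_def)
  show "M N \<le> c" if "\<And>\<zeta>. \<zeta> \<in> level N \<alpha> \<Longrightarrow> 1 / angular \<Lambda> N \<zeta> \<le> c" "0 \<le> c"
    unfolding M_def by (rule *(2)) (use that beta in auto)
qed

end

section \<open>Measure-preserving maps of the circle\<close>

inductive trig_poly :: "(complex \<Rightarrow> complex) \<Rightarrow> bool" where
  monomial: "trig_poly (\<lambda>z. z ^ m * cnj z ^ n)"
| scale: "trig_poly u \<Longrightarrow> trig_poly (\<lambda>z. c * u z)"
| add: "trig_poly u \<Longrightarrow> trig_poly v \<Longrightarrow> trig_poly (\<lambda>z. u z + v z)"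

lemma trig_poly_mult:
  assumes "trig_poly u" "trig_poly v"
  shows "trig_poly (\<lambda>z. u z * v z)"
  using assms(1)
proof induction
  case (monomial m n)
  show ?case
    using assms(2)
  proof induction
    case (monomial m' n')
    have "(\<lambda>z. z ^ m * cnj z ^ n * (z ^ m' * cnj z ^ n')) = (\<lambda>z. z ^ (m + m') * cnj z ^ (n + n'))"
      by (auto simp: power_add mult_ac)
    then show ?case using trig_poly.monomial by metis
  next
    case (scale u c)
    have "(\<lambda>z. z ^ m * cnj z ^ n * (c * u z)) = (\<lambda>z. c * (z ^ m * cnj z ^ n * u z))"
      by (auto simp: mult_ac)
    then show ?case using trig_poly.scale[OF scale.IH] by metis
  next
    case (add u v)
    show ?case
      unfolding distrib_left by (rule trig_poly.add[OF add.IH])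
  qed
next
  case (scale u c)
  then show ?case
    unfolding mult.assoc by (intro trig_poly.scale)
next
  case (add u v)
  then show ?case
    unfolding distrib_right by (intro trig_poly.add)
qed

lemma trig_poly_of_real_polynomial:
  assumes "real_polynomial_function (g :: complex \<Rightarrow> real)"
  shows "trig_poly (\<lambda>z. of_real (g z))"
  using assms
proof induction
  case (linear f)
  interpret bounded_linear f by fact
  define a where "a = (of_real (f 1) - \<i> * of_real (f \<i>)) / 2"
  define b where "b = (of_real (f 1) + \<i> * of_real (f \<i>)) / 2"
  have "of_real (f z) = a * (z ^ 1 * cnj z ^ 0) + b * (z ^ 0 * cnj z ^ 1)" for z
  proof -
    have "z = Re z *\<^sub>R 1 + Im z *\<^sub>R \<i>"
      by (simp add: complex_eq_iff)
    then have "f z = f (Re z *\<^sub>R 1 + Im z *\<^sub>R \<i>)"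
      by (rule arg_cong)
    also have "\<dots> = Re z * f 1 + Im z * f \<i>"
      by (simp add: add scaleR)
    finally show ?thesis
      by (simp add: a_def b_def complex_eq_iff field_simps)
  qed
  then have "(\<lambda>z. of_real (f z)) = (\<lambda>z. a * (z ^ 1 * cnj z ^ 0) + b * (z ^ 0 * cnj z ^ 1))"
    by blast
  then show ?case
    by (simp only:) (intro trig_poly.intros)
next
  case (const c)
  have "(\<lambda>z::complex. complex_of_real c) = (\<lambda>z. of_real c * (z ^ 0 * cnj z ^ 0))"
    by simp
  then show ?case
    by (simp only:) (intro trig_poly.intros)
next
  case (add f g)
  then show ?case
    using trig_poly.add by simp
next
  case (mult f g)
  then show ?case
    using trig_poly_mult by simp
qed

lemma trig_poly_continuous: "trig_poly u \<Longrightarrow> continuous_on A u"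
  by (induction rule: trig_poly.induct) (intro continuous_intros; assumption)+

text \<open>
  A continuous self-map of the circle whose positive powers have mean zero preserves the
  normalized measure, because trigonometric polynomials are dense.
\<close>

locale circle_map =
  fixes \<Phi> :: "complex \<Rightarrow> complex"
  assumes cont: "continuous_on (sphere 0 1) \<Phi>"
    and norm_eq: "\<And>z. cmod z = 1 \<Longrightarrow> cmod (\<Phi> z) = 1"
    and power_mean: "\<And>k. k \<ge> 1 \<Longrightarrow> (LINT z|circ. \<Phi> z ^ k) = 0"
begin

lemma comp_continuous: "continuous_on (sphere 0 1) u \<Longrightarrow> continuous_on (sphere 0 1) (\<lambda>z. u (\<Phi> z))"
  by (rule continuous_on_compose2[OF _ cont]) (auto simp: norm_eq)

lemma monomial_mean: "(LINT z|circ. \<Phi> z ^ m * cnj (\<Phi> z) ^ n) = (if m = n then 1 else 0)"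
proof -
  have int: "integrable circ (\<lambda>z. \<Phi> z ^ k)" for k
    by (intro circ_continuous_integrable continuous_intros cont)
  have one: "\<Phi> z ^ k * cnj (\<Phi> z) ^ k = 1" if "cmod z = 1" for z k
    using cnj_mult_on_sphere[OF norm_eq[OF that]] by (simp flip: power_mult_distrib)
  consider "m = n" | "m > n" | "m < n" by linarith
  then show ?thesis
  proof cases
    case 1
    have "(LINT z|circ. \<Phi> z ^ m * cnj (\<Phi> z) ^ n) = (LINT z|circ. 1)"
      by (intro circ_integral_cong) (simp add: 1 one)
    then show ?thesis by (simp add: 1 measure_circ)
  next
    case 2
    have "(LINT z|circ. \<Phi> z ^ m * cnj (\<Phi> z) ^ n) = (LINT z|circ. \<Phi> z ^ (m - n))"
    proof (intro circ_integral_cong)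
      fix z :: complex assume z: "cmod z = 1"
      have "\<Phi> z ^ m = \<Phi> z ^ (m - n) * \<Phi> z ^ n"
        using 2 by (simp flip: power_add)
      then show "\<Phi> z ^ m * cnj (\<Phi> z) ^ n = \<Phi> z ^ (m - n)"
        using one[OF z, of n] by (simp add: mult.assoc)
    qed
    then show ?thesis using 2 power_mean[of "m - n"] by simp
  next
    case 3
    have "(LINT z|circ. \<Phi> z ^ m * cnj (\<Phi> z) ^ n) = (LINT z|circ. cnj (\<Phi> z ^ (n - m)))"
    proof (intro circ_integral_cong)
      fix z :: complex assume z: "cmod z = 1"
      have "cnj (\<Phi> z) ^ n = cnj (\<Phi> z) ^ m * cnj (\<Phi> z) ^ (n - m)"
        using 3 by (simp flip: power_add)
      then show "\<Phi> z ^ m * cnj (\<Phi> z) ^ n = cnj (\<Phi> z ^ (n - m))"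
        using one[OF z, of m] by (simp add: mult.assoc[symmetric])
    qed
    also have "\<dots> = cnj (LINT z|circ. \<Phi> z ^ (n - m))"
      by (rule integral_bounded_linear[OF bounded_linear_cnj int])
    finally show ?thesis using 3 power_mean[of "n - m"] by simp
  qed
qed

end

lemma circle_map_id: "circle_map (\<lambda>z. z)"
proof
  fix k :: nat assume "k \<ge> 1"
  then show "(LINT z|circ. z ^ k) = 0"
    using disc_algebra_mean_value[OF disc_algebra_power[OF disc_algebra_id], of k] by simp
qed auto

context circle_map
begin

lemma trig_poly_mean:
  assumes "trig_poly u"
  shows "(LINT z|circ. u (\<Phi> z)) = (LINT z|circ. u z)"
  using assms
proof induction
  case (monomial m n)
  show ?case
    unfolding monomial_mean circle_map.monomial_mean[OF circle_map_id] ..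
next
  case (scale u c)
  then show ?case by simp
next
  case (add u v)
  then show ?case
    by (simp add: circ_continuous_integrable comp_continuous trig_poly_continuous)
qed

lemma continuous_mean:
  fixes g :: "complex \<Rightarrow> real"
  assumes g: "continuous_on (sphere 0 1) g"
  shows "(LINT z|circ. g (\<Phi> z)) = (LINT z|circ. g z)"
proof -
  have "\<bar>(LINT z|circ. g (\<Phi> z)) - (LINT z|circ. g z)\<bar> \<le> e" if e: "e > 0" for e
  proof -
    obtain p where p: "real_polynomial_function p" and close: "\<And>x. x \<in> sphere 0 1 \<Longrightarrow> \<bar>g x - p x\<bar> < e / 2"
      using Stone_Weierstrass_real_polynomial_function[OF compact_sphere g, of "e / 2"] e by auto
    have pc: "continuous_on (sphere 0 1) p"
      using continuous_on_Re[OF trig_poly_continuous[OF trig_poly_of_real_polynomial[OF p]]] by simp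
    have "complex_of_real (LINT z|circ. p (\<Phi> z)) = of_real (LINT z|circ. p z)"
      using trig_poly_mean[OF trig_poly_of_real_polynomial[OF p]] by (simp only: integral_complex_of_real)
    then have peq: "(LINT z|circ. p (\<Phi> z)) = (LINT z|circ. p z)"
      using of_real_eq_iff by blast
    have bd: "\<bar>(LINT z|circ. g (h z)) - (LINT z|circ. p (h z))\<bar> \<le> e / 2"
      if h: "continuous_on (sphere 0 1) h" "\<And>z. cmod z = 1 \<Longrightarrow> cmod (h z) = 1" for h
    proof -
      have c: "continuous_on (sphere 0 1) (\<lambda>z. g (h z))" "continuous_on (sphere 0 1) (\<lambda>z. p (h z))"
        by (rule continuous_on_compose2[OF _ h(1)], rule g pc, use h(2) in force)+
      have "\<bar>(LINT z|circ. g (h z)) - (LINT z|circ. p (h z))\<bar> = \<bar>LINT z|circ. g (h z) - p (h z)\<bar>"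
        using c by (simp add: circ_continuous_integrable)
      also have "\<dots> \<le> (LINT z|circ. \<bar>g (h z) - p (h z)\<bar>)"
        by (rule integral_abs_bound)
      also have "\<dots> \<le> (LINT z|circ. e / 2)"
        using c h(2) close by (intro circ_integral_mono circ_continuous_integrable continuous_intros)
          (auto intro: less_imp_le)
      finally show ?thesis by (simp add: measure_circ)
    qed
    from bd[OF cont norm_eq] bd[OF continuous_on_id] show ?thesis
      using peq by linarith
  qed
  then have "\<bar>(LINT z|circ. g (\<Phi> z)) - (LINT z|circ. g z)\<bar> \<le> 0"
    by (rule field_le_epsilon) simp
  then show ?thesis by simp
qed

text \<open>Closed sets are decreasing limits of continuous functions, so images cannot lose measure.\<close>

lemma measure_le_image:
  assumes F: "closed F" "F \<subseteq> sphere 0 1"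
  shows "measure circ F \<le> measure circ (\<Phi> ` F)"
proof (cases "F = {}")
  case False
  define L where "L = \<Phi> ` F"
  have "compact F"
    using F by (rule closed_circle_compact)
  then have L: "compact L"
    unfolding L_def using cont continuous_on_subset F by (intro compact_continuous_image) auto
  have Ls: "L \<subseteq> sphere 0 1"
    using F norm_eq by (auto simp: L_def)
  have L0: "L \<noteq> {}" using False by (simp add: L_def)
  have sets: "L \<in> sets circ" "F \<in> sets circ"
    using L Ls F by (auto simp: circ_sets_iff intro: borel_closed compact_imp_closed)
  define g where "g n x = max 0 (1 - real n * infdist x L)" for n x
  have gc: "continuous_on A (g n)" for A n
    unfolding g_def by (intro continuous_intros)
  have g01: "0 \<le> g n x" "g n x \<le> 1" for n x
    by (auto simp: g_def infdist_nonneg)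
  have gL: "g n x = 1" if "x \<in> L" for n x
    using that by (simp add: g_def infdist_zero)
  have le: "measure circ F \<le> (LINT z|circ. g n z)" for n
  proof -
    have "measure circ F = (LINT z|circ. indicator F z)"
      using sets F(2) by (simp add: Int_absorb2)
    also have "\<dots> \<le> (LINT z|circ. g n (\<Phi> z))"
    proof (rule circ_integral_mono)
      show "integrable circ (indicator F :: complex \<Rightarrow> real)"
        using sets by (intro integrable_real_indicator) (auto simp: circ.emeasure_eq_measure)
      show "integrable circ (\<lambda>z. g n (\<Phi> z))"
        by (intro circ_continuous_integrable comp_continuous gc)
      show "indicator F z \<le> g n (\<Phi> z)" if "cmod z = 1" for z
        using gL[of "\<Phi> z" n] g01 by (auto simp: indicator_def L_def)
    qed
    also have "\<dots> = (LINT z|circ. g n z)"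
      by (rule continuous_mean) (rule gc)
    finally show ?thesis .
  qed
  have "(\<lambda>n. LINT z|circ. g n z) \<longlonglongrightarrow> (LINT z|circ. indicator L z)"
  proof (rule integral_dominated_convergence[where w = "\<lambda>_. 1"])
    show "AE z in circ. (\<lambda>n. g n z) \<longlonglongrightarrow> indicator L z"
    proof (rule AE_I2)
      fix x
      show "(\<lambda>n. g n x) \<longlonglongrightarrow> indicator L x"
      proof (cases "x \<in> L")
        case True
        then show ?thesis by (simp add: gL)
      next
        case False
        have "0 < infdist x L"
          using L L0 False in_closed_iff_infdist_zero[OF compact_imp_closed L0, of x] infdist_nonneg[of x L]
          by (simp add: less_le)
        then obtain m :: nat where m: "1 < real m * infdist x L"
          using reals_Archimedean3 by blast
        have "g n x = 0" if "n \<ge> m" for n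
        proof -
          have "real m * infdist x L \<le> real n * infdist x L"
            using that by (intro mult_right_mono) (auto simp: infdist_nonneg)
          then show ?thesis using m by (simp add: g_def)
        qed
        then have "\<forall>\<^sub>F n in sequentially. g n x = 0"
          by (auto simp: eventually_sequentially)
        then show ?thesis
          using False by (simp add: tendsto_eventually)
      qed
    qed
    show "AE z in circ. norm (g n z) \<le> 1" for n
      using g01 by auto
  qed (use sets in \<open>auto intro: circ_continuous_measurable gc\<close>)
  then have "(\<lambda>n. LINT z|circ. g n z) \<longlonglongrightarrow> measure circ L"
    using sets Ls by (simp add: Int_absorb2)
  then show ?thesis
    unfolding L_def[symmetric] by (rule LIMSEQ_le_const) (use le in auto)
qed simp

end

section \<open>Lipschitz images of null sets of the circle\<close>

lemma norm_cis_diff_le: "cmod (cis s - cis t) \<le> \<bar>s - t\<bar>"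
proof -
  have "cis s - cis t = cis t * (cis (s - t) - 1)"
    by (simp add: cis_mult right_diff_distrib)
  then have "cmod (cis s - cis t) = cmod (exp (\<i> * of_real (s - t)) - 1)"
    by (simp add: norm_mult cis_conv_exp)
  also have "\<dots> = 2 * \<bar>sin ((s - t) / 2)\<bar>"
    by (rule dist_exp_i_1)
  also have "\<dots> \<le> 2 * \<bar>(s - t) / 2\<bar>"
    by (intro mult_left_mono abs_sin_x_le_abs_x) auto
  finally show ?thesis by simp
qed

lemma Ln_pointwise_lipschitz:
  assumes "w \<notin> \<real>\<^sub>\<le>\<^sub>0"
  obtains B d where "d > 0" "\<And>u. cmod (u - w) < d \<Longrightarrow> cmod (Ln u - Ln w) \<le> B * cmod (u - w)"
proof -
  have "((\<lambda>u. (Ln u - Ln w) / (u - w)) \<longlongrightarrow> inverse w) (at w)"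
    using has_field_derivative_Ln[OF assms] by (simp add: has_field_derivative_iff)
  then have "\<forall>\<^sub>F u in at w. cmod ((Ln u - Ln w) / (u - w)) < cmod (inverse w) + 1"
    by (intro order_tendstoD(2)[OF tendsto_norm]) auto
  then obtain d where d: "d > 0"
    "\<And>u. u \<noteq> w \<Longrightarrow> dist u w < d \<Longrightarrow> cmod ((Ln u - Ln w) / (u - w)) < cmod (inverse w) + 1"
    unfolding eventually_at by auto
  show ?thesis
  proof (rule that[OF d(1)])
    fix u assume u: "cmod (u - w) < d"
    show "cmod (Ln u - Ln w) \<le> (cmod (inverse w) + 1) * cmod (u - w)"
    proof (cases "u = w")
      case False
      then have "cmod (Ln u - Ln w) / cmod (u - w) < cmod (inverse w) + 1"
        using d(2)[of u] u by (simp add: dist_norm norm_divide)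
      then show ?thesis
        using False by (simp add: divide_less_eq less_imp_le)
    qed simp
  qed
qed

lemma cis_eq_imp_2pi:
  assumes "cis s = cis t"
  obtains k :: int where "s = t + 2 * pi * of_int k"
proof -
  have "cis (s - t) = 1"
    using assms by (simp add: cis_divide[symmetric])
  then have "cos (s - t) = 1"
    by (simp add: complex_eq_iff)
  then obtain k :: int where "s - t = of_int k * 2 * pi"
    unfolding cos_one_2pi_int by blast
  then show ?thesis
    by (intro that[of k]) (simp add: algebra_simps)
qed

text \<open>
  A Lipschitz self-map of part of the circle is locally Lipschitz in the angle, away from the
  branch cut of the argument; the cut itself accounts for a single point of the image.
\<close>

lemma circ_lipschitz_null_image:
  assumes F: "closed F" "F \<in> null_sets circ"
    and W: "\<And>x. x \<in> F \<Longrightarrow> cmod (W x) = 1"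
    and lip: "\<And>x y. x \<in> F \<Longrightarrow> y \<in> F \<Longrightarrow> cmod (W x - W y) \<le> L * cmod (x - y)"
  shows "W ` F \<in> null_sets circ"
proof -
  have Fs: "F \<subseteq> sphere 0 1"
    using F(2) by (auto simp: null_sets_def circ_sets_iff)
  have "compact F"
    using F(1) Fs by (rule closed_circle_compact)
  moreover have "continuous_on F W"
  proof (rule continuous_onI)
    fix x e assume x: "x \<in> F" "(0::real) < e"
    show "\<exists>d>0. \<forall>x'\<in>F. dist x' x < d \<longrightarrow> dist (W x') (W x) \<le> e"
    proof (intro exI[of _ "e / (\<bar>L\<bar> + 1)"] conjI ballI impI)
      show "0 < e / (\<bar>L\<bar> + 1)" using x by simp
      fix x' assume x': "x' \<in> F" "dist x' x < e / (\<bar>L\<bar> + 1)"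
      have "dist (W x') (W x) \<le> L * dist x' x"
        using lip x x' by (simp add: dist_norm)
      also have "\<dots> \<le> (\<bar>L\<bar> + 1) * dist x' x"
        by (intro mult_right_mono) auto
      also have "\<dots> \<le> e"
        using x'(2) by (simp add: field_simps)
      finally show "dist (W x') (W x) \<le> e" .
    qed
  qed
  ultimately have "compact (W ` F)"
    by (intro compact_continuous_image)
  then have WF: "W ` F \<in> sets circ"
    using W by (auto simp: circ_sets_iff borel_closed compact_imp_closed)
  define S where "S = {0..2*pi} \<inter> cis -` F"
  have "S \<in> null_sets lborel"
    unfolding S_def using F(2) by (subst circ_null_iff_angle[symmetric]) auto
  then have negS: "negligible S"
    unfolding negligible_iff_null_sets by (rule null_sets_completionI)
  define f where "f \<theta> = Im (Ln (W (cis \<theta>)))" for \<theta>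
  define S' where "S' = {\<theta>\<in>S. W (cis \<theta>) \<noteq> -1}"
  have "negligible (f ` S')"
  proof (rule negligible_locally_Lipschitz_image)
    show "negligible S'"
      using negS by (rule negligible_subset) (auto simp: S'_def)
    fix x assume x: "x \<in> S'"
    have xF: "cis x \<in> F" using x by (auto simp: S'_def S_def)
    have "W (cis x) \<notin> \<real>\<^sub>\<le>\<^sub>0"
    proof
      assume "W (cis x) \<in> \<real>\<^sub>\<le>\<^sub>0"
      then obtain r where "r \<le> 0" "W (cis x) = of_real r"
        by (auto elim: nonpos_Reals_cases)
      then show False
        using W[OF xF] x by (auto simp: S'_def)
    qed
    then obtain C d where d: "d > 0"
      "\<And>u. cmod (u - W (cis x)) < d \<Longrightarrow> cmod (Ln u - Ln (W (cis x))) \<le> C * cmod (u - W (cis x))"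
      by (rule Ln_pointwise_lipschitz) blast
    let ?M = "\<bar>L\<bar> + 1"
    show "\<exists>T B. open T \<and> x \<in> T \<and> (\<forall>y\<in>S' \<inter> T. norm (f y - f x) \<le> B * norm (y - x))"
    proof (intro exI[of _ "ball x (d / ?M)"] exI[of _ "\<bar>C\<bar> * ?M"] conjI ballI)
      show "x \<in> ball x (d / ?M)" using d by simp
      fix y assume y: "y \<in> S' \<inter> ball x (d / ?M)"
      have yF: "cis y \<in> F" using y by (auto simp: S'_def S_def)
      have "cmod (W (cis y) - W (cis x)) \<le> L * cmod (cis y - cis x)"
        by (rule lip[OF yF xF])
      also have "\<dots> \<le> ?M * \<bar>y - x\<bar>"
        by (intro mult_mono norm_cis_diff_le) auto
      finally have le: "cmod (W (cis y) - W (cis x)) \<le> ?M * \<bar>y - x\<bar>" .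
      also have "\<dots> < d"
        using y by (simp add: dist_real_def field_simps abs_minus_commute)
      finally have "cmod (Ln (W (cis y)) - Ln (W (cis x))) \<le> C * cmod (W (cis y) - W (cis x))"
        by (rule d(2))
      also have "\<dots> \<le> \<bar>C\<bar> * (?M * \<bar>y - x\<bar>)"
        using le by (intro mult_mono) auto
      finally have "cmod (Ln (W (cis y)) - Ln (W (cis x))) \<le> \<bar>C\<bar> * ?M * \<bar>y - x\<bar>"
        by (simp add: mult.assoc)
      then show "norm (f y - f x) \<le> \<bar>C\<bar> * ?M * norm (y - x)"
        using abs_Im_le_cmod[of "Ln (W (cis y)) - Ln (W (cis x))"] by (simp add: f_def)
    qed simp
  qed simp
  then have neg: "negligible (f ` S' \<union> (\<lambda>x. 2 * pi + x) ` (f ` S') \<union> {pi})"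
    by (intro negligible_Un negligible_translation) auto
  have "{0..2*pi} \<inter> cis -` (W ` F) \<subseteq> f ` S' \<union> (\<lambda>x. 2 * pi + x) ` (f ` S') \<union> {pi}"
  proof
    fix t assume t: "t \<in> {0..2*pi} \<inter> cis -` (W ` F)"
    then obtain \<zeta> where \<zeta>: "\<zeta> \<in> F" "cis t = W \<zeta>" by auto
    obtain \<theta> where \<theta>: "0 \<le> \<theta>" "\<theta> < 2 * pi" "\<zeta> = cis \<theta>"
      using Fs \<zeta>(1) Arg2pi[of \<zeta>] Arg2pi_eq[of \<zeta>] by (auto simp: cis_conv_exp)
    have S: "\<theta> \<in> S" using \<theta> \<zeta> by (auto simp: S_def)
    have W0: "W \<zeta> \<noteq> 0" using W[OF \<zeta>(1)] by auto
    have "cis (Arg (W \<zeta>)) = W \<zeta>"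
      using cis_Arg[OF W0] W[OF \<zeta>(1)] by (simp add: sgn_div_norm)
    then obtain k :: int where k: "t = Arg (W \<zeta>) + 2 * pi * of_int k"
      using \<zeta>(2) by (metis cis_eq_imp_2pi)
    have f: "f \<theta> = Arg (W \<zeta>)"
      using Arg_eq_Im_Ln[OF W0] by (simp add: f_def \<theta>)
    have A: "- pi < Arg (W \<zeta>)" "Arg (W \<zeta>) \<le> pi"
      using Arg_bounded[of "W \<zeta>"] by auto
    have t02: "0 \<le> t" "t \<le> 2 * pi"
      using t by auto
    have "2 * pi * of_int k < 2 * pi * 2"
      using t02 k A(1) pi_gt_zero by linarith
    then have "real_of_int k < 2"
      by (subst (asm) mult_less_cancel_left_pos) auto
    then have "k < 2" by linarith
    moreover have "2 * pi * (-1) < 2 * pi * of_int k"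
      using t02 k A(2) pi_gt_zero by linarith
    then have "-1 < real_of_int k"
      by (subst (asm) mult_less_cancel_left_pos) auto
    then have "-1 < k" by linarith
    ultimately have k01: "k = 0 \<or> k = 1" by auto
    show "t \<in> f ` S' \<union> (\<lambda>x. 2 * pi + x) ` (f ` S') \<union> {pi}"
    proof (cases "W \<zeta> = -1")
      case True
      moreover have "Arg (-1) = pi"
        by (rule cis_Arg_unique) (auto simp: cis_pi sgn_minus)
      ultimately have "t = pi"
        using k k01 t02 pi_gt_zero by auto
      then show ?thesis by simp
    next
      case False
      then have "\<theta> \<in> S'" using S \<theta> by (simp add: S'_def)
      then have "Arg (W \<zeta>) \<in> f ` S'"
        using f by (metis imageI)
      then show ?thesis
        using k k01 by auto
    qed
  qed
  then have "negligible ({0..2*pi} \<inter> cis -` (W ` F))"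
    by (rule negligible_subset[OF neg])
  moreover have "{0..2*pi} \<inter> cis -` (W ` F) \<in> sets lborel"
    using measurable_sets[OF cis_measurable_circ, of "W ` F"] WF by (auto simp: sets_circ)
  ultimately have "{0..2*pi} \<inter> cis -` (W ` F) \<in> null_sets lborel"
    by (auto simp: negligible_iff_null_sets null_sets_def emeasure_completion)
  then show ?thesis
    using circ_null_iff_angle[OF WF] by simp
qed

section \<open>The norm of \<open>\<beta>\<^sub>N(U\<^sub>\<alpha>)\<close> and the exceptional set\<close>

context blaschke_zeros
begin

lemma angular_continuous: "continuous_on (sphere 0 1) (angular \<Lambda> N)"
proof -
  have "\<forall>\<zeta>\<in>sphere 0 1. (cmod (\<zeta> - \<Lambda> j))\<^sup>2 \<noteq> 0" for j
    using sphere_diff_nonzero[OF zeros] by auto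
  then show ?thesis
    unfolding angular_def[abs_def] by (intro continuous_intros)
qed

definition sublevel :: "nat \<Rightarrow> real \<Rightarrow> complex set" where
  "sublevel N c = {\<zeta> \<in> sphere 0 1. angular \<Lambda> N \<zeta> \<le> c}"

text \<open>The exceptional set is a countable union of these closed sets.\<close>

definition limit_sublevel :: "real \<Rightarrow> complex set" where
  "limit_sublevel c = (\<Inter>N. sublevel N c)"

lemma closed_sublevel: "closed (sublevel N c)"
  unfolding sublevel_def
  using continuous_closed_preimage[OF angular_continuous closed_sphere closed_atMost, of N c]
  by (simp add: vimage_def Int_def)

lemma closed_limit_sublevel: "closed (limit_sublevel c)"
  unfolding limit_sublevel_def by (intro closed_INT ballI closed_sublevel)

lemma sublevel_sphere: "sublevel N c \<subseteq> sphere 0 1" "limit_sublevel c \<subseteq> sphere 0 1"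
  by (auto simp: sublevel_def limit_sublevel_def)

lemma sets_sublevel [measurable]: "sublevel N c \<in> sets circ" "limit_sublevel c \<in> sets circ"
  using closed_sublevel closed_limit_sublevel sublevel_sphere by (auto simp: circ_sets_iff)

lemma poisson_terms_nonneg: "0 \<le> (1 - (cmod (\<Lambda> j))\<^sup>2) / (cmod (\<zeta> - \<Lambda> j))\<^sup>2"
  using one_minus_zeros[of j] by (intro divide_nonneg_nonneg) auto

lemma limit_set_iff:
  "\<zeta> \<in> limit_set \<Lambda> \<longleftrightarrow> cmod \<zeta> = 1 \<and> summable (\<lambda>j. (1 - (cmod (\<Lambda> j))\<^sup>2) / (cmod (\<zeta> - \<Lambda> j))\<^sup>2)"
  unfolding limit_set_def summable_iff_convergent
  by (auto simp: norm_deriv_blaschke angular_def)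

lemma limit_set_eq_Union: "limit_set \<Lambda> = (\<Union>k. limit_sublevel (real (Suc k)))"
proof (intro equalityI subsetI)
  fix \<zeta> assume \<zeta>: "\<zeta> \<in> limit_set \<Lambda>"
  let ?s = "\<lambda>j. (1 - (cmod (\<Lambda> j))\<^sup>2) / (cmod (\<zeta> - \<Lambda> j))\<^sup>2"
  obtain k where "suminf ?s < real k"
    using reals_Archimedean2 by blast
  then have "angular \<Lambda> N \<zeta> \<le> real (Suc k)" for N
    using sum_le_suminf[of ?s "{..<N}"] \<zeta> poisson_terms_nonneg
    by (simp add: angular_def limit_set_iff)
  then show "\<zeta> \<in> (\<Union>k. limit_sublevel (real (Suc k)))"
    using \<zeta> by (auto simp: limit_sublevel_def sublevel_def limit_set_iff)
next
  fix \<zeta> assume "\<zeta> \<in> (\<Union>k. limit_sublevel (real (Suc k)))"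
  then obtain k where k: "cmod \<zeta> = 1" "\<And>N. angular \<Lambda> N \<zeta> \<le> real (Suc k)"
    by (auto simp: limit_sublevel_def sublevel_def)
  then show "\<zeta> \<in> limit_set \<Lambda>"
    unfolding limit_set_iff angular_def
    using poisson_terms_nonneg by (auto intro!: summableI_nonneg_bounded)
qed

lemma limit_set_sets [measurable]: "limit_set \<Lambda> \<in> sets circ"
  unfolding limit_set_eq_Union by (intro sets.countable_UN) (auto simp: sets_sublevel)

lemma limit_set_null_iff_AE:
  "limit_set \<Lambda> \<in> null_sets circ \<longleftrightarrow> (AE \<zeta> in circ.
     (\<Sum>j. ennreal ((1 - (cmod (\<Lambda> (Suc j)))\<^sup>2) / (cmod (\<zeta> - \<Lambda> (Suc j)))\<^sup>2)) = \<infinity>)"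
proof -
  have "\<zeta> \<notin> limit_set \<Lambda> \<longleftrightarrow>
      (\<Sum>j. ennreal ((1 - (cmod (\<Lambda> (Suc j)))\<^sup>2) / (cmod (\<zeta> - \<Lambda> (Suc j)))\<^sup>2)) = \<infinity>"
    if "\<zeta> \<in> space circ" for \<zeta>
  proof -
    let ?s = "\<lambda>j. (1 - (cmod (\<Lambda> j))\<^sup>2) / (cmod (\<zeta> - \<Lambda> j))\<^sup>2"
    have "summable (\<lambda>j. ?s (Suc j)) \<longleftrightarrow> (\<Sum>j. ennreal (?s (Suc j))) \<noteq> top"
    proof
      show "(\<Sum>j. ennreal (?s (Suc j))) \<noteq> top" if "summable (\<lambda>j. ?s (Suc j))"
        using that poisson_terms_nonneg by (rule ennreal_suminf_neq_top)
      show "summable (\<lambda>j. ?s (Suc j))" if "(\<Sum>j. ennreal (?s (Suc j))) \<noteq> top"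
        using poisson_terms_nonneg that by (rule summable_suminf_not_top)
    qed
    then show ?thesis
      using that summable_Suc_iff[of ?s] by (simp add: limit_set_iff infinity_ennreal_def)
  qed
  then show ?thesis
    unfolding AE_iff_null_sets[OF limit_set_sets] by (intro AE_cong) auto
qed

text \<open>By the Cauchy--Schwarz inequality for reproducing kernels, \<open>B\<^sub>N\<close> is Lipschitz where \<open>\<bar>B\<^sub>N'\<bar>\<close> is bounded.\<close>

lemma blaschke_lipschitz_sublevel:
  assumes "z \<in> sublevel N c" "w \<in> sublevel N c"
  shows "cmod (B N z - B N w) \<le> c * cmod (z - w)"
proof -
  have z: "cmod z = 1" "angular \<Lambda> N z \<le> c" and w: "cmod w = 1" "angular \<Lambda> N w \<le> c"
    using assms by (auto simp: sublevel_def)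
  have c: "0 \<le> c" using z angular_nonneg[of N z] by simp
  have rot: "cmod (1 - cnj a * b) = cmod (a - b)" if "cmod a = 1" for a b
  proof -
    have "a * (1 - cnj a * b) = a - (a * cnj a) * b"
      by (simp add: algebra_simps)
    also have "\<dots> = a - b"
      by (simp add: cnj_mult_on_sphere[OF that])
    finally have "a * (1 - cnj a * b) = a - b" .
    then have "cmod a * cmod (1 - cnj a * b) = cmod (a - b)"
      by (simp only: norm_mult[symmetric])
    then show ?thesis
      using that by simp
  qed
  have "cmod (B N z - B N w) = cmod (1 - cnj (B N z) * B N w)"
    by (rule rot[symmetric]) (rule norm_blaschke[OF z(1)])
  also have "\<dots> = cmod (1 - cnj z * w) * cmod (kernel N z w)"
    using kernel_eq[of z w N] z w by (simp add: norm_mult[symmetric])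
  also have "\<dots> = cmod (z - w) * cmod (cinner (kvec N z) (kvec N w))"
    by (simp add: rot[OF z(1)] cinner_kvec_kvec)
  also have "\<dots> \<le> cmod (z - w) * (norm (kvec N z) * norm (kvec N w))"
    by (intro mult_left_mono cinner_Cauchy_Schwarz) simp
  also have "\<dots> \<le> cmod (z - w) * (sqrt c * sqrt c)"
    using norm_kvec[OF z(1), of N] norm_kvec[OF w(1), of N] z w c
    by (intro mult_left_mono mult_mono real_le_rsqrt) auto
  finally show ?thesis
    using c by (simp add: mult.commute)
qed

text \<open>
  With this normalization the factors tend to \<open>-1\<close> rather than \<open>1\<close> at points of the exceptional set,
  so it is \<open>(-1)\<^sup>N B\<^sub>N\<close> that converges there.
\<close>

lemma blaschke_factor_near_minus_one:
  assumes a: "cmod a < 1" and z: "cmod z = 1"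
  shows "cmod (blaschke_factor a z + 1) \<le> 4 * ((1 - (cmod a)\<^sup>2) / (cmod (z - a))\<^sup>2)"
proof (cases "a = 0")
  case True
  have "cmod (z + 1) \<le> 2"
    using norm_triangle_ineq[of z 1] z by simp
  then show ?thesis
    using True z by (simp add: blaschke_factor_def blaschke_sign_def)
next
  case False
  let ?r = "complex_of_real (cmod a)"
  have nz: "1 - cnj a * z \<noteq> 0" "?r \<noteq> 0" "z - a \<noteq> 0"
    using blaschke_denominator_nonzero[OF a, of z] z False sphere_diff_nonzero[OF a z] by auto
  have rr: "cnj a * a = ?r * ?r"
    using complex_norm_square[of a] by (simp add: power2_eq_square mult.commute)
  have "blaschke_factor a z + 1 = (cnj a * (z - a) + ?r * (1 - cnj a * z)) / (?r * (1 - cnj a * z))"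
    using nz False by (simp add: blaschke_factor_def blaschke_sign_def add_divide_distrib)
  also have "cnj a * (z - a) + ?r * (1 - cnj a * z) = (1 - ?r) * (?r + cnj a * z)"
    using rr by (simp add: algebra_simps)
  finally have "cmod (blaschke_factor a z + 1) =
      cmod (1 - ?r) * cmod (?r + cnj a * z) / (cmod a * cmod (z - a))"
    by (simp add: norm_divide norm_mult norm_one_minus_on_sphere[OF z])
  also have "cmod (1 - ?r) = 1 - cmod a"
    using a norm_of_real[of "1 - cmod a", where ?'a = complex] by simp
  also have "(1 - cmod a) * cmod (?r + cnj a * z) / (cmod a * cmod (z - a))
      \<le> (1 - cmod a) * (2 * cmod a) / (cmod a * cmod (z - a))"
  proof (intro divide_right_mono mult_left_mono)
    show "cmod (?r + cnj a * z) \<le> 2 * cmod a"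
      using norm_triangle_ineq[of ?r "cnj a * z"] z by (simp add: norm_mult)
  qed (use a in auto)
  also have "\<dots> = 2 * (1 - cmod a) * (1 / cmod (z - a))"
    using False by simp
  also have "\<dots> \<le> 2 * (1 - (cmod a)\<^sup>2) * (2 / (cmod (z - a))\<^sup>2)"
  proof (rule mult_mono)
    have "(cmod a)\<^sup>2 \<le> cmod a * 1"
      using a by (simp add: power2_eq_square mult_left_le)
    then show "2 * (1 - cmod a) \<le> 2 * (1 - (cmod a)\<^sup>2)" by simp
    have "cmod (z - a) \<le> 2"
      using norm_triangle_ineq4[of z a] a z by simp
    then have "cmod (z - a) / (cmod (z - a))\<^sup>2 \<le> 2 / (cmod (z - a))\<^sup>2"
      by (intro divide_right_mono) auto
    then show "1 / cmod (z - a) \<le> 2 / (cmod (z - a))\<^sup>2"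
      using nz(3) by (simp add: power2_eq_square)
    show "0 \<le> 2 * (1 - (cmod a)\<^sup>2)"
      using power_le_one[of "cmod a" 2] a by simp
  qed simp
  finally show ?thesis by simp
qed

lemma blaschke_alternating_convergent:
  assumes "\<zeta> \<in> limit_set \<Lambda>"
  shows "convergent (\<lambda>N. (-1) ^ N * B N \<zeta>)"
proof -
  have z: "cmod \<zeta> = 1" and s: "summable (\<lambda>j. (1 - (cmod (\<Lambda> j))\<^sup>2) / (cmod (\<zeta> - \<Lambda> j))\<^sup>2)"
    using assms by (auto simp: limit_set_iff)
  define g where "g N = (-1) ^ N * B N \<zeta>" for N
  have "norm (g (Suc N) - g N) \<le> 4 * ((1 - (cmod (\<Lambda> N))\<^sup>2) / (cmod (\<zeta> - \<Lambda> N))\<^sup>2)" for N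
  proof -
    have "g (Suc N) - g N = - ((-1) ^ N * B N \<zeta> * (blaschke_factor (\<Lambda> N) \<zeta> + 1))"
      by (simp add: g_def blaschke_Suc algebra_simps)
    then have "norm (g (Suc N) - g N) = cmod (blaschke_factor (\<Lambda> N) \<zeta> + 1)"
      by (simp add: norm_mult norm_power norm_blaschke[OF z])
    then show ?thesis
      using blaschke_factor_near_minus_one[OF zeros z, of N] by simp
  qed
  then have "summable (\<lambda>N. g (Suc N) - g N)"
    by (intro summable_comparison_test'[OF summable_mult[OF s, of 4]])
  then have "convergent (\<lambda>N. \<Sum>i<N. g (Suc i) - g i)"
    by (simp add: summable_iff_convergent)
  then have "convergent (\<lambda>N. g N - g 0)"
    by (simp add: sum_lessThan_telescope)
  then have "convergent (\<lambda>N. (g N - g 0) + g 0)"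
    using convergent_add convergent_const by blast
  then show ?thesis
    by (simp add: g_def[abs_def])
qed

end

context blaschke_zeros_0
begin

lemma blaschke_circle_map:
  assumes N: "N \<ge> 1"
  shows "circle_map (B N)"
proof
  show "continuous_on (sphere 0 1) (B N)"
    by (intro disc_algebra_sphere blaschke_disc_algebra)
  show "cmod (B N z) = 1" if "cmod z = 1" for z
    using that by (rule norm_blaschke)
  fix k :: nat assume "k \<ge> 1"
  then show "(LINT z|circ. B N z ^ k) = 0"
    using disc_algebra_mean_value[OF disc_algebra_power[OF blaschke_disc_algebra], of N k]
    by (simp add: blaschke_at_0[OF N])
qed

abbreviation clark_beta_norm :: "complex \<Rightarrow> nat \<Rightarrow> real" where
  "clark_beta_norm \<alpha> N \<equiv> op_norm (K N) (unitary_calculus (K N) (beta \<Lambda> N) (clark_op (B N) \<alpha>))"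

text \<open>
  If the norms tend to zero, almost every \<open>\<alpha>\<close> eventually leaves the images
  \<open>B\<^sub>N(\<bar>B\<^sub>N'\<bar> \<le> c)\<close>, whose measures therefore tend to zero. Since \<open>B\<^sub>N\<close> preserves measure, these
  images are at least as large as \<open>{\<bar>B\<^sub>N'\<bar> \<le> c for all N}\<close>.
\<close>

lemma limit_set_null_if_norms:
  assumes "AE \<alpha> in circ. clark_beta_norm \<alpha> \<longlonglongrightarrow> 0"
  shows "limit_set \<Lambda> \<in> null_sets circ"
proof -
  have "limit_sublevel c \<in> null_sets circ" if c: "c > 0" for c
  proof -
    let ?L = "\<lambda>N. B N ` sublevel N c"
    have comp: "compact (?L N)" for N
    proof (rule compact_continuous_image)
      show "continuous_on (sublevel N c) (B N)"
        using disc_algebra_sphere[OF blaschke_disc_algebra] sublevel_sphere continuous_on_subset by blast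
      show "compact (sublevel N c)"
        using closed_sublevel sublevel_sphere(1) by (rule closed_circle_compact)
    qed
    have Ls: "?L N \<subseteq> sphere 0 1" for N
      using norm_blaschke by (auto simp: sublevel_def)
    have sets: "?L N \<in> sets circ" for N
      using comp Ls by (auto simp: circ_sets_iff intro: borel_closed compact_imp_closed)
    have "(\<lambda>N. LINT \<alpha>|circ. indicator (?L N) \<alpha> :: real) \<longlonglongrightarrow> (LINT \<alpha>|circ. 0)"
    proof (rule integral_dominated_convergence[where w = "\<lambda>_. 1"])
      show "AE \<alpha> in circ. (\<lambda>N. indicator (?L N) \<alpha> :: real) \<longlonglongrightarrow> 0"
        using assms AE_space
      proof eventually_elim
        case (elim \<alpha>)
        then have \<alpha>: "cmod \<alpha> = 1" by simp
        have "\<forall>\<^sub>F N in sequentially. clark_beta_norm \<alpha> N < 1 / c"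
          using elim c by (intro order_tendstoD(2)) auto
        then have "\<forall>\<^sub>F N in sequentially. indicator (?L N) \<alpha> = (0::real)"
          using eventually_ge_at_top[of 1]
        proof eventually_elim
          case (elim N)
          have "\<alpha> \<notin> ?L N"
          proof
            assume "\<alpha> \<in> ?L N"
            then obtain \<zeta> where \<zeta>: "\<zeta> \<in> sublevel N c" "B N \<zeta> = \<alpha>" by auto
            then have "\<zeta> \<in> level N \<alpha>" "cmod \<zeta> = 1" "angular \<Lambda> N \<zeta> \<le> c"
              by (auto simp: level_def sublevel_def)
            then have "1 / c \<le> 1 / angular \<Lambda> N \<zeta>" "1 / angular \<Lambda> N \<zeta> \<le> clark_beta_norm \<alpha> N"
              using angular_ge_1[OF elim(2), of \<zeta>] clark_norm(2)[OF elim(2) \<alpha>] by (auto intro: frac_le)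
            then show False using elim by linarith
          qed
          then show ?case by simp
        qed
        then show ?case by (rule tendsto_eventually)
      qed
    qed (use sets in auto)
    then have lim: "(\<lambda>N. measure circ (?L N)) \<longlonglongrightarrow> 0"
      using sets Ls by (simp add: Int_absorb2)
    have "measure circ (limit_sublevel c) \<le> 0"
    proof (rule LIMSEQ_le_const[OF lim], intro exI allI impI)
      fix N :: nat assume N: "N \<ge> 1"
      have "measure circ (limit_sublevel c) \<le> measure circ (sublevel N c)"
        by (intro circ.finite_measure_mono) (auto simp: limit_sublevel_def)
      also have "\<dots> \<le> measure circ (?L N)"
        by (rule circle_map.measure_le_image[OF blaschke_circle_map[OF N] closed_sublevel sublevel_sphere(1)])
      finally show "measure circ (limit_sublevel c) \<le> measure circ (?L N)" .
    qed
    then have "measure circ (limit_sublevel c) = 0"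
      using measure_nonneg[of circ "limit_sublevel c"] by linarith
    then show ?thesis
      by (auto simp: null_sets_def circ.emeasure_eq_measure)
  qed
  then show ?thesis
    unfolding limit_set_eq_Union by (intro null_sets_UN) simp
qed

text \<open>The limit of the Blaschke products on the exceptional set, with the alternating sign removed.\<close>

definition limit_value :: "complex \<Rightarrow> complex" where
  "limit_value \<zeta> = lim (\<lambda>N. (-1) ^ N * B N \<zeta>)"

lemma limit_value_LIMSEQ:
  "\<zeta> \<in> limit_set \<Lambda> \<Longrightarrow> (\<lambda>N. (-1) ^ N * B N \<zeta>) \<longlonglongrightarrow> limit_value \<zeta>"
  unfolding limit_value_def using blaschke_alternating_convergent by (simp add: convergent_LIMSEQ_iff)

lemma limit_value_image_null:
  assumes "limit_set \<Lambda> \<in> null_sets circ" and s: "cmod s = 1"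
  shows "(\<lambda>\<zeta>. s * limit_value \<zeta>) ` limit_sublevel (real (Suc k)) \<in> null_sets circ"
proof (rule circ_lipschitz_null_image)
  let ?F = "limit_sublevel (real (Suc k))"
  have sub: "?F \<subseteq> limit_set \<Lambda>"
    by (auto simp: limit_set_eq_Union)
  show "closed ?F" by (rule closed_limit_sublevel)
  show "?F \<in> null_sets circ"
    using null_sets_subset[OF assms(1) sets_sublevel(2) sub] .
  show "cmod (s * limit_value x) = 1" if x: "x \<in> ?F" for x
  proof -
    have "(\<lambda>N. cmod ((-1) ^ N * B N x)) \<longlonglongrightarrow> cmod (limit_value x)"
      using x sub by (intro tendsto_norm limit_value_LIMSEQ) auto
    moreover have "cmod ((-1) ^ N * B N x) = 1" for N
      using subsetD[OF sublevel_sphere(2) x] norm_blaschke[of x N] by (simp add: norm_mult norm_power)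
    ultimately show ?thesis
      using s by (simp add: LIMSEQ_const_iff norm_mult)
  qed
  fix x y assume xy: "x \<in> ?F" "y \<in> ?F"
  have "(\<lambda>N. cmod ((-1) ^ N * B N x - (-1) ^ N * B N y)) \<longlonglongrightarrow> cmod (limit_value x - limit_value y)"
    using xy sub by (intro tendsto_intros limit_value_LIMSEQ) auto
  moreover have "cmod ((-1) ^ N * B N x - (-1) ^ N * B N y) \<le> real (Suc k) * cmod (x - y)" for N
  proof -
    have "cmod ((-1) ^ N * B N x - (-1) ^ N * B N y) = cmod (B N x - B N y)"
      by (simp add: norm_mult norm_power flip: right_diff_distrib)
    also have "\<dots> \<le> real (Suc k) * cmod (x - y)"
      using xy by (intro blaschke_lipschitz_sublevel) (auto simp: limit_sublevel_def)
    finally show ?thesis .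
  qed
  ultimately have "cmod (limit_value x - limit_value y) \<le> real (Suc k) * cmod (x - y)"
    by (intro LIMSEQ_le_const2) auto
  then show "cmod (s * limit_value x - s * limit_value y) \<le> real (Suc k) * cmod (x - y)"
    using s by (simp add: norm_mult flip: right_diff_distrib)
qed

text \<open>
  If the norms do not tend to zero for some \<open>\<alpha>\<close>, then along a subsequence there are \<open>\<zeta>\<^sub>N\<close> with
  \<open>B\<^sub>N(\<zeta>\<^sub>N) = \<alpha>\<close> and \<open>\<bar>B\<^sub>N'(\<zeta>\<^sub>N)\<bar> \<le> c\<close>. A limit point \<open>\<zeta>\<close> inherits the bound for every \<open>N\<close>, and the
  Lipschitz estimate carries the value \<open>\<alpha>\<close> over to it up to the sign \<open>(-1)\<^sup>N\<close>.
\<close>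

lemma norms_tendsto_0:
  assumes \<alpha>: "cmod \<alpha> = 1"
    and excl: "\<And>k \<zeta>. \<zeta> \<in> limit_sublevel (real (Suc k)) \<Longrightarrow> \<alpha> \<noteq> limit_value \<zeta> \<and> \<alpha> \<noteq> - limit_value \<zeta>"
  shows "clark_beta_norm \<alpha> \<longlonglongrightarrow> 0"
proof (rule ccontr)
  assume "\<not> clark_beta_norm \<alpha> \<longlonglongrightarrow> 0"
  then obtain e where e: "e > 0" "\<And>m. \<exists>n\<ge>m. \<not> norm (clark_beta_norm \<alpha> n - 0) < e"
    unfolding LIMSEQ_iff by meson
  obtain k where k: "1 / real (Suc k) < e"
    using reals_Archimedean[OF e(1)] by (auto simp: inverse_eq_divide)
  let ?c = "real (Suc k)"
  have ex: "\<exists>n\<ge>m. \<exists>\<zeta>. \<zeta> \<in> level n \<alpha> \<and> angular \<Lambda> n \<zeta> \<le> ?c" for m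
  proof -
    obtain n where n: "n \<ge> max m 1" "\<not> norm (clark_beta_norm \<alpha> n - 0) < e"
      using e(2) by blast
    have n1: "n \<ge> 1" using n by simp
    have "\<exists>\<zeta>\<in>level n \<alpha>. angular \<Lambda> n \<zeta> \<le> ?c"
    proof (rule ccontr)
      assume "\<not> ?thesis"
      then have "clark_beta_norm \<alpha> n \<le> 1 / ?c"
        by (intro clark_norm(3)[OF n1 \<alpha>] frac_le) (auto simp: not_le less_imp_le)
      then show False
        using n(2) k clark_norm(1)[OF n1 \<alpha>] by simp
    qed
    then show ?thesis using n by auto
  qed
  define r where "r m = (SOME n. n \<ge> m \<and> (\<exists>\<zeta>. \<zeta> \<in> level n \<alpha> \<and> angular \<Lambda> n \<zeta> \<le> ?c))" for m
  have r: "r m \<ge> m" "\<exists>\<zeta>. \<zeta> \<in> level (r m) \<alpha> \<and> angular \<Lambda> (r m) \<zeta> \<le> ?c" for m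
    using someI_ex[OF ex[of m]] by (auto simp: r_def)
  then obtain x where x: "\<And>m. x m \<in> level (r m) \<alpha>" "\<And>m. angular \<Lambda> (r m) (x m) \<le> ?c"
    by metis
  have xs: "cmod (x m) = 1" for m
    using x(1) by (auto simp: level_def)
  then have "\<forall>m. x m \<in> sphere 0 1" by auto
  then obtain \<zeta> s where \<zeta>: "\<zeta> \<in> sphere 0 1" and s: "strict_mono s" and lim: "(x \<circ> s) \<longlonglongrightarrow> \<zeta>"
    using compact_sphere[of "0::complex" 1] unfolding compact_def by metis
  have ge: "r (s m) \<ge> m" for m
    using r(1)[of "s m"] seq_suble[OF s, of m] by linarith
  have "angular \<Lambda> M \<zeta> \<le> ?c" for M
  proof (rule LIMSEQ_le_const2)
    have "((angular \<Lambda> M) \<circ> (x \<circ> s)) \<longlonglongrightarrow> angular \<Lambda> M \<zeta>"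
      using angular_continuous[of M] \<zeta> lim xs unfolding continuous_on_sequentially by auto
    then show "(\<lambda>m. angular \<Lambda> M (x (s m))) \<longlonglongrightarrow> angular \<Lambda> M \<zeta>"
      by (simp add: comp_def)
    show "\<exists>n0. \<forall>m\<ge>n0. angular \<Lambda> M (x (s m)) \<le> ?c"
      using order_trans[OF angular_mono x(2)] ge order_trans by blast
  qed
  then have \<zeta>F: "\<zeta> \<in> limit_sublevel ?c"
    using \<zeta> by (auto simp: limit_sublevel_def sublevel_def)
  let ?b = "\<lambda>m. B (r (s m)) \<zeta>" and ?\<sigma> = "\<lambda>m. (-1::complex) ^ r (s m)"
  have "(\<lambda>m. ?b m - \<alpha>) \<longlonglongrightarrow> 0"
  proof (rule Lim_null_comparison)
    show "\<forall>\<^sub>F m in sequentially. norm (?b m - \<alpha>) \<le> ?c * cmod (\<zeta> - x (s m))"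
    proof (intro always_eventually allI)
      fix m
      have "B (r (s m)) (x (s m)) = \<alpha>"
        using x(1) by (simp add: level_def)
      moreover have "\<zeta> \<in> sublevel (r (s m)) ?c" "x (s m) \<in> sublevel (r (s m)) ?c"
        using \<zeta>F x(2) xs by (auto simp: limit_sublevel_def sublevel_def)
      ultimately show "norm (?b m - \<alpha>) \<le> ?c * cmod (\<zeta> - x (s m))"
        using blaschke_lipschitz_sublevel by metis
    qed
    have "(\<lambda>m. ?c * cmod (\<zeta> - x (s m))) \<longlonglongrightarrow> ?c * cmod (\<zeta> - \<zeta>)"
      using lim unfolding comp_def by (intro tendsto_intros)
    then show "(\<lambda>m. ?c * cmod (\<zeta> - x (s m))) \<longlonglongrightarrow> 0" by simp
  qed
  then have "(\<lambda>m. ?\<sigma> m * (?b m - \<alpha>)) \<longlonglongrightarrow> 0"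
    by (subst tendsto_norm_zero_iff[symmetric], subst (asm) tendsto_norm_zero_iff[symmetric])
      (simp add: norm_mult norm_power)
  moreover have "(\<lambda>m. ?\<sigma> m * ?b m) \<longlonglongrightarrow> limit_value \<zeta>"
  proof -
    have "filterlim (\<lambda>m. r (s m)) at_top sequentially"
      using ge by (rule filterlim_at_top_mono[OF filterlim_ident, rotated, OF always_eventually, OF allI])
    then show ?thesis
      using filterlim_compose[OF limit_value_LIMSEQ] \<zeta>F by (auto simp: limit_set_eq_Union)
  qed
  ultimately have "(\<lambda>m. ?\<sigma> m * ?b m - ?\<sigma> m * (?b m - \<alpha>)) \<longlonglongrightarrow> limit_value \<zeta> - 0"
    by (rule tendsto_diff[rotated])
  then have "(\<lambda>m. ?\<sigma> m * \<alpha>) \<longlonglongrightarrow> limit_value \<zeta>"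
    by (simp add: algebra_simps)
  \<comment> \<open>Squaring removes the alternating sign.\<close>
  then have "(\<lambda>m. (?\<sigma> m * \<alpha>)\<^sup>2) \<longlonglongrightarrow> (limit_value \<zeta>)\<^sup>2"
    by (rule tendsto_power)
  moreover have "(?\<sigma> m * \<alpha>)\<^sup>2 = \<alpha>\<^sup>2" for m
    by (simp add: power_mult_distrib flip: power_mult)
  ultimately have "\<alpha>\<^sup>2 = (limit_value \<zeta>)\<^sup>2"
    by (simp add: LIMSEQ_const_iff)
  then show False
    using excl[OF \<zeta>F] by (simp add: power2_eq_iff)
qed

text \<open>
  The values excluded in \<open>norms_tendsto_0\<close> are, up to sign, images of null sets under Lipschitz maps, one for each
  integer bound on \<open>\<bar>B\<^sub>N'\<bar>\<close>.
\<close>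

lemma norms_if_limit_set_null:
  assumes "limit_set \<Lambda> \<in> null_sets circ"
  shows "AE \<alpha> in circ. clark_beta_norm \<alpha> \<longlonglongrightarrow> 0"
proof -
  have "AE \<alpha> in circ. \<forall>k. \<alpha> \<notin> (\<lambda>\<zeta>. 1 * limit_value \<zeta>) ` limit_sublevel (real (Suc k)) \<and>
      \<alpha> \<notin> (\<lambda>\<zeta>. (-1) * limit_value \<zeta>) ` limit_sublevel (real (Suc k))"
    unfolding AE_all_countable
    by (intro allI AE_conjI AE_not_in limit_value_image_null[OF assms]) auto
  then show ?thesis
    using AE_space
  proof eventually_elim
    case (elim \<alpha>)
    then show ?case
      by (intro norms_tendsto_0) (auto simp: image_iff)
  qed
qed

end

section \<open>Contours around a compact convex set\<close>

lemma surrounds_subset: "surrounds \<gamma> \<sigma> U \<Longrightarrow> \<tau> \<subseteq> \<sigma> \<Longrightarrow> surrounds \<gamma> \<tau> U"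
  unfolding surrounds_def by blast

lemma surroundsD:
  assumes "surrounds \<gamma> \<sigma> U"
  shows "valid_path \<gamma>" "pathfinish \<gamma> = pathstart \<gamma>" "path_image \<gamma> \<subseteq> U - \<sigma>"
    "w \<in> \<sigma> \<Longrightarrow> winding_number \<gamma> w = 1" "w \<notin> U \<Longrightarrow> winding_number \<gamma> w = 0"
  using assms unfolding surrounds_def by auto

text \<open>
  A convex neighbourhood \<open>V\<close> of \<open>C\<close> is the conformal image of the disc, and the image of a circle of
  radius close to \<open>1\<close> is a smooth contour that surrounds \<open>C\<close>. Since it is a conformal image of a
  circle, integrals along it are bounded by a constant times the maximum of the integrand.
\<close>

lemma surrounding_contour:
  fixes C U :: "complex set"
  assumes C: "compact C" "convex C" "C \<noteq> {}" and U: "open U" "C \<subseteq> U"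
  obtains \<gamma> L where "surrounds \<gamma> C U" "L \<ge> 0"
    "\<And>F b. continuous_on (path_image \<gamma>) F \<Longrightarrow> b \<ge> 0 \<Longrightarrow> (\<And>w. w \<in> path_image \<gamma> \<Longrightarrow> cmod (F w) \<le> b) \<Longrightarrow>
        cmod (contour_integral \<gamma> F) \<le> L * b"
proof -
  obtain e where e: "e > 0" "{x. infdist x C \<le> e} \<subseteq> U"
    using compact_in_open_separated[OF C(3,1) U] by blast
  define V where "V = (\<Union>x\<in>C. ball x e)"
  have VU: "V \<subseteq> U"
  proof
    fix y assume "y \<in> V"
    then obtain x where "x \<in> C" "dist x y < e" by (auto simp: V_def)
    then have "infdist y C \<le> e"
      using infdist_le2[of x C y e] by (simp add: dist_commute)
    then show "y \<in> U" using e by auto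
  qed
  have CV: "C \<subseteq> V" using e by (force simp: V_def)
  have "open V"
    by (auto simp: V_def)
  then have V: "open V" "V \<noteq> {}"
    using C(3) CV by auto
  have "V = (\<Union>x\<in>C. \<Union>y\<in>ball 0 e. {x + y})"
  proof (intro equalityI subsetI)
    fix z assume "z \<in> V"
    then obtain x where "x \<in> C" "dist x z < e" by (auto simp: V_def)
    then show "z \<in> (\<Union>x\<in>C. \<Union>y\<in>ball 0 e. {x + y})"
      by (intro UN_I[of x] UN_I[of "z - x"]) (auto simp: dist_norm norm_minus_commute)
  next
    fix z assume "z \<in> (\<Union>x\<in>C. \<Union>y\<in>ball 0 e. {x + y})"
    then obtain x y where "x \<in> C" "cmod y < e" "z = x + y" by auto
    then show "z \<in> V"
      unfolding V_def by (intro UN_I[of x]) (auto simp: dist_norm)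
  qed
  then have convV: "convex V"
    using convex_sums[OF C(2) convex_ball[of 0 e]] by simp
  have "bounded V"
    by (rule bounded_subset[OF compact_imp_bounded[OF compact_minkowski_sum_cball[OF C(1), of e]]])
      (auto simp: V_def)
  then have "V \<noteq> UNIV"
    using not_bounded_UNIV by metis
  then obtain h g where h: "h holomorphic_on V" and g: "g holomorphic_on ball 0 1"
    and hg0: "\<forall>z\<in>V. h z \<in> ball 0 1 \<and> g (h z) = z"
    and gh0: "\<forall>z\<in>ball 0 1. g z \<in> V \<and> h (g z) = z"
    using Riemann_mapping_theorem[of V] V convex_imp_simply_connected[OF convV] by blast
  have hg: "h z \<in> ball 0 1 \<and> g (h z) = z" if "z \<in> V" for z
    using hg0 that by blast
  have gh: "g z \<in> V \<and> h (g z) = z" if "z \<in> ball 0 1" for z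
    using gh0 that by blast
  have "compact (h ` C)"
    using h CV C(1) by (meson compact_continuous_image holomorphic_on_imp_continuous_on continuous_on_subset)
  then have "compact (norm ` h ` C)"
    by (rule compact_continuous_image[OF continuous_on_norm[OF continuous_on_id]])
  then obtain m where m: "m \<in> norm ` h ` C" "\<And>x. x \<in> norm ` h ` C \<Longrightarrow> x \<le> m"
    using C(3) compact_attains_sup[of "norm ` h ` C"] by auto
  have "0 \<le> m" "m < 1"
    using m(1) hg CV by auto
  define r where "r = (m + 1) / 2"
  have r: "0 < r" "r < 1" "m < r"
    using \<open>0 \<le> m\<close> \<open>m < 1\<close> by (auto simp: r_def)
  have hC: "cmod (h w) < r" if "w \<in> C" for w
    using m(2)[of "cmod (h w)"] that r by auto
  define \<gamma> where "\<gamma> = g \<circ> circlepath 0 r"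
  have pi: "path_image (circlepath 0 r) \<subseteq> ball 0 1" "path_image (circlepath 0 r) = sphere 0 r"
    using r by auto
  have vp: "valid_path \<gamma>"
    unfolding \<gamma>_def by (rule valid_path_compose_holomorphic[OF _ g _ pi(1)]) auto
  have loop: "pathfinish \<gamma> = pathstart \<gamma>"
    by (simp add: \<gamma>_def pathfinish_compose pathstart_compose)
  have im: "path_image \<gamma> = g ` sphere 0 r"
    using pi by (simp add: \<gamma>_def path_image_compose)
  have imV: "path_image \<gamma> \<subseteq> V"
    unfolding im using gh r by auto
  have imC: "path_image \<gamma> \<inter> C = {}"
    unfolding im
  proof safe
    fix z assume "z \<in> sphere 0 r" "g z \<in> C"
    then show "g z \<in> {}"
      using hC[of "g z"] gh[of z] r by auto
  qed
  have ga: "g analytic_on ball 0 1"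
    using g by (simp add: analytic_on_open)
  have comp: "contour_integral \<gamma> F = contour_integral (circlepath 0 r) (\<lambda>z. deriv g z * F (g z))" for F
    unfolding \<gamma>_def by (rule contour_integral_comp_analyticW[OF ga _ pi(1)]) simp
  have g'c: "continuous_on (ball 0 1) (deriv g)"
    using g holomorphic_deriv holomorphic_on_imp_continuous_on open_ball by blast
  have inj: "inj_on g (ball 0 1)"
    by (rule inj_onI) (metis gh)
  have winding: "winding_number \<gamma> w = 1" if w: "w \<in> C" for w
  proof -
    define z0 where "z0 = h w"
    have z0: "cmod z0 < r" "g z0 = w" "z0 \<in> ball 0 1"
      using hC[OF w] hg[of w] CV w by (auto simp: z0_def)
    define D where "D z = (if z = z0 then deriv g z0 else (g z - g z0) / (z - z0))" for z
    have D: "D holomorphic_on ball 0 1"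
      unfolding D_def by (rule pole_lemma_open[OF g open_ball])
    have Dnz: "D z \<noteq> 0" if "z \<in> ball 0 1" for z
    proof (cases "z = z0")
      case True
      then show ?thesis
        using holomorphic_injective_imp_regular[OF g open_ball inj z0(3)] by (simp add: D_def)
    next
      case False
      then show ?thesis
        using inj_onD[OF inj, of z z0] that z0(3) by (auto simp: D_def)
    qed
    have Q: "(\<lambda>z. deriv g z / D z) holomorphic_on ball 0 1"
      using Dnz by (intro holomorphic_intros D holomorphic_deriv[OF g]) auto
    have sub: "cball 0 r \<subseteq> ball (0::complex) 1" using r by auto
    have "((\<lambda>z. (deriv g z / D z) / (z - z0)) has_contour_integral
        (2 * of_real pi * \<i> * (deriv g z0 / D z0))) (circlepath 0 r)"
      using z0 by (intro Cauchy_integral_circlepath_simple holomorphic_on_subset[OF Q sub]) auto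
    then have "((\<lambda>z. deriv g z * (1 / (g z - w))) has_contour_integral
        (2 * of_real pi * \<i> * (deriv g z0 / D z0))) (circlepath 0 r)"
    proof (rule has_contour_integral_eq)
      fix z assume "z \<in> path_image (circlepath 0 r)"
      then have "z \<noteq> z0" using z0 r pi(2) by auto
      then show "(deriv g z / D z) / (z - z0) = deriv g z * (1 / (g z - w))"
        by (simp add: D_def z0(2))
    qed
    then have "contour_integral \<gamma> (\<lambda>u. 1 / (u - w)) = 2 * of_real pi * \<i>"
      unfolding comp using Dnz[OF z0(3)] by (simp add: contour_integral_unique D_def)
    then show ?thesis
      using winding_number_valid_path[OF vp, of w] imC w by auto
  qed
  have sur: "surrounds \<gamma> C U"
    unfolding surrounds_def
  proof (intro conjI ballI allI impI)
    show "path_image \<gamma> \<subseteq> U - C" using imV VU imC by auto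
    show "winding_number \<gamma> w = 0" if "w \<notin> U" for w
      using winding_number_zero_outside[OF valid_path_imp_path[OF vp] convV loop _ imV] VU that by blast
  qed (use vp loop winding in auto)
  have "bounded (deriv g ` sphere 0 r)"
    using r by (intro compact_imp_bounded compact_continuous_image continuous_on_subset[OF g'c]) auto
  then obtain M where M: "M > 0" "\<And>z. z \<in> sphere 0 r \<Longrightarrow> cmod (deriv g z) \<le> M"
    unfolding bounded_pos by auto
  show ?thesis
  proof (rule that[OF sur])
    show "0 \<le> M * (2 * pi * r)" using M r by simp
    fix F :: "complex \<Rightarrow> complex" and b :: real
    assume F: "continuous_on (path_image \<gamma>) F" and b: "b \<ge> 0" "\<And>w. w \<in> path_image \<gamma> \<Longrightarrow> cmod (F w) \<le> b"
    have gc: "continuous_on (sphere 0 r) g"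
      using r by (intro holomorphic_on_imp_continuous_on holomorphic_on_subset[OF g]) auto
    have "continuous_on (sphere 0 r) (\<lambda>z. deriv g z * F (g z))"
      using r by (intro continuous_intros continuous_on_subset[OF g'c] continuous_on_compose2[OF F gc])
        (auto simp: im)
    then have "((\<lambda>z. deriv g z * F (g z)) has_contour_integral
        contour_integral \<gamma> F) (circlepath 0 r)"
      unfolding comp using pi(2)
      by (intro has_contour_integral_integral contour_integrable_continuous_circlepath) simp
    then have "cmod (contour_integral \<gamma> F) \<le> (M * b) * (2 * pi * r)"
    proof (rule has_contour_integral_bound_circlepath)
      fix z :: complex assume "cmod (z - 0) = r"
      then have "cmod (deriv g z) * cmod (F (g z)) \<le> M * b"
        using M b im by (intro mult_mono) auto
      then show "cmod (deriv g z * F (g z)) \<le> M * b" by (simp add: norm_mult)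
    qed (use M b r in auto)
    then show "cmod (contour_integral \<gamma> F) \<le> M * (2 * pi * r) * b"
      by (simp add: mult_ac)
  qed
qed

section \<open>Contour integrals of functions with finitely many poles\<close>

definition root_prod :: "complex list \<Rightarrow> complex \<Rightarrow> complex" where
  "root_prod as w = prod_list (map (\<lambda>a. w - a) as)"

lemma root_prod_simps [simp]:
  "root_prod [] w = 1" "root_prod (a # as) w = (w - a) * root_prod as w"
  "root_prod (as @ bs) w = root_prod as w * root_prod bs w"
  by (auto simp: root_prod_def)

lemma root_prod_eq_0_iff: "root_prod as w = 0 \<longleftrightarrow> w \<in> set as"
  by (induction as) auto

lemma root_prod_remove1: "b \<in> set as \<Longrightarrow> root_prod as w = (w - b) * root_prod (remove1 b as) w"
  by (induction as) auto

text \<open>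
  When a closed path winds equally often around all poles, the residues of \<open>1/((w - a\<^sub>1) \<dots> (w - a\<^sub>n))\<close>
  cancel for \<open>n \<ge> 2\<close>. Partial fractions at two different poles lower \<open>n\<close>; if all poles agree there
  is a primitive.
\<close>

lemma contour_integral_inverse_root_prod:
  assumes "surrounds \<gamma> (set as) U" "length as \<ge> 2"
  shows "((\<lambda>w. 1 / root_prod as w) has_contour_integral 0) \<gamma>"
  using assms
proof (induction "length as" arbitrary: as rule: less_induct)
  case less
  note \<gamma> = surroundsD[OF less.prems(1)]
  obtain a rest where as: "as = a # rest" "rest \<noteq> []"
    using less.prems(2) by (cases as) (auto simp: Suc_le_length_iff)
  have single: "((\<lambda>w. 1 / (w - c)) has_contour_integral (2 * pi * \<i>)) \<gamma>" if "c \<in> set as" for c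
    using has_contour_integral_winding_number[OF \<gamma>(1), of c] \<gamma>(3,4) that by auto
  show ?case
  proof (cases "\<exists>b\<in>set rest. b \<noteq> a")
    case True
    then obtain b where b: "b \<in> set rest" "b \<noteq> a" by blast
    define bs where "bs = remove1 b rest"
    have set_bs: "set bs \<subseteq> set rest"
      unfolding bs_def by (rule set_remove1_subset)
    have len: "length bs + 2 = length as"
      using b(1) as by (simp add: bs_def length_remove1)
    have IH: "\<exists>I. ((\<lambda>w. 1 / root_prod (c # bs) w) has_contour_integral I) \<gamma> \<and>
        I = (if bs = [] then 2 * pi * \<i> else 0)" if c: "c = a \<or> c = b" for c
    proof (cases "bs = []")
      case True
      then show ?thesis
        using single[of c] c as b by auto
    next
      case False
      have "surrounds \<gamma> (set (c # bs)) U"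
        by (rule surrounds_subset[OF less.prems(1)]) (use c as b set_bs in auto)
      then have "((\<lambda>w. 1 / root_prod (c # bs) w) has_contour_integral 0) \<gamma>"
        using len False by (intro less.hyps) (auto simp: Suc_le_eq)
      then show ?thesis using False by simp
    qed
    then have "((\<lambda>w. (1 / root_prod (a # bs) w - 1 / root_prod (b # bs) w) / (a - b)) has_contour_integral
        ((if bs = [] then 2 * pi * \<i> else 0) - (if bs = [] then 2 * pi * \<i> else 0)) / (a - b)) \<gamma>"
      by (intro has_contour_integral_div has_contour_integral_diff) auto
    then have "((\<lambda>w. (1 / root_prod (a # bs) w - 1 / root_prod (b # bs) w) / (a - b))
        has_contour_integral 0) \<gamma>" by simp
    then show ?thesis
    proof (rule has_contour_integral_eq)
      fix w assume "w \<in> path_image \<gamma>"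
      then have "w \<notin> set as" using \<gamma>(3) by auto
      then have nz: "w - a \<noteq> 0" "w - b \<noteq> 0" "root_prod bs w \<noteq> 0"
        using as b set_bs by (auto simp: root_prod_eq_0_iff)
      have "root_prod as w = (w - a) * ((w - b) * root_prod bs w)"
        using root_prod_remove1[OF b(1), of w] by (simp add: as bs_def)
      then show "(1 / root_prod (a # bs) w - 1 / root_prod (b # bs) w) / (a - b) = 1 / root_prod as w"
        using nz b(2) by (simp add: divide_simps)
    qed
  next
    case False
    define n where "n = length rest"
    have n: "n \<ge> 1" using as by (cases rest) (auto simp: n_def)
    have "rest = replicate n a"
      using False unfolding n_def by (intro replicate_eqI) auto
    then have rp: "root_prod as w = (w - a) ^ Suc n" for w
      by (simp add: as root_prod_def prod_list_replicate map_replicate_const)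
    have nr: "of_nat n \<noteq> (0::complex)" using n by simp
    have "((\<lambda>w. 1 / root_prod as w) has_contour_integral 0) \<gamma>"
    proof (rule Cauchy_theorem_primitive[where S = "- {a}" and f = "\<lambda>w. - 1 / (of_nat n * (w - a) ^ n)"])
      fix w assume "w \<in> - {a}"
      then have w: "w - a \<noteq> 0" by simp
      obtain k where k: "n = Suc k" using n by (cases n) auto
      have "((\<lambda>w. - 1 / (of_nat n * (w - a) ^ n)) has_field_derivative
          (0 * (of_nat n * (w - a) ^ n) - (- 1) * (of_nat n * (of_nat n * (w - a) ^ (n - 1)))) /
          ((of_nat n * (w - a) ^ n) * (of_nat n * (w - a) ^ n))) (at w within - {a})"
        using w nr by (intro DERIV_divide DERIV_const) (auto intro!: derivative_eq_intros)
      also have "(0 * (of_nat n * (w - a) ^ n) - (- 1) * (of_nat n * (of_nat n * (w - a) ^ (n - 1)))) /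
          ((of_nat n * (w - a) ^ n) * (of_nat n * (w - a) ^ n)) = 1 / root_prod as w"
        unfolding rp using w nr by (simp add: k divide_simps)
      finally show "((\<lambda>w. - 1 / (of_nat n * (w - a) ^ n)) has_field_derivative 1 / root_prod as w)
          (at w within - {a})" .
    next
      show "path_image \<gamma> \<subseteq> - {a}" using \<gamma>(3) as by auto
    qed (use \<gamma> in auto)
    then show ?thesis .
  qed
qed

text \<open>
  The residue sum of \<open>F(w)/((w - a\<^sub>1) \<dots> (w - a\<^sub>n))\<close>: the divided difference \<open>F[a\<^sub>1, \<dots>, a\<^sub>n]\<close>,
  confluent nodes included.
\<close>

fun divided_diff :: "(complex \<Rightarrow> complex) \<Rightarrow> complex list \<Rightarrow> complex" where
  "divided_diff F [] = 0"
| "divided_diff F (a # as) = (if as = [] then F a else 0) +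
     divided_diff (\<lambda>z. if z = a then deriv F a else (F z - F a) / (z - a)) as"

lemma difference_quotient_const:
  "(\<lambda>z. if z = a then deriv (\<lambda>_. c) a else (c - c) / (z - a)) = (\<lambda>_. 0 :: complex)"
  by auto

lemma divided_diff_const_0: "divided_diff (\<lambda>_. 0) as = 0"
  by (induction as) (simp_all add: difference_quotient_const)

lemma divided_diff_const_1: "divided_diff (\<lambda>_. 1) as = (if length as = 1 then 1 else 0)"
  by (cases as) (auto simp: divided_diff_const_0 difference_quotient_const)

text \<open>
  Splitting \<open>F(w) = F(a) + (w - a) G(w)\<close> removes one pole from the part with \<open>G\<close> and leaves a constant
  numerator in the other.
\<close>

lemma contour_integral_divided_diff:
  assumes "open U" "F holomorphic_on U" "surrounds \<gamma> (set as) U"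
  shows "((\<lambda>w. F w / root_prod as w) has_contour_integral (2 * pi * \<i> * divided_diff F as)) \<gamma>"
  using assms(2,3)
proof (induction as arbitrary: F)
  case Nil
  note \<gamma> = surroundsD[OF Nil(2)]
  show ?case
    using Cauchy_theorem_global[OF assms(1) Nil(1) \<gamma>(1,2) _ \<gamma>(5)] \<gamma>(3) by auto
next
  case (Cons a as)
  note \<gamma> = surroundsD[OF Cons.prems(2)]
  let ?G = "\<lambda>z. if z = a then deriv F a else (F z - F a) / (z - a)"
  have "?G holomorphic_on U"
    by (rule pole_lemma_open[OF Cons.prems(1) assms(1)])
  moreover have "surrounds \<gamma> (set as) U"
    by (rule surrounds_subset[OF Cons.prems(2)]) auto
  ultimately have G: "((\<lambda>w. ?G w / root_prod as w) has_contour_integral (2 * pi * \<i> * divided_diff ?G as)) \<gamma>"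
    by (rule Cons.IH)
  have "((\<lambda>w. 1 / root_prod (a # as) w) has_contour_integral (if as = [] then 2 * pi * \<i> else 0)) \<gamma>"
  proof (cases "as = []")
    case True
    then show ?thesis
      using has_contour_integral_winding_number[OF \<gamma>(1), of a] \<gamma>(3,4) by auto
  next
    case False
    then have "length (a # as) \<ge> 2" by (cases as) auto
    then show ?thesis
      using contour_integral_inverse_root_prod[OF Cons.prems(2)] False by simp
  qed
  from has_contour_integral_add[OF has_contour_integral_lmul[OF this, of "F a"] G]
  have "((\<lambda>w. F a * (1 / root_prod (a # as) w) + ?G w / root_prod as w) has_contour_integral
      (2 * pi * \<i> * divided_diff F (a # as))) \<gamma>"
    by (simp add: algebra_simps split: if_splits)
  then show ?case
  proof (rule has_contour_integral_eq)
    fix w assume "w \<in> path_image \<gamma>"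
    then have "w - a \<noteq> 0" "root_prod as w \<noteq> 0"
      using \<gamma>(3) by (auto simp: root_prod_eq_0_iff)
    then show "F a * (1 / root_prod (a # as) w) + ?G w / root_prod as w = F w / root_prod (a # as) w"
      by (simp add: divide_simps)
  qed
qed

section \<open>The holomorphic functional calculus in finite dimension\<close>

text \<open>
  \<open>shift_apply T [a\<^sub>1, \<dots>, a\<^sub>n] g\<close> is \<open>(T - a\<^sub>n) \<dots> (T - a\<^sub>1) g\<close>. When it vanishes,
  \<open>resolvent_rat\<close> is the matrix coefficient of the resolvent that \<open>1/(w-T) = (1 + (T-a)/(w-T))/(w-a)\<close>
  yields by iteration.
\<close>

fun shift_apply :: "(l2_circ \<Rightarrow> l2_circ) \<Rightarrow> complex list \<Rightarrow> l2_circ \<Rightarrow> l2_circ" where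
  "shift_apply T [] g = g"
| "shift_apply T (a # as) g = shift_apply T as (T g - a *\<^sub>C g)"

fun resolvent_rat :: "(l2_circ \<Rightarrow> l2_circ) \<Rightarrow> l2_circ \<Rightarrow> complex list \<Rightarrow> l2_circ \<Rightarrow> complex \<Rightarrow> complex" where
  "resolvent_rat T k [] g w = 0"
| "resolvent_rat T k (a # as) g w = (cinner g k + resolvent_rat T k as (T g - a *\<^sub>C g) w) / (w - a)"

text \<open>
  The contour integral of \<open>F(w) \<langle>(w-T)\<^sup>-\<^sup>1 g, k\<rangle>\<close>, divided by \<open>2\<pi>\<i>\<close>, in terms of data that do not
  involve the contour. The list \<open>bs\<close> accumulates the poles already split off.
\<close>

fun calculus_value :: "(complex \<Rightarrow> complex) \<Rightarrow> (l2_circ \<Rightarrow> l2_circ) \<Rightarrow> l2_circ \<Rightarrow>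
    complex list \<Rightarrow> complex list \<Rightarrow> l2_circ \<Rightarrow> complex" where
  "calculus_value F T k bs [] g = 0"
| "calculus_value F T k bs (a # as) g = cinner g k * divided_diff F (bs @ [a]) +
     calculus_value F T k (bs @ [a]) as (T g - a *\<^sub>C g)"

lemma calculus_value_const_1:
  "bs \<noteq> [] \<Longrightarrow> calculus_value (\<lambda>_. 1) T k bs as g = 0"
  by (induction as arbitrary: bs g) (simp_all add: divided_diff_const_1)

lemma contour_integral_resolvent_rat:
  assumes "open U" "F holomorphic_on U" "surrounds \<gamma> (set (bs @ as)) U"
  shows "((\<lambda>w. F w * resolvent_rat T k as g w / root_prod bs w) has_contour_integral
    (2 * pi * \<i> * calculus_value F T k bs as g)) \<gamma>"
  using assms(3)
proof (induction as arbitrary: bs g)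
  case Nil
  then show ?case by (simp add: has_contour_integral_0)
next
  case (Cons a as)
  have "((\<lambda>w. F w * resolvent_rat T k as (T g - a *\<^sub>C g) w / root_prod (bs @ [a]) w) has_contour_integral
    (2 * pi * \<i> * calculus_value F T k (bs @ [a]) as (T g - a *\<^sub>C g))) \<gamma>"
    using Cons.prems by (intro Cons.IH) simp
  moreover have "((\<lambda>w. F w / root_prod (bs @ [a]) w) has_contour_integral
    (2 * pi * \<i> * divided_diff F (bs @ [a]))) \<gamma>"
    by (rule contour_integral_divided_diff[OF assms(1,2) surrounds_subset[OF Cons.prems]]) auto
  ultimately have "((\<lambda>w. cinner g k * (F w / root_prod (bs @ [a]) w) +
      F w * resolvent_rat T k as (T g - a *\<^sub>C g) w / root_prod (bs @ [a]) w) has_contour_integral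
      (cinner g k * (2 * pi * \<i> * divided_diff F (bs @ [a])) +
       2 * pi * \<i> * calculus_value F T k (bs @ [a]) as (T g - a *\<^sub>C g))) \<gamma>"
    by (intro has_contour_integral_add has_contour_integral_lmul)
  moreover have "cinner g k * (2 * pi * \<i> * divided_diff F (bs @ [a])) +
       2 * pi * \<i> * calculus_value F T k (bs @ [a]) as (T g - a *\<^sub>C g) =
     2 * pi * \<i> * calculus_value F T k bs (a # as) g"
    by (simp add: algebra_simps)
  moreover have "cinner g k * (F w / root_prod (bs @ [a]) w) +
      F w * resolvent_rat T k as (T g - a *\<^sub>C g) w / root_prod (bs @ [a]) w =
      F w * resolvent_rat T k (a # as) g w / root_prod bs w" for w
    by (simp add: add_divide_distrib algebra_simps)
  ultimately show ?case by (simp only:)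
qed

lemma resolvent_rat_continuous:
  "A \<inter> set as = {} \<Longrightarrow> continuous_on A (resolvent_rat T k as g)"
proof (induction as arbitrary: g)
  case (Cons a as)
  have "continuous_on A (\<lambda>w. (cinner g k + resolvent_rat T k as (T g - a *\<^sub>C g) w) / (w - a))"
    using Cons.prems by (intro continuous_intros Cons.IH) auto
  then show ?case by simp
qed simp

context onb
begin

lemma shift_in: "lin_on K T \<Longrightarrow> g \<in> K \<Longrightarrow> T g - a *\<^sub>C g \<in> K"
  by (rule diff_in[OF lin_onD(1) scale_in])

lemma lin_on_funpow: "lin_on K T \<Longrightarrow> lin_on K (T ^^ n)"
proof (induction n)
  case 0
  then show ?case by (simp add: lin_on_def)
next
  case (Suc n)
  then show ?case by (simp add: lin_on_def)
qed

definition poly_op :: "nat \<Rightarrow> complex poly \<Rightarrow> (l2_circ \<Rightarrow> l2_circ) \<Rightarrow> l2_circ \<Rightarrow> l2_circ" where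
  "poly_op n p T g = (\<Sum>i\<le>n. coeff p i *\<^sub>C (T ^^ i) g)"

lemma poly_op_in: "lin_on K T \<Longrightarrow> g \<in> K \<Longrightarrow> poly_op n p T g \<in> K"
  unfolding poly_op_def by (intro sum_in scale_in lin_onD(1)[OF lin_on_funpow])

lemma poly_op_linear_factor:
  assumes T: "lin_on K T" and g: "g \<in> K" and deg: "degree q \<le> n"
  shows "poly_op (Suc n) ([:- a, 1:] * q) T g = poly_op n q T (T g - a *\<^sub>C g)"
    and "poly_op n q T (T g - a *\<^sub>C g) = T (poly_op n q T g) - a *\<^sub>C poly_op n q T g"
proof -
  have in_K: "(T ^^ i) g \<in> K" for i
    by (rule lin_onD(1)[OF lin_on_funpow[OF T] g])
  have step: "(T ^^ i) (T g - a *\<^sub>C g) = (T ^^ Suc i) g - a *\<^sub>C (T ^^ i) g" for i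
    using lin_on_diff[OF lin_on_funpow[OF T] lin_onD(1)[OF T g] scale_in[OF g]]
      lin_onD(3)[OF lin_on_funpow[OF T] g] by (simp add: funpow_swap1)
  have q: "poly_op n q T (T g - a *\<^sub>C g) =
      (\<Sum>i\<le>n. coeff q i *\<^sub>C (T ^^ Suc i) g) - (\<Sum>i\<le>n. (coeff q i * a) *\<^sub>C (T ^^ i) g)"
    unfolding poly_op_def step by (simp only: scaleC_diff_right sum_subtractf cvec.scale_scale)
  have c0: "coeff q (Suc n) = 0"
    using deg by (simp add: coeff_eq_0)
  have p: "coeff ([:- a, 1:] * q) i = (if i = 0 then 0 else coeff q (i - 1)) - coeff q i * a" for i
    by (cases i) (simp_all add: mult.commute)
  have "poly_op (Suc n) ([:- a, 1:] * q) T g =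
      (\<Sum>i\<le>Suc n. (if i = 0 then 0 else coeff q (i - 1)) *\<^sub>C (T ^^ i) g) -
      (\<Sum>i\<le>Suc n. (coeff q i * a) *\<^sub>C (T ^^ i) g)"
    unfolding poly_op_def p by (simp only: cvec.scale_left_diff_distrib sum_subtractf)
  also have "(\<Sum>i\<le>Suc n. (if i = 0 then 0 else coeff q (i - 1)) *\<^sub>C (T ^^ i) g) =
      (\<Sum>i\<le>n. coeff q i *\<^sub>C (T ^^ Suc i) g)"
    by (subst sum.atMost_Suc_shift) simp
  also have "(\<Sum>i\<le>Suc n. (coeff q i * a) *\<^sub>C (T ^^ i) g) = (\<Sum>i\<le>n. (coeff q i * a) *\<^sub>C (T ^^ i) g)"
    by (simp add: c0)
  finally show "poly_op (Suc n) ([:- a, 1:] * q) T g = poly_op n q T (T g - a *\<^sub>C g)"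
    unfolding q .
  have "T (poly_op n q T g) = (\<Sum>i\<le>n. coeff q i *\<^sub>C T ((T ^^ i) g))"
    unfolding poly_op_def by (rule lin_on_sum[OF T]) (auto simp: in_K)
  moreover have "a *\<^sub>C poly_op n q T g = (\<Sum>i\<le>n. (coeff q i * a) *\<^sub>C (T ^^ i) g)"
    unfolding poly_op_def by (simp add: cvec.scale_sum_right mult.commute)
  ultimately show "poly_op n q T (T g - a *\<^sub>C g) = T (poly_op n q T g) - a *\<^sub>C poly_op n q T g"
    unfolding q by simp
qed

text \<open>The iterates of \<open>T\<close> on a vector are linearly dependent, since there are more than \<open>dim K\<close> of them.\<close>

lemma krylov_polynomial:
  assumes T: "lin_on K T" and g: "g \<in> K"
  obtains p where "p \<noteq> 0" "poly_op (degree p) p T g = 0"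
proof -
  have bound: "poly_op n p T g = poly_op (degree p) p T g" if "degree p \<le> n" for n p
    unfolding poly_op_def using that
    by (intro sum.mono_neutral_right) (auto simp: coeff_eq_0)
  let ?N = "card I" and ?v = "\<lambda>i. (T ^^ i) g"
  have in_K: "?v i \<in> K" for i
    by (rule lin_onD(1)[OF lin_on_funpow[OF T] g])
  have "\<exists>c. (\<exists>i\<le>?N. c i \<noteq> 0) \<and> (\<Sum>i\<le>?N. c i *\<^sub>C ?v i) = 0"
  proof (cases "inj_on ?v {..?N}")
    case True
    let ?S = "?v ` {..?N}"
    have "\<not> cvec.independent ?S"
    proof
      assume "cvec.independent ?S"
      moreover have "?S \<subseteq> cvec.span (e ` I)"
        using in_K span by auto
      ultimately have "card ?S \<le> card (e ` I)"
        using cvec.independent_span_bound[of "e ` I" ?S] fin by auto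
      then show False
        using True inj_basis by (simp add: card_image)
    qed
    then obtain u where u: "\<exists>v\<in>?S. u v \<noteq> 0" "(\<Sum>v\<in>?S. u v *\<^sub>C v) = 0"
      using cvec.dependent_finite[of ?S] by auto
    have "(\<Sum>i\<le>?N. u (?v i) *\<^sub>C ?v i) = 0"
      using u(2) True by (simp add: sum.reindex)
    then show ?thesis
      using u(1) by (intro exI[of _ "\<lambda>i. u (?v i)"]) auto
  next
    case False
    then obtain i j where ij: "i \<le> ?N" "j \<le> ?N" "i \<noteq> j" "?v i = ?v j"
      by (auto simp: inj_on_def)
    define c where "c l = (if l = i then 1 else if l = j then -1 else (0::complex))" for l
    have "(\<Sum>l\<le>?N. c l *\<^sub>C ?v l) = (\<Sum>l\<in>{i, j}. c l *\<^sub>C ?v l)"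
      using ij by (intro sum.mono_neutral_right) (auto simp: c_def)
    also have "\<dots> = 0"
      using ij by (simp add: c_def)
    finally show ?thesis
      using ij(1) by (intro exI[of _ c]) (auto simp: c_def)
  qed
  then obtain c i where c: "i \<le> ?N" "c i \<noteq> 0" "(\<Sum>i\<le>?N. c i *\<^sub>C ?v i) = 0" by blast
  define p where "p = (\<Sum>i\<le>?N. monom (c i) i)"
  have coeff: "coeff p l = (if l \<le> ?N then c l else 0)" for l
    unfolding p_def coeff_sum by (simp add: if_distrib cong: if_cong)
  have "degree p \<le> ?N"
    by (rule degree_le) (simp add: coeff)
  moreover have "poly_op ?N p T g = 0"
    unfolding poly_op_def using c(3) by (simp add: coeff)
  moreover have "p \<noteq> 0"
    using c(1,2) coeff[of i] by auto
  ultimately show ?thesis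
    using that bound by metis
qed

lemma spectrum_complement:
  assumes "w \<notin> op_spectrum K T"
  shows "bij_betw (\<lambda>g. w *\<^sub>C g - T g) K K"
  using assms by (simp add: op_spectrum_def)

text \<open>
  An annihilating polynomial splits into linear factors; a factor \<open>T - a\<close> with \<open>a\<close> outside the
  spectrum is injective and can be cancelled.
\<close>

lemma annihilating_list:
  assumes T: "lin_on K T" and g: "g \<in> K"
  obtains as where "set as \<subseteq> op_spectrum K T" "shift_apply T as g = 0"
proof -
  have "\<exists>as. set as \<subseteq> op_spectrum K T \<and> shift_apply T as g = 0"
    if "degree p = n" "p \<noteq> 0" "g \<in> K" "poly_op n p T g = 0" for n p g
    using that
  proof (induction n arbitrary: p g)
    case 0
    then obtain c where "p = [:c:]" "c \<noteq> 0"
      by (metis degree_eq_zeroE pCons_0_0)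
    then have "g = 0"
      using 0 by (simp add: poly_op_def)
    then show ?case by (intro exI[of _ "[]"]) simp
  next
    case (Suc n)
    have "\<not> constant (poly p)"
      using Suc.prems(1) constant_degree by force
    then obtain a where "poly p a = 0"
      using fundamental_theorem_of_algebra by blast
    then obtain q where pq: "p = [:- a, 1:] * q"
      unfolding poly_eq_0_iff_dvd by (auto simp: dvd_def)
    have q0: "q \<noteq> 0" using Suc.prems(2) pq by auto
    have "degree p = Suc (degree q)"
      unfolding pq using q0 by (subst degree_mult_eq) auto
    then have dq: "degree q = n" using Suc.prems(1) by simp
    let ?h = "T g - a *\<^sub>C g"
    have h: "?h \<in> K" by (rule shift_in[OF T Suc.prems(3)])
    have qh: "poly_op n q T ?h = 0"
      using poly_op_linear_factor(1)[OF T Suc.prems(3), of q n a] dq Suc.prems(4) pq by simp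
    show ?case
    proof (cases "a \<in> op_spectrum K T")
      case True
      obtain as where "set as \<subseteq> op_spectrum K T" "shift_apply T as ?h = 0"
        using Suc.IH[OF dq q0 h qh] by blast
      then show ?thesis
        using True by (intro exI[of _ "a # as"]) simp
    next
      case False
      have "T (poly_op n q T g) - a *\<^sub>C poly_op n q T g = 0"
        using poly_op_linear_factor(2)[OF T Suc.prems(3), of q n a] dq qh by simp
      then have "a *\<^sub>C poly_op n q T g - T (poly_op n q T g) = a *\<^sub>C 0 - T 0"
        using lin_onD(3)[OF T zero_in, of 0] by simp
      moreover have "inj_on (\<lambda>g. a *\<^sub>C g - T g) K"
        using spectrum_complement[OF False] by (simp add: bij_betw_def)
      ultimately have "poly_op n q T g = 0"
        using poly_op_in[OF T Suc.prems(3)] by (elim inj_onD) auto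
      then show ?thesis
        using Suc.IH[OF dq q0 Suc.prems(3)] by blast
    qed
  qed
  moreover obtain p where "p \<noteq> 0" "poly_op (degree p) p T g = 0"
    using krylov_polynomial[OF T g] by blast
  ultimately show ?thesis
    using that g by blast
qed

lemma resolvent_in_eq:
  assumes w: "w \<notin> op_spectrum K T" and g: "g \<in> K"
  shows resolvent_in: "resolvent K T w g \<in> K"
    and resolvent_eq: "w *\<^sub>C resolvent K T w g - T (resolvent K T w g) = g"
proof -
  have im: "g \<in> (\<lambda>g. w *\<^sub>C g - T g) ` K"
    using spectrum_complement[OF w] g by (simp add: bij_betw_def)
  show "resolvent K T w g \<in> K"
    unfolding resolvent_def by (rule inv_into_into[OF im])
  show "w *\<^sub>C resolvent K T w g - T (resolvent K T w g) = g"
    unfolding resolvent_def by (rule f_inv_into_f[OF im])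
qed

lemma resolvent_eqI:
  assumes "w \<notin> op_spectrum K T" "y \<in> K" "w *\<^sub>C y - T y = g"
  shows "resolvent K T w g = y"
  unfolding resolvent_def using spectrum_complement[OF assms(1)] assms(2,3)
  by (intro inv_into_f_eq) (auto simp: bij_betw_def)

lemma resolvent_add:
  assumes T: "lin_on K T" and w: "w \<notin> op_spectrum K T" and g: "g \<in> K" "h \<in> K"
  shows "resolvent K T w (g + h) = resolvent K T w g + resolvent K T w h"
  using resolvent_eq[OF w g(1)] resolvent_eq[OF w g(2)] resolvent_in[OF w g(1)] resolvent_in[OF w g(2)]
  by (intro resolvent_eqI[OF w])
    (auto simp: add_in lin_onD(2)[OF T] cvec.scale_right_distrib algebra_simps)

lemma resolvent_scale:
  assumes T: "lin_on K T" and w: "w \<notin> op_spectrum K T" and g: "g \<in> K"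
  shows "resolvent K T w (c *\<^sub>C g) = c *\<^sub>C resolvent K T w g"
proof (rule resolvent_eqI[OF w])
  let ?r = "resolvent K T w g"
  have "w *\<^sub>C (c *\<^sub>C ?r) - T (c *\<^sub>C ?r) = c *\<^sub>C (w *\<^sub>C ?r - T ?r)"
    by (simp add: lin_onD(3)[OF T] resolvent_in w g scaleC_diff_right mult.commute)
  then show "w *\<^sub>C (c *\<^sub>C ?r) - T (c *\<^sub>C ?r) = c *\<^sub>C g"
    by (simp add: resolvent_eq w g)
qed (simp add: scale_in resolvent_in w g)

lemma cinner_resolvent:
  assumes T: "lin_on K T" and w: "w \<notin> op_spectrum K T"
    and "g \<in> K" "set as \<subseteq> op_spectrum K T" "shift_apply T as g = 0"
  shows "cinner (resolvent K T w g) k = resolvent_rat T k as g w"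
  using assms(3-)
proof (induction as arbitrary: g)
  case Nil
  then have "g = 0" by simp
  have "T 0 = 0"
    using lin_onD(3)[OF T zero_in, of 0] by simp
  then have "resolvent K T w 0 = 0"
    by (intro resolvent_eqI[OF w]) auto
  then show ?case using \<open>g = 0\<close> by simp
next
  case (Cons a as)
  have wa: "w - a \<noteq> 0" using Cons.prems(2) w by auto
  let ?h = "T g - a *\<^sub>C g"
  let ?r = "resolvent K T w ?h"
  have h: "?h \<in> K" by (rule shift_in[OF T Cons.prems(1)])
  have r: "?r \<in> K" by (rule resolvent_in[OF w h])
  have "resolvent K T w g = (1 / (w - a)) *\<^sub>C (g + ?r)"
  proof (rule resolvent_eqI[OF w])
    show "(1 / (w - a)) *\<^sub>C (g + ?r) \<in> K"
      by (intro scale_in add_in r Cons.prems)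
    have "w *\<^sub>C (g + ?r) - T (g + ?r) = (w *\<^sub>C g - T g) + (w *\<^sub>C ?r - T ?r)"
      using Cons.prems(1) r by (simp add: lin_onD(2)[OF T] cvec.scale_right_distrib)
    also have "\<dots> = (w - a) *\<^sub>C g"
      unfolding resolvent_eq[OF w h] by (simp add: cvec.scale_left_diff_distrib)
    finally have eq: "w *\<^sub>C (g + ?r) - T (g + ?r) = (w - a) *\<^sub>C g" .
    have "w *\<^sub>C ((1 / (w - a)) *\<^sub>C (g + ?r)) - T ((1 / (w - a)) *\<^sub>C (g + ?r)) =
        (1 / (w - a)) *\<^sub>C (w *\<^sub>C (g + ?r) - T (g + ?r))"
      using add_in[OF Cons.prems(1) r] by (simp add: lin_onD(3)[OF T] scaleC_diff_right mult.commute)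
    then show "w *\<^sub>C ((1 / (w - a)) *\<^sub>C (g + ?r)) - T ((1 / (w - a)) *\<^sub>C (g + ?r)) = g"
      unfolding eq using wa by simp
  qed
  moreover have "cinner ?r k = resolvent_rat T k as ?h w"
    using Cons.prems by (intro Cons.IH h) auto
  ultimately show ?case
    by (simp add: cinner_scale_left cinner_add_left)
qed

text \<open>
  A matrix coefficient of the resolvent is a rational function, so its integral against \<open>f\<close> is a
  combination of divided differences of \<open>f\<close>, the same for every contour around the spectrum.
\<close>

lemma contour_integral_resolvent:
  assumes T: "lin_on K T" and U: "open U" and f: "f holomorphic_on U" and g: "g \<in> K"
  obtains as where
    "\<And>\<gamma>. surrounds \<gamma> (op_spectrum K T) U \<Longrightarrow>
      ((\<lambda>w. f w * cinner (resolvent K T w g) k) has_contour_integral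
        2 * pi * \<i> * calculus_value f T k [] as g) \<gamma>"
    "continuous_on (- op_spectrum K T) (\<lambda>w. cinner (resolvent K T w g) k)"
    "shift_apply T as g = 0"
proof -
  obtain as where as: "set as \<subseteq> op_spectrum K T" "shift_apply T as g = 0"
    by (rule annihilating_list[OF T g])
  have eq: "cinner (resolvent K T w g) k = resolvent_rat T k as g w" if "w \<notin> op_spectrum K T" for w
    by (rule cinner_resolvent[OF T that g as])
  show ?thesis
  proof (rule that[of as])
    fix \<gamma> assume \<gamma>: "surrounds \<gamma> (op_spectrum K T) U"
    have "((\<lambda>w. f w * resolvent_rat T k as g w / root_prod [] w) has_contour_integral
        2 * pi * \<i> * calculus_value f T k [] as g) \<gamma>"
      using as by (intro contour_integral_resolvent_rat[OF U f] surrounds_subset[OF \<gamma>]) simp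
    then show "((\<lambda>w. f w * cinner (resolvent K T w g) k) has_contour_integral
        2 * pi * \<i> * calculus_value f T k [] as g) \<gamma>"
      by (rule has_contour_integral_eq) (use surroundsD(3)[OF \<gamma>] eq in auto)
  next
    have "continuous_on (- op_spectrum K T) (resolvent_rat T k as g)"
      using as by (intro resolvent_rat_continuous) auto
    then show "continuous_on (- op_spectrum K T) (\<lambda>w. cinner (resolvent K T w g) k)"
      by (rule continuous_on_eq) (use eq in auto)
  qed (rule as)
qed

lemma contour_integral_resolvent_1:
  assumes T: "lin_on K T" and g: "g \<in> K" and \<gamma>: "surrounds \<gamma> (op_spectrum K T) UNIV"
  shows "((\<lambda>w. cinner (resolvent K T w g) k) has_contour_integral (2 * pi * \<i> * cinner g k)) \<gamma>"
proof -
  obtain as where as: "\<And>\<gamma>. surrounds \<gamma> (op_spectrum K T) UNIV \<Longrightarrow>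
      ((\<lambda>w. 1 * cinner (resolvent K T w g) k) has_contour_integral
        2 * pi * \<i> * calculus_value (\<lambda>_. 1) T k [] as g) \<gamma>" "shift_apply T as g = 0"
    using contour_integral_resolvent[OF T open_UNIV holomorphic_on_const g, of 1 k] by blast
  have "calculus_value (\<lambda>_. 1) T k [] as g = cinner g k"
    using as(2) by (cases as) (auto simp: divided_diff_const_1 calculus_value_const_1)
  then show ?thesis
    using as(1)[OF \<gamma>] by simp
qed

lemma holomorphic_calculus_eq:
  assumes T: "lin_on K T" and U: "open U" and f: "f holomorphic_on U" and g: "g \<in> K"
    and ex: "surrounds \<gamma>' (op_spectrum K T) U"
  shows "holomorphic_calculus K U f T g \<in> K"
    and "k \<in> K \<Longrightarrow> surrounds \<gamma> (op_spectrum K T) U \<Longrightarrow>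
      ((\<lambda>w. f w * cinner (resolvent K T w g) k) has_contour_integral
        2 * of_real pi * \<i> * cinner (holomorphic_calculus K U f T g) k) \<gamma>"
proof -
  define \<gamma>0 where "\<gamma>0 = (SOME \<gamma>. surrounds \<gamma> (op_spectrum K T) U)"
  have \<gamma>0: "surrounds \<gamma>0 (op_spectrum K T) U"
    unfolding \<gamma>0_def by (rule someI[where P = "\<lambda>\<gamma>. surrounds \<gamma> (op_spectrum K T) U", OF ex])
  let ?J = "\<lambda>k. contour_integral \<gamma>0 (\<lambda>w. f w * cinner (resolvent K T w g) k) / (2 * of_real pi * \<i>)"
  have int: "((\<lambda>w. f w * cinner (resolvent K T w g) k) has_contour_integral
      2 * of_real pi * \<i> * ?J k) \<gamma>" if "surrounds \<gamma> (op_spectrum K T) U" for k \<gamma>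
  proof -
    obtain as where as: "\<And>\<gamma>. surrounds \<gamma> (op_spectrum K T) U \<Longrightarrow>
      ((\<lambda>w. f w * cinner (resolvent K T w g) k) has_contour_integral
        2 * pi * \<i> * calculus_value f T k [] as g) \<gamma>"
      using contour_integral_resolvent[OF T U f g, of k] by blast
    have "contour_integral \<gamma>0 (\<lambda>w. f w * cinner (resolvent K T w g) k) =
        2 * pi * \<i> * calculus_value f T k [] as g"
      by (rule contour_integral_unique[OF as[OF \<gamma>0]])
    then show ?thesis
      using as[OF that] by simp
  qed
  define y where "y = (\<Sum>i\<in>I. ?J (e i) *\<^sub>C e i)"
  have y: "y \<in> K" by (simp add: y_def)
  have yJ: "cinner y k = ?J k" if k: "k \<in> K" for k
  proof -
    have "((\<lambda>w. \<Sum>i\<in>I. cnj (cinner k (e i)) * (f w * cinner (resolvent K T w g) (e i)))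
        has_contour_integral (\<Sum>i\<in>I. cnj (cinner k (e i)) * (2 * of_real pi * \<i> * ?J (e i)))) \<gamma>0"
      by (intro has_contour_integral_sum fin has_contour_integral_lmul int \<gamma>0)
    then have "((\<lambda>w. f w * cinner (resolvent K T w g) k)
        has_contour_integral (\<Sum>i\<in>I. cnj (cinner k (e i)) * (2 * of_real pi * \<i> * ?J (e i)))) \<gamma>0"
    proof (rule has_contour_integral_eq)
      fix w assume "w \<in> path_image \<gamma>0"
      then have "resolvent K T w g \<in> K"
        using surroundsD(3)[OF \<gamma>0] by (intro resolvent_in g) auto
      then have "cinner (resolvent K T w g) k =
          (\<Sum>i\<in>I. cinner (resolvent K T w g) (e i) * cnj (cinner k (e i)))"
        by (rule cinner_expand)
      then show "(\<Sum>i\<in>I. cnj (cinner k (e i)) * (f w * cinner (resolvent K T w g) (e i))) =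
          f w * cinner (resolvent K T w g) k"
        by (simp add: sum_distrib_left mult_ac)
    qed
    then have "?J k = (\<Sum>i\<in>I. cnj (cinner k (e i)) * (2 * of_real pi * \<i> * ?J (e i))) / (2 * of_real pi * \<i>)"
      by (simp only: contour_integral_unique)
    also have "\<dots> = (\<Sum>i\<in>I. ?J (e i) * cnj (cinner k (e i)))"
      by (simp add: sum_divide_distrib mult.commute)
    also have "\<dots> = (\<Sum>i\<in>I. cinner y (e i) * cnj (cinner k (e i)))"
      by (intro sum.cong refl) (simp only: y_def coeff_comb)
    also have "\<dots> = cinner y k"
      by (rule cinner_expand[OF y, symmetric])
    finally show ?thesis ..
  qed
  have "holomorphic_calculus K U f T g = y"
    unfolding holomorphic_calculus_def Let_def \<gamma>0_def[symmetric]
  proof (rule the_equality)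
    show "y \<in> K \<and> (\<forall>k\<in>K. cinner y k = ?J k)"
      using y yJ by blast
    show "z = y" if "z \<in> K \<and> (\<forall>k\<in>K. cinner z k = ?J k)" for z
      using that y yJ by (intro eqI_cinner) auto
  qed
  then show "holomorphic_calculus K U f T g \<in> K"
    and "k \<in> K \<Longrightarrow> surrounds \<gamma> (op_spectrum K T) U \<Longrightarrow>
      ((\<lambda>w. f w * cinner (resolvent K T w g) k) has_contour_integral
        2 * of_real pi * \<i> * cinner (holomorphic_calculus K U f T g) k) \<gamma>"
    using y yJ int by simp_all
qed

lemma holomorphic_calculus_eqI:
  assumes T: "lin_on K T" and U: "open U" and f: "f holomorphic_on U" and g: "g \<in> K"
    and \<gamma>: "surrounds \<gamma> (op_spectrum K T) U" and y: "y \<in> K"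
    and int: "\<And>k. k \<in> K \<Longrightarrow> ((\<lambda>w. f w * cinner (resolvent K T w g) k) has_contour_integral
        2 * of_real pi * \<i> * cinner y k) \<gamma>"
  shows "holomorphic_calculus K U f T g = y"
proof (rule eqI_cinner[OF holomorphic_calculus_eq(1)[OF T U f g \<gamma>] y])
  fix k assume k: "k \<in> K"
  have "2 * of_real pi * \<i> * cinner (holomorphic_calculus K U f T g) k = 2 * of_real pi * \<i> * cinner y k"
    using holomorphic_calculus_eq(2)[OF T U f g \<gamma> k \<gamma>] int[OF k] by (rule has_contour_integral_unique)
  then show "cinner (holomorphic_calculus K U f T g) k = cinner y k"
    by simp
qed

lemma holomorphic_calculus_lin_on:
  assumes T: "lin_on K T" and U: "open U" and f: "f holomorphic_on U"
    and \<gamma>: "surrounds \<gamma> (op_spectrum K T) U"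
  shows "lin_on K (holomorphic_calculus K U f T)"
  unfolding lin_on_def
proof (intro conjI ballI allI)
  let ?X = "holomorphic_calculus K U f T"
  note X = holomorphic_calculus_eq[OF T U f _ \<gamma>]
  have nS: "w \<notin> op_spectrum K T" if "w \<in> path_image \<gamma>" for w
    using surroundsD(3)[OF \<gamma>] that by auto
  show "?X g \<in> K" if "g \<in> K" for g by (rule X(1)[OF that])
  show "?X (g + h) = ?X g + ?X h" if gh: "g \<in> K" "h \<in> K" for g h
  proof (rule holomorphic_calculus_eqI[OF T U f add_in[OF gh] \<gamma>])
    show "?X g + ?X h \<in> K" by (intro add_in X(1) gh)
    fix k assume k: "k \<in> K"
    have "((\<lambda>w. f w * cinner (resolvent K T w g) k + f w * cinner (resolvent K T w h) k) has_contour_integral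
        2 * of_real pi * \<i> * cinner (?X g) k + 2 * of_real pi * \<i> * cinner (?X h) k) \<gamma>"
      by (intro has_contour_integral_add X(2) gh k \<gamma>)
    then have "((\<lambda>w. f w * cinner (resolvent K T w g) k + f w * cinner (resolvent K T w h) k) has_contour_integral
        2 * of_real pi * \<i> * cinner (?X g + ?X h) k) \<gamma>"
      by (simp add: cinner_add_left distrib_left)
    then show "((\<lambda>w. f w * cinner (resolvent K T w (g + h)) k) has_contour_integral
        2 * of_real pi * \<i> * cinner (?X g + ?X h) k) \<gamma>"
      by (rule has_contour_integral_eq)
        (simp add: resolvent_add[OF T nS gh] cinner_add_left distrib_left)
  qed
  show "?X (c *\<^sub>C g) = c *\<^sub>C ?X g" if g: "g \<in> K" for g c
  proof (rule holomorphic_calculus_eqI[OF T U f scale_in[OF g] \<gamma>])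
    show "c *\<^sub>C ?X g \<in> K" by (intro scale_in X(1) g)
    fix k assume k: "k \<in> K"
    have "((\<lambda>w. c * (f w * cinner (resolvent K T w g) k)) has_contour_integral
        c * (2 * of_real pi * \<i> * cinner (?X g) k)) \<gamma>"
      by (intro has_contour_integral_lmul X(2) g k \<gamma>)
    then have "((\<lambda>w. c * (f w * cinner (resolvent K T w g) k)) has_contour_integral
        2 * of_real pi * \<i> * cinner (c *\<^sub>C ?X g) k) \<gamma>"
      by (simp add: cinner_scale_left mult_ac)
    then show "((\<lambda>w. f w * cinner (resolvent K T w (c *\<^sub>C g)) k) has_contour_integral
        2 * of_real pi * \<i> * cinner (c *\<^sub>C ?X g) k) \<gamma>"
      by (rule has_contour_integral_eq)
        (simp add: resolvent_scale[OF T nS g] cinner_scale_left mult_ac)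
  qed
qed

text \<open>From \<open>w (w-T)\<^sup>-\<^sup>1 g = g + (w-T)\<^sup>-\<^sup>1 T g\<close> the calculus reproduces powers of \<open>T\<close>.\<close>

lemma resolvent_mult:
  assumes T: "lin_on K T" and w: "w \<notin> op_spectrum K T" and g: "g \<in> K"
  shows "w * cinner (resolvent K T w g) k = cinner g k + cinner (resolvent K T w (T g)) k"
proof -
  let ?r = "resolvent K T w g"
  have r: "?r \<in> K" by (rule resolvent_in[OF w g])
  have Tg: "T g \<in> K" by (rule lin_onD(1)[OF T g])
  have "resolvent K T w (T g) = T ?r"
  proof (rule resolvent_eqI[OF w lin_onD(1)[OF T r]])
    have "T (w *\<^sub>C ?r - T ?r) = w *\<^sub>C T ?r - T (T ?r)"
      using r lin_onD(1)[OF T r] by (simp add: lin_on_diff[OF T] scale_in lin_onD(3)[OF T])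
    then show "w *\<^sub>C T ?r - T (T ?r) = T g"
      unfolding resolvent_eq[OF w g] by simp
  qed
  moreover have "w *\<^sub>C ?r = g + T ?r"
    using resolvent_eq[OF w g] by (simp add: algebra_simps)
  ultimately show ?thesis
    by (metis cinner_add_left cinner_scale_left)
qed

lemma holomorphic_calculus_id_square:
  assumes T: "lin_on K T" and g: "g \<in> K" and \<gamma>: "surrounds \<gamma> (op_spectrum K T) UNIV"
  shows "holomorphic_calculus K UNIV (\<lambda>w. w) T g = T g"
    and "holomorphic_calculus K UNIV (\<lambda>w. w\<^sup>2) T g = T (T g)"
proof -
  note \<gamma>D = surroundsD[OF \<gamma>]
  have nS: "w \<notin> op_spectrum K T" if "w \<in> path_image \<gamma>" for w
    using \<gamma>D(3) that by auto
  have TK: "T h \<in> K" if "h \<in> K" for h using lin_onD(1)[OF T that] .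
  have entire: "(F has_contour_integral 0) \<gamma>" if "F holomorphic_on UNIV" for F
    using Cauchy_theorem_global[OF open_UNIV that \<gamma>D(1,2)] by simp
  have one: "((\<lambda>w. w * cinner (resolvent K T w h) k) has_contour_integral
      (2 * of_real pi * \<i> * cinner (T h) k)) \<gamma>" if h: "h \<in> K" for h k
  proof -
    have "((\<lambda>w. cinner h k + cinner (resolvent K T w (T h)) k) has_contour_integral
        0 + 2 * of_real pi * \<i> * cinner (T h) k) \<gamma>"
      using has_contour_integral_add[OF entire[OF holomorphic_on_const]
          contour_integral_resolvent_1[OF T TK[OF h] \<gamma>]] by simp
    then have "((\<lambda>w. w * cinner (resolvent K T w h) k) has_contour_integral
        0 + 2 * of_real pi * \<i> * cinner (T h) k) \<gamma>"
      by (rule has_contour_integral_eq) (simp add: resolvent_mult[OF T nS h])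
    then show ?thesis by simp
  qed
  show "holomorphic_calculus K UNIV (\<lambda>w. w) T g = T g"
    by (rule holomorphic_calculus_eqI[OF T open_UNIV _ g \<gamma> TK[OF g] one[OF g]])
      (intro holomorphic_intros)
  show "holomorphic_calculus K UNIV (\<lambda>w. w\<^sup>2) T g = T (T g)"
  proof (rule holomorphic_calculus_eqI[OF T open_UNIV _ g \<gamma> TK[OF TK[OF g]]])
    fix k
    have "((\<lambda>w. w * cinner g k + w * cinner (resolvent K T w (T g)) k) has_contour_integral
        0 + 2 * of_real pi * \<i> * cinner (T (T g)) k) \<gamma>"
      by (intro has_contour_integral_add entire holomorphic_intros one TK g)
    then have "((\<lambda>w. w\<^sup>2 * cinner (resolvent K T w g) k) has_contour_integral
        0 + 2 * of_real pi * \<i> * cinner (T (T g)) k) \<gamma>"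
    proof (rule has_contour_integral_eq)
      fix w assume "w \<in> path_image \<gamma>"
      then show "w * cinner g k + w * cinner (resolvent K T w (T g)) k = w\<^sup>2 * cinner (resolvent K T w g) k"
        using resolvent_mult[OF T nS g, of w k] by (simp add: power2_eq_square mult.assoc distrib_left)
    qed
    then show "((\<lambda>w. w\<^sup>2 * cinner (resolvent K T w g) k) has_contour_integral
        2 * of_real pi * \<i> * cinner (T (T g)) k) \<gamma>" by simp
  qed (intro holomorphic_intros)
qed

end

section \<open>Normalized reproducing kernels as approximate eigenvectors\<close>

lemma continuous_values_in_ess_range:
  assumes \<phi>: "continuous_on (sphere 0 1) \<phi>" and z: "cmod z = 1"
  shows "\<phi> z \<in> ess_range \<phi>"
  unfolding ess_range_def
proof (intro CollectI allI impI)
  fix \<epsilon> :: real assume \<epsilon>: "\<epsilon> > 0"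
  obtain V where V: "open V" "V \<inter> sphere 0 1 = \<phi> -` ball (\<phi> z) \<epsilon> \<inter> sphere 0 1"
    using \<phi> open_ball unfolding continuous_on_open_invariant by metis
  have "z \<in> V \<inter> sphere 0 1"
    unfolding V(2) using z \<epsilon> by simp
  then have "0 < emeasure circ (sphere 0 1 \<inter> V)"
    using circ_open_not_null[OF V(1) z] by simp
  moreover have "{\<zeta> \<in> space circ. dist (\<phi> \<zeta>) (\<phi> z) < \<epsilon>} = \<phi> -` ball (\<phi> z) \<epsilon> \<inter> sphere 0 1"
    by (auto simp: dist_commute)
  then have "{\<zeta> \<in> space circ. dist (\<phi> \<zeta>) (\<phi> z) < \<epsilon>} = sphere 0 1 \<inter> V"
    unfolding V(2)[symmetric] by (simp only: Int_commute)
  ultimately show "0 < emeasure circ {\<zeta> \<in> space circ. dist (\<phi> \<zeta>) (\<phi> z) < \<epsilon>}"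
    by simp
qed

lemma compact_hull_of_values:
  fixes \<phi> :: "complex \<Rightarrow> complex"
  assumes "continuous_on (sphere 0 1) \<phi>"
  shows "compact (convex hull (\<phi> ` sphere 0 1))" "convex hull (\<phi> ` sphere 0 1) \<noteq> {}"
  using assms by (auto intro!: compact_convex_hull compact_continuous_image)

lemma mult_op_selfadjoint:
  assumes \<phi>: "\<phi> \<in> L_inf" and real: "\<And>z. cmod z = 1 \<Longrightarrow> cnj (\<phi> z) = \<phi> z"
  shows "cinner (mult_op \<phi> g) h = cinner g (mult_op \<phi> h)"
proof -
  have "cinner (mult_op \<phi> g) h = cinner (l2 (\<lambda>z. \<phi> z * rep_l2_circ g z)) (l2 (rep_l2_circ h))"
    by (simp add: mult_op_rep[OF \<phi>])
  also have "\<dots> = (LINT z|circ. (\<phi> z * rep_l2_circ g z) * cnj (rep_l2_circ h z))"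
    by (intro cinner_l2 sq_int_mult \<phi> rep_sq_int)
  also have "\<dots> = (LINT z|circ. rep_l2_circ g z * cnj (\<phi> z * rep_l2_circ h z))"
    by (intro circ_integral_cong) (simp add: real)
  also have "\<dots> = cinner (l2 (rep_l2_circ g)) (l2 (\<lambda>z. \<phi> z * rep_l2_circ h z))"
    by (intro cinner_l2[symmetric] sq_int_mult \<phi> rep_sq_int)
  also have "\<dots> = cinner g (mult_op \<phi> h)"
    by (simp add: mult_op_rep[OF \<phi>])
  finally show ?thesis .
qed

context blaschke_zeros
begin

lemma model_space_function:
  assumes "g \<in> K N"
  obtains F where "F \<in> disc_algebra" "g = l2 F"
proof -
  have "g = l2 (\<lambda>z. \<Sum>j<N. cinner g (l2 (tm j)) * tm j z)"
    using K.expand[OF assms] tm_comb_l2 by simp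
  then show ?thesis
    by (rule that[OF tm_comb_disc_algebra])
qed

text \<open>
  The numerical range of \<open>T\<^sub>B(\<phi>)\<close> consists of averages of \<open>\<phi>\<close>, hence lies in the convex hull of the
  values of \<open>\<phi>\<close>. Separating \<open>w\<close> from the hull by the hyperplane at the closest point turns this into
  the resolvent bound.
\<close>

lemma tto_numerical_range_bound:
  assumes \<phi>: "continuous_on (sphere 0 1) \<phi>" and g: "g \<in> K N"
  shows "infdist w (convex hull (\<phi> ` sphere 0 1)) * norm g \<le> norm (w *\<^sub>C g - tto (B N) \<phi> g)"
proof -
  let ?C = "convex hull (\<phi> ` sphere 0 1)"
  have C: "compact ?C" "convex ?C" "?C \<noteq> {}"
    using compact_hull_of_values[OF \<phi>] by auto
  then have cl: "closed ?C" by (simp add: compact_imp_closed)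
  define a where "a = closest_point ?C w"
  have a: "a \<in> ?C" "\<And>y. y \<in> ?C \<Longrightarrow> dist w a \<le> dist w y"
    unfolding a_def using closest_point_exists[OF cl C(3)] by auto
  have d: "infdist w ?C = dist w a"
  proof (rule antisym)
    show "infdist w ?C \<le> dist w a" by (rule infdist_le[OF a(1)])
    show "dist w a \<le> infdist w ?C"
      unfolding infdist_notempty[OF C(3)] using C(3) a(2) by (intro cINF_greatest)
  qed
  let ?v = "w - a"
  obtain F where F: "F \<in> disc_algebra" "g = l2 F"
    using model_space_function[OF g] .
  have Fc: "continuous_on (sphere 0 1) F" by (rule disc_algebra_sphere[OF F(1)])
  have FS: "F \<in> sq_int" using F(1) by auto
  have pos: "(norm ?v)\<^sup>2 \<le> inner ?v (w - \<phi> z)" if "cmod z = 1" for z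
  proof -
    have "\<phi> z \<in> ?C" using that by (intro hull_inc) auto
    then have "inner (w - a) (\<phi> z - a) \<le> 0"
      using any_closest_point_dot[OF C(2) cl a(1), of "\<phi> z" w] a(2) by blast
    moreover have "inner ?v (w - \<phi> z) = inner ?v ?v - inner ?v (\<phi> z - a)"
      by (simp add: inner_diff_right)
    ultimately show ?thesis
      by (simp add: power2_norm_eq_inner)
  qed
  have eq: "cinner (w *\<^sub>C g - tto (B N) \<phi> g) g = (LINT z|circ. (cmod (F z))\<^sup>2 *\<^sub>R (w - \<phi> z))"
  proof -
    have m: "mult_op \<phi> g = l2 (\<lambda>z. \<phi> z * F z)"
      unfolding F(2) by (rule mult_op_l2[OF continuous_L_inf[OF \<phi>] FS])
    have "cinner (w *\<^sub>C g - tto (B N) \<phi> g) g = w * cinner g g - cinner (l2 (\<lambda>z. \<phi> z * F z)) g"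
      by (simp add: cinner_diff_left cinner_scale_left cinner_tto[OF g] m)
    also have "\<dots> = w * (LINT z|circ. F z * cnj (F z)) - (LINT z|circ. \<phi> z * F z * cnj (F z))"
      unfolding F(2) using FS sq_int_mult[OF continuous_L_inf[OF \<phi>] FS] by (simp add: cinner_l2)
    also have "\<dots> = (LINT z|circ. w * (F z * cnj (F z)) - \<phi> z * F z * cnj (F z))"
      using Fc \<phi> by (simp add: circ_continuous_integrable continuous_intros)
    also have "\<dots> = (LINT z|circ. (cmod (F z))\<^sup>2 *\<^sub>R (w - \<phi> z))"
      by (intro circ_integral_cong)
        (simp add: scaleR_conv_of_real complex_norm_square[symmetric] algebra_simps flip: of_real_power)
    finally show ?thesis .
  qed
  have int: "integrable circ (\<lambda>z. (cmod (F z))\<^sup>2 *\<^sub>R (w - \<phi> z))"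
    by (intro circ_continuous_integrable continuous_intros Fc \<phi>)
  have "(norm ?v)\<^sup>2 * (norm g)\<^sup>2 = (LINT z|circ. (norm ?v)\<^sup>2 * (cmod (F z))\<^sup>2)"
    unfolding F(2) norm_l2_sq[OF FS] by simp
  also have "\<dots> \<le> (LINT z|circ. inner ?v ((cmod (F z))\<^sup>2 *\<^sub>R (w - \<phi> z)))"
  proof (rule circ_integral_mono)
    show "(norm ?v)\<^sup>2 * (cmod (F z))\<^sup>2 \<le> inner ?v ((cmod (F z))\<^sup>2 *\<^sub>R (w - \<phi> z))" if "cmod z = 1" for z
      using mult_right_mono[OF pos[OF that], of "(cmod (F z))\<^sup>2"] by (simp add: mult.commute)
  qed (intro circ_continuous_integrable continuous_intros Fc \<phi>)+
  also have "\<dots> = inner ?v (cinner (w *\<^sub>C g - tto (B N) \<phi> g) g)"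
    unfolding eq by (rule integral_bounded_linear[OF bounded_linear_inner_right int])
  also have "\<dots> \<le> norm ?v * norm (cinner (w *\<^sub>C g - tto (B N) \<phi> g) g)"
    by (rule norm_cauchy_schwarz)
  also have "\<dots> \<le> norm ?v * (norm (w *\<^sub>C g - tto (B N) \<phi> g) * norm g)"
    by (intro mult_left_mono cinner_Cauchy_Schwarz) simp
  finally have "(norm ?v * norm g) * (norm ?v * norm g) \<le>
      (norm ?v * norm g) * norm (w *\<^sub>C g - tto (B N) \<phi> g)"
    by (simp add: power2_eq_square mult_ac)
  then have "norm ?v * norm g \<le> norm (w *\<^sub>C g - tto (B N) \<phi> g)"
    by (cases "norm ?v * norm g = 0") (auto simp: mult_le_cancel_left)
  then show ?thesis
    by (simp add: d dist_norm)
qed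

lemma tto_spectrum:
  assumes \<phi>: "continuous_on (sphere 0 1) \<phi>"
  shows "op_spectrum (K N) (tto (B N) \<phi>) \<subseteq> convex hull (\<phi> ` sphere 0 1)"
proof
  let ?C = "convex hull (\<phi> ` sphere 0 1)" and ?T = "tto (B N) \<phi>"
  fix w assume w: "w \<in> op_spectrum (K N) ?T"
  show "w \<in> ?C"
  proof (rule ccontr)
    assume "w \<notin> ?C"
    have "compact ?C" "?C \<noteq> {}"
      using compact_hull_of_values[OF \<phi>] by auto
    then have pos: "0 < infdist w ?C"
      using \<open>w \<notin> ?C\<close> in_closed_iff_infdist_zero[of ?C w] infdist_nonneg[of w ?C]
      by (simp add: compact_imp_closed less_le)
    have "bij_betw (\<lambda>g. w *\<^sub>C g - ?T g) (K N) (K N)"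
    proof (rule K.lin_on_inj_imp_bij)
      show "lin_on (K N) (\<lambda>g. w *\<^sub>C g - ?T g)"
        unfolding lin_on_def
        by (auto simp: K.diff_in K.scale_in lin_onD[OF tto_lin_on] cvec.scale_right_distrib
            scaleC_diff_right mult.commute)
      show "g = 0" if "g \<in> K N" "w *\<^sub>C g - ?T g = 0" for g
        using tto_numerical_range_bound[OF \<phi> that(1), of w] that(2) pos
        by (simp add: mult_le_0_iff)
    qed
    then show False
      using w by (simp add: op_spectrum_def)
  qed
qed

text \<open>
  On the contour, \<open>(w-T)\<^sup>-\<^sup>1 k - (w-p)\<^sup>-\<^sup>1 k = (w-p)\<^sup>-\<^sup>1 (w-T)\<^sup>-\<^sup>1 (T-p) k\<close>; hence \<open>f(T)\<close> acts on a vector \<open>k\<close>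
  as \<open>f(p)\<close> up to a multiple of \<open>\<parallel>(T-p) k\<parallel>\<close>, with a constant independent of \<open>N\<close>.
\<close>

lemma calculus_approximate_eigenvector:
  assumes \<phi>: "continuous_on (sphere 0 1) \<phi>" and U: "open U" "convex hull (\<phi> ` sphere 0 1) \<subseteq> U"
    and f: "f holomorphic_on U"
  obtains \<gamma> D where "D \<ge> 0" "\<And>N. surrounds \<gamma> (op_spectrum (K N) (tto (B N) \<phi>)) U"
    "\<And>N k p. k \<in> K N \<Longrightarrow> k \<noteq> 0 \<Longrightarrow> p \<in> convex hull (\<phi> ` sphere 0 1) \<Longrightarrow>
      cmod (cinner (holomorphic_calculus (K N) U f (tto (B N) \<phi>) k) k / of_real ((norm k)\<^sup>2) - f p)
        \<le> D * (norm (tto (B N) \<phi> k - p *\<^sub>C k) / norm k)"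
proof -
  let ?C = "convex hull (\<phi> ` sphere 0 1)"
  have C: "compact ?C" "convex ?C" "?C \<noteq> {}"
    using compact_hull_of_values[OF \<phi>] by auto
  obtain \<gamma> L where \<gamma>C: "surrounds \<gamma> ?C U" and L: "L \<ge> 0"
    "\<And>F b. continuous_on (path_image \<gamma>) F \<Longrightarrow> b \<ge> 0 \<Longrightarrow> (\<And>w. w \<in> path_image \<gamma> \<Longrightarrow> cmod (F w) \<le> b) \<Longrightarrow>
        cmod (contour_integral \<gamma> F) \<le> L * b"
    using surrounding_contour[OF C U] by metis
  note \<gamma>D = surroundsD[OF \<gamma>C]
  have \<gamma>S: "surrounds \<gamma> (op_spectrum (K N) (tto (B N) \<phi>)) U" for N
    by (rule surrounds_subset[OF \<gamma>C tto_spectrum[OF \<phi>]])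
  have P: "compact (path_image \<gamma>)"
    by (rule compact_path_image[OF valid_path_imp_path[OF \<gamma>D(1)]])
  obtain d where d: "d > 0" "\<And>x y. x \<in> path_image \<gamma> \<Longrightarrow> y \<in> ?C \<Longrightarrow> d \<le> dist x y"
    using separate_compact_closed[OF P compact_imp_closed[OF C(1)]] \<gamma>D(3) by blast
  have infd: "d \<le> infdist w ?C" if "w \<in> path_image \<gamma>" for w
    unfolding infdist_notempty[OF C(3)] using C(3) d(2)[OF that] by (intro cINF_greatest)
  have fc: "continuous_on (path_image \<gamma>) f"
    using f \<gamma>D(3) holomorphic_on_imp_continuous_on continuous_on_subset by blast
  have "bounded (f ` path_image \<gamma>)"
    by (rule compact_imp_bounded[OF compact_continuous_image[OF fc P]])
  then obtain M where M: "M > 0" "\<And>w. w \<in> path_image \<gamma> \<Longrightarrow> cmod (f w) \<le> M"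
    unfolding bounded_pos by auto
  \<comment> \<open>One factor \<open>1/d\<close> bounds the resolvent on the contour, the other bounds \<open>1/(w - p)\<close>.\<close>
  define D where "D = L * (M / d\<^sup>2) / (2 * pi)"
  show ?thesis
  proof (rule that[OF _ \<gamma>S])
    show "0 \<le> D" using L M d by (simp add: D_def)
    fix N k p assume k: "k \<in> K N" "k \<noteq> 0" and p: "p \<in> ?C"
    let ?T = "tto (B N) \<phi>"
    let ?X = "holomorphic_calculus (K N) U f ?T" and ?R = "\<lambda>w. resolvent (K N) ?T w k"
    define n where "n = norm k"
    have n: "n > 0" using k by (simp add: n_def)
    have kk: "cinner k k = of_real (n\<^sup>2)" by (simp add: n_def cinner_self)
    define r where "r = norm (?T k - p *\<^sub>C k)"
    have nS: "w \<notin> op_spectrum (K N) ?T" if "w \<in> path_image \<gamma>" for w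
      using surroundsD(3)[OF \<gamma>S] that by auto
    define \<Delta> where "\<Delta> w = f w * cinner (?R w) k / of_real (n\<^sup>2) - f w / (w - p)" for w
    have "((\<lambda>w. f w * cinner (?R w) k) has_contour_integral 2 * of_real pi * \<i> * cinner (?X k) k) \<gamma>"
      by (rule K.holomorphic_calculus_eq(2)[OF tto_lin_on U(1) f k(1) \<gamma>S k(1) \<gamma>S])
    then have 1: "((\<lambda>w. f w * cinner (?R w) k / of_real (n\<^sup>2)) has_contour_integral
        2 * of_real pi * \<i> * cinner (?X k) k / of_real (n\<^sup>2)) \<gamma>"
      by (rule has_contour_integral_div)
    have 2: "((\<lambda>w. f w / (w - p)) has_contour_integral 2 * of_real pi * \<i> * f p) \<gamma>"
      using Cauchy_integral_formula_global[OF U(1) f _ \<gamma>D(1) _ \<gamma>D(2) \<gamma>D(5), of p] \<gamma>D(3,4) p U(2) by auto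
    have "(\<Delta> has_contour_integral 2 * of_real pi * \<i> * (cinner (?X k) k / of_real (n\<^sup>2) - f p)) \<gamma>"
      using has_contour_integral_diff[OF 1 2] unfolding \<Delta>_def by (simp add: algebra_simps)
    then have val: "contour_integral \<gamma> \<Delta> = 2 * of_real pi * \<i> * (cinner (?X k) k / of_real (n\<^sup>2) - f p)"
      by (rule contour_integral_unique)
    obtain as where "continuous_on (- op_spectrum (K N) ?T) (\<lambda>w. cinner (?R w) k)"
      using K.contour_integral_resolvent[OF tto_lin_on U(1) f k(1)] by metis
    then have "continuous_on (path_image \<gamma>) (\<lambda>w. cinner (?R w) k)"
      by (rule continuous_on_subset) (use nS in auto)
    then have cont: "continuous_on (path_image \<gamma>) \<Delta>"
      unfolding \<Delta>_def using n p \<gamma>D(3) by (intro continuous_intros fc) auto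
    have bound: "cmod (\<Delta> w) \<le> M / d\<^sup>2 * (r / n)" if w: "w \<in> path_image \<gamma>" for w
    proof -
      have wp: "d \<le> cmod (w - p)" using d(2)[OF w p] by (simp add: dist_norm)
      then have wp0: "w - p \<noteq> 0" using d(1) by auto
      define y where "y = ?R w - (1 / (w - p)) *\<^sub>C k"
      have R: "?R w \<in> K N" "w *\<^sub>C ?R w - ?T (?R w) = k"
        using K.resolvent_in_eq[OF nS[OF w] k(1)] by auto
      have y: "y \<in> K N"
        unfolding y_def by (intro K.diff_in K.scale_in R k)
      have Ty: "?T y = ?T (?R w) - (1 / (w - p)) *\<^sub>C ?T k"
        unfolding y_def
        by (subst K.lin_on_diff[OF tto_lin_on R(1) K.scale_in[OF k(1)]])
          (simp add: lin_onD(3)[OF tto_lin_on k(1)])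
      have "w *\<^sub>C y - ?T y = (w *\<^sub>C ?R w - ?T (?R w)) - (1 / (w - p)) *\<^sub>C (w *\<^sub>C k - ?T k)"
        unfolding Ty unfolding y_def by (simp add: scaleC_diff_right mult.commute)
      also have "\<dots> = (1 / (w - p)) *\<^sub>C ((w - p) *\<^sub>C k) - (1 / (w - p)) *\<^sub>C (w *\<^sub>C k - ?T k)"
        using wp0 by (simp add: R(2))
      also have "\<dots> = (1 / (w - p)) *\<^sub>C (?T k - p *\<^sub>C k)"
        unfolding scaleC_diff_right[symmetric] cvec.scale_left_diff_distrib by simp
      finally have "norm (w *\<^sub>C y - ?T y) = r / cmod (w - p)"
        by (simp add: norm_scaleC norm_divide r_def)
      also have "\<dots> \<le> r / d"
        using wp d(1) by (intro divide_left_mono mult_pos_pos) (auto simp: r_def)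
      finally have "infdist w ?C * norm y \<le> r / d"
        using tto_numerical_range_bound[OF \<phi> y, of w] by linarith
      moreover have "d * norm y \<le> infdist w ?C * norm y"
        by (intro mult_right_mono infd w) simp
      ultimately have "d * norm y \<le> r / d"
        by linarith
      then have ny: "norm y \<le> r / d\<^sup>2"
        using d(1) by (simp add: field_simps power2_eq_square)
      have "cinner y k = cinner (?R w) k - of_real (n\<^sup>2) / (w - p)"
        by (simp add: y_def cinner_diff_left cinner_scale_left kk)
      then have "\<Delta> w = f w * (cinner y k / of_real (n\<^sup>2))"
        using n by (simp add: \<Delta>_def diff_divide_distrib right_diff_distrib)
      then have "cmod (\<Delta> w) = cmod (f w) * (cmod (cinner y k) / n\<^sup>2)"
        using n by (simp add: norm_mult norm_divide norm_power)
      also have "\<dots> \<le> M * ((r / d\<^sup>2 * n) / n\<^sup>2)"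
      proof (intro mult_mono divide_right_mono M w)
        have "cmod (cinner y k) \<le> norm y * n"
          unfolding n_def by (rule cinner_Cauchy_Schwarz)
        also have "\<dots> \<le> r / d\<^sup>2 * n"
          using ny n by (intro mult_right_mono) auto
        finally show "cmod (cinner y k) \<le> r / d\<^sup>2 * n" .
      qed (use M n in auto)
      also have "\<dots> = M / d\<^sup>2 * (r / n)"
        using n by (simp add: power2_eq_square)
      finally show ?thesis .
    qed
    have "cmod (contour_integral \<gamma> \<Delta>) \<le> L * (M / d\<^sup>2 * (r / n))"
      using M n by (intro L(2) cont bound) (auto simp: r_def)
    then have "2 * pi * cmod (cinner (?X k) k / of_real (n\<^sup>2) - f p) \<le> L * (M / d\<^sup>2 * (r / n))"
      unfolding val by (simp add: norm_mult)
    then have "cmod (cinner (?X k) k / of_real (n\<^sup>2) - f p) \<le> L * (M / d\<^sup>2 * (r / n)) / (2 * pi)"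
      by (subst pos_le_divide_eq) (simp_all add: mult.commute)
    also have "\<dots> = D * (r / n)"
      by (simp add: D_def mult_ac)
    finally show "cmod (cinner (?X k) k / of_real ((norm k)\<^sup>2) - f p)
        \<le> D * (norm (?T k - p *\<^sub>C k) / norm k)"
      by (simp only: n_def r_def)
  qed
qed

lemma tto_defect:
  assumes \<phi>: "continuous_on (sphere 0 1) \<phi>" and k: "k \<in> K N" "k = l2 F" "F \<in> disc_algebra"
  shows "(norm (tto (B N) \<phi> k - p *\<^sub>C k))\<^sup>2 \<le> (LINT z|circ. (cmod (\<phi> z - p))\<^sup>2 * (cmod (F z))\<^sup>2)"
proof -
  let ?y = "tto (B N) \<phi> k - p *\<^sub>C k"
  have F: "F \<in> sq_int" using k by auto
  define v where "v = mult_op \<phi> k - p *\<^sub>C k"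
  have y: "?y \<in> K N" by (intro K.diff_in K.scale_in k tto_in)
  have "cinner ?y ?y = cinner v ?y"
    unfolding v_def cinner_diff_left cinner_tto[OF y] ..
  then have "(norm ?y)\<^sup>2 \<le> norm v * norm ?y"
    using cinner_Cauchy_Schwarz[of v ?y] cinner_self[of ?y]
    by (metis norm_of_real abs_of_nonneg zero_le_power2)
  then have "norm ?y \<le> norm v"
    by (cases "norm ?y = 0") (simp_all add: power2_eq_square)
  then have "(norm ?y)\<^sup>2 \<le> (norm v)\<^sup>2"
    by (intro power_mono) auto
  also have "v = l2 (\<lambda>z. (\<phi> z - p) * F z)"
  proof -
    have s: "(\<lambda>z. \<phi> z * F z) \<in> sq_int" "(\<lambda>z. (- p) * F z) \<in> sq_int"
      by (intro sq_int_mult continuous_L_inf \<phi> F sq_int_scale)+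
    have "v = l2 (\<lambda>z. \<phi> z * F z) + l2 (\<lambda>z. (- p) * F z)"
      unfolding v_def k(2) mult_op_l2[OF continuous_L_inf[OF \<phi>] F] scaleC_l2[OF F, symmetric] by simp
    also have "\<dots> = l2 (\<lambda>z. \<phi> z * F z + (- p) * F z)"
      by (rule add_l2[OF s])
    finally show ?thesis by (simp add: algebra_simps)
  qed
  also have "(norm \<dots>)\<^sup>2 = (LINT z|circ. (cmod ((\<phi> z - p) * F z))\<^sup>2)"
    by (intro norm_l2_sq continuous_sq_int continuous_intros \<phi> disc_algebra_sphere k)
  finally show ?thesis
    by (simp add: norm_mult power_mult_distrib)
qed

text \<open>
  Off the diagonal the kernel is bounded by \<open>2/\<bar>z-\<zeta>\<bar>\<close> while its norm is the square root of \<open>\<bar>B\<^sub>N'(\<zeta>)\<bar>\<close>. When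
  the latter tends to infinity, the normalized kernels concentrate at \<open>\<zeta>\<close>.
\<close>

lemma tto_kernel_defect_tendsto:
  assumes \<phi>: "continuous_on (sphere 0 1) \<phi>" and \<zeta>: "cmod \<zeta> = 1"
    and lim: "filterlim (\<lambda>N. angular \<Lambda> N \<zeta>) at_top sequentially"
  shows "(\<lambda>N. norm (tto (B N) \<phi> (kvec N \<zeta>) - \<phi> \<zeta> *\<^sub>C kvec N \<zeta>) / norm (kvec N \<zeta>)) \<longlonglongrightarrow> 0"
proof (rule LIMSEQ_I)
  fix e :: real assume e: "e > 0"
  obtain M where M: "M > 0" "\<And>z. cmod z = 1 \<Longrightarrow> cmod (\<phi> z) \<le> M"
    using circ_continuous_bounded[OF \<phi>] by metis
  obtain \<delta> where \<delta>: "\<delta> > 0" "\<And>z. cmod z = 1 \<Longrightarrow> dist z \<zeta> < \<delta> \<Longrightarrow> dist (\<phi> z) (\<phi> \<zeta>) < e / 2"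
    using \<phi> \<zeta> e unfolding continuous_on_iff by (metis half_gt_zero mem_sphere_0)
  \<comment> \<open>A bound for the integrand of the defect at distance at least \<open>\<delta>\<close> from \<open>\<zeta>\<close>.\<close>
  define Q where "Q = (2 * M)\<^sup>2 * (2 / \<delta>)\<^sup>2"
  have Q: "Q \<ge> 0" by (simp add: Q_def)
  have "\<forall>\<^sub>F N in sequentially. 2 * (Q + 1) / e\<^sup>2 < angular \<Lambda> N \<zeta>"
    using lim by (simp add: filterlim_at_top_dense)
  then obtain N0 where N0: "\<And>N. N \<ge> N0 \<Longrightarrow> 2 * (Q + 1) / e\<^sup>2 < angular \<Lambda> N \<zeta>"
    by (auto simp: eventually_sequentially)
  have "norm (norm (tto (B N) \<phi> (kvec N \<zeta>) - \<phi> \<zeta> *\<^sub>C kvec N \<zeta>) / norm (kvec N \<zeta>) - 0) < e" if "N \<ge> N0" for N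
  proof -
    let ?k = "kernel N \<zeta>" and ?A = "angular \<Lambda> N \<zeta>"
    have kc: "continuous_on (sphere 0 1) ?k" by (intro disc_algebra_sphere kernel_disc_algebra)
    have "0 \<le> 2 * (Q + 1) / e\<^sup>2" using Q by simp
    then have A0: "?A > 0"
      using N0[OF that] by linarith
    have A: "2 * (Q + 1) < e\<^sup>2 * ?A"
      using N0[OF that] e by (simp add: pos_divide_less_eq mult.commute)
    have nk: "(norm (kvec N \<zeta>))\<^sup>2 = ?A" by (rule norm_kvec[OF \<zeta>])
    have intk: "(LINT z|circ. (cmod (?k z))\<^sup>2) = ?A"
      using nk norm_l2_sq[OF disc_algebra_sq_int[OF kernel_disc_algebra], of N \<zeta>] by (simp add: kvec_l2)
    have pt: "(cmod (\<phi> z - \<phi> \<zeta>))\<^sup>2 * (cmod (?k z))\<^sup>2 \<le> (e / 2)\<^sup>2 * (cmod (?k z))\<^sup>2 + Q"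
      if z: "cmod z = 1" for z
    proof (cases "dist z \<zeta> < \<delta>")
      case True
      then have "cmod (\<phi> z - \<phi> \<zeta>) \<le> e / 2"
        using \<delta>(2)[OF z] by (simp add: dist_norm)
      then have "(cmod (\<phi> z - \<phi> \<zeta>))\<^sup>2 * (cmod (?k z))\<^sup>2 \<le> (e / 2)\<^sup>2 * (cmod (?k z))\<^sup>2"
        by (intro mult_right_mono power_mono) auto
      then show ?thesis using Q by simp
    next
      case False
      have "cmod (1 - cnj \<zeta> * z) = cmod (z - \<zeta>)"
        by (rule norm_one_minus_on_sphere[OF z])
      then have "cmod (z - \<zeta>) * cmod (?k z) = cmod (1 - cnj (B N \<zeta>) * B N z)"
        using kernel_eq[of \<zeta> z N] \<zeta> z by (metis norm_mult order_refl)
      also have "\<dots> \<le> 2"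
        using norm_triangle_ineq4[of 1 "cnj (B N \<zeta>) * B N z"] norm_blaschke[OF z] norm_blaschke[OF \<zeta>]
        by (simp add: norm_mult)
      finally have "cmod (z - \<zeta>) * cmod (?k z) \<le> 2" .
      moreover have "\<delta> * cmod (?k z) \<le> cmod (z - \<zeta>) * cmod (?k z)"
        using False by (intro mult_right_mono) (auto simp: dist_norm)
      ultimately have k2: "cmod (?k z) \<le> 2 / \<delta>"
        using \<delta>(1) by (simp add: field_simps)
      have "cmod (\<phi> z - \<phi> \<zeta>) \<le> 2 * M"
        using norm_triangle_ineq4[of "\<phi> z" "\<phi> \<zeta>"] M(2)[OF z] M(2)[OF \<zeta>] by linarith
      then have "(cmod (\<phi> z - \<phi> \<zeta>))\<^sup>2 * (cmod (?k z))\<^sup>2 \<le> Q"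
        unfolding Q_def using k2 by (intro mult_mono power_mono) auto
      then show ?thesis by (simp add: add_increasing)
    qed
    have "(norm (tto (B N) \<phi> (kvec N \<zeta>) - \<phi> \<zeta> *\<^sub>C kvec N \<zeta>))\<^sup>2
        \<le> (LINT z|circ. (cmod (\<phi> z - \<phi> \<zeta>))\<^sup>2 * (cmod (?k z))\<^sup>2)"
      by (rule tto_defect[OF \<phi> kvec_in kvec_l2 kernel_disc_algebra])
    also have "\<dots> \<le> (LINT z|circ. (e / 2)\<^sup>2 * (cmod (?k z))\<^sup>2 + Q)"
      by (intro circ_integral_mono circ_continuous_integrable continuous_intros \<phi> kc pt)
    also have "\<dots> = (e / 2)\<^sup>2 * ?A + Q"
      using kc by (simp add: circ_continuous_integrable continuous_intros intk measure_circ)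
    also have "\<dots> < e\<^sup>2 * ?A"
      using A Q e by (simp add: power_divide field_simps)
    also have "\<dots> = (e * norm (kvec N \<zeta>))\<^sup>2"
      by (simp add: power_mult_distrib nk)
    finally have "norm (tto (B N) \<phi> (kvec N \<zeta>) - \<phi> \<zeta> *\<^sub>C kvec N \<zeta>) < e * norm (kvec N \<zeta>)"
      by (rule power2_less_imp_less) (use e in simp)
    moreover have "norm (kvec N \<zeta>) > 0"
      using nk A0 by (metis norm_ge_zero less_le power_zero_numeral)
    ultimately show ?thesis
      by (simp add: divide_less_eq)
  qed
  then show "\<exists>N0. \<forall>N\<ge>N0. norm (norm (tto (B N) \<phi> (kvec N \<zeta>) - \<phi> \<zeta> *\<^sub>C kvec N \<zeta>) / norm (kvec N \<zeta>) - 0) < e"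
    by blast
qed

lemma angular_at_top:
  assumes "cmod \<zeta> = 1" "\<zeta> \<notin> limit_set \<Lambda>"
  shows "filterlim (\<lambda>N. angular \<Lambda> N \<zeta>) at_top sequentially"
  unfolding filterlim_at_top
proof
  fix Z :: real
  have "\<exists>N. angular \<Lambda> N \<zeta> > Z"
  proof (rule ccontr)
    assume "\<not> ?thesis"
    then have "summable (\<lambda>j. (1 - (cmod (\<Lambda> j))\<^sup>2) / (cmod (\<zeta> - \<Lambda> j))\<^sup>2)"
      using poisson_terms_nonneg
      by (intro summableI_nonneg_bounded[where x = Z]) (auto simp: angular_def not_less)
    then show False
      using assms by (simp add: limit_set_iff)
  qed
  then obtain N where "angular \<Lambda> N \<zeta> > Z" by blast
  then have "angular \<Lambda> n \<zeta> \<ge> Z" if "n \<ge> N" for n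
    using angular_mono[OF that, of \<zeta>] by linarith
  then show "\<forall>\<^sub>F N in sequentially. Z \<le> angular \<Lambda> N \<zeta>"
    by (auto simp: eventually_sequentially)
qed

end

section \<open>The trace condition\<close>

context blaschke_zeros_0
begin

lemma beta_continuous:
  assumes "N \<ge> 1"
  shows "continuous_on (sphere 0 1) (beta \<Lambda> N)"
proof -
  have "continuous_on (sphere 0 1) (\<lambda>z. complex_of_real (1 / angular \<Lambda> N z))"
    using angular_ge_1[OF assms] by (intro continuous_intros angular_continuous) force
  then show ?thesis
    by (rule continuous_on_eq) (simp add: beta_eq)
qed

text \<open>
  The trace against \<open>T\<^sub>B(\<beta>\<^sub>N)\<close> averages the quadratic form of the operator over the normalized
  reproducing kernels, because \<open>\<beta>\<^sub>N(\<zeta>)\<close> is the reciprocal of \<open>\<parallel>k\<^sub>\<zeta>\<parallel>\<^sup>2\<close>.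
\<close>

lemma trace_tto_beta:
  assumes N: "N \<ge> 1" and X: "lin_on (K N) X"
  shows "op_trace (K N) (tto (B N) (beta \<Lambda> N) \<circ> X) =
      (LINT \<zeta>|circ. cinner (X (kvec N \<zeta>)) (kvec N \<zeta>) / of_real (angular \<Lambda> N \<zeta>))"
    and "continuous_on (sphere 0 1) (\<lambda>\<zeta>. cinner (X (kvec N \<zeta>)) (kvec N \<zeta>) / of_real (angular \<Lambda> N \<zeta>))"
proof -
  let ?e = "\<lambda>j. l2 (tm j)"
  define F where "F j z = (\<Sum>l<N. cinner (X (?e j)) (?e l) * tm l z)" for j z
  have FA: "F j \<in> disc_algebra" for j
    unfolding F_def[abs_def] by (rule tm_comb_disc_algebra)
  have Xe: "X (?e j) \<in> K N" if "j < N" for j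
    using lin_onD(1)[OF X K.basis_in[of j N]] that by simp
  have XF: "X (?e j) = l2 (F j)" if "j < N" for j
    using K.expand[OF Xe[OF that]] tm_comb_l2[of "\<lambda>l. cinner (X (?e j)) (?e l)" N]
    by (simp add: F_def[abs_def])
  have bL: "beta \<Lambda> N \<in> L_inf"
    by (rule continuous_L_inf[OF beta_continuous[OF N]])
  have c: "continuous_on (sphere 0 1) (F j)" "continuous_on (sphere 0 1) (tm j)" for j
    by (intro disc_algebra_sphere FA tm_disc_algebra)+
  have quad: "cinner (X (kvec N \<zeta>)) (kvec N \<zeta>) = (\<Sum>j<N. F j \<zeta> * cnj (tm j \<zeta>))" for \<zeta>
  proof -
    have "X (kvec N \<zeta>) = (\<Sum>j<N. cnj (tm j \<zeta>) *\<^sub>C X (?e j))"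
      unfolding kvec_def by (rule K.lin_on_sum[OF X]) auto
    moreover have "cinner (X (?e j)) (kvec N \<zeta>) = F j \<zeta>" if "j < N" for j
      using cinner_kvec[where N = N and c = "\<lambda>l. cinner (X (?e j)) (?e l)" and w = \<zeta>]
      by (simp add: K.expand Xe that F_def)
    ultimately show ?thesis
      by (simp add: cinner_sum_left cinner_scale_left mult.commute)
  qed
  show "continuous_on (sphere 0 1) (\<lambda>\<zeta>. cinner (X (kvec N \<zeta>)) (kvec N \<zeta>) / of_real (angular \<Lambda> N \<zeta>))"
    unfolding quad using angular_ge_1[OF N] by (intro continuous_intros c angular_continuous) force
  have "lin_on (K N) (tto (B N) (beta \<Lambda> N) \<circ> X)"
    using lin_onD[OF X] lin_onD[OF tto_lin_on[of N "beta \<Lambda> N"]] unfolding lin_on_def comp_def by auto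
  then have "op_trace (K N) (tto (B N) (beta \<Lambda> N) \<circ> X) =
      (\<Sum>j<N. cinner (tto (B N) (beta \<Lambda> N) (X (?e j))) (?e j))"
    using K.op_trace_eq by simp
  also have "\<dots> = (\<Sum>j<N. LINT \<zeta>|circ. beta \<Lambda> N \<zeta> * F j \<zeta> * cnj (tm j \<zeta>))"
  proof (intro sum.cong refl)
    fix j assume "j \<in> {..<N}"
    then have j: "j < N" by simp
    have FS: "F j \<in> sq_int" using FA by auto
    have "cinner (tto (B N) (beta \<Lambda> N) (X (?e j))) (?e j) = cinner (mult_op (beta \<Lambda> N) (l2 (F j))) (?e j)"
      using cinner_tto[OF K.basis_in[of j N]] j by (simp add: XF)
    also have "\<dots> = cinner (l2 (\<lambda>\<zeta>. beta \<Lambda> N \<zeta> * F j \<zeta>)) (?e j)"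
      by (simp add: mult_op_l2[OF bL FS])
    also have "\<dots> = (LINT \<zeta>|circ. beta \<Lambda> N \<zeta> * F j \<zeta> * cnj (tm j \<zeta>))"
      by (intro cinner_l2 sq_int_mult bL FS tm_sq_int)
    finally show "cinner (tto (B N) (beta \<Lambda> N) (X (?e j))) (?e j) =
        (LINT \<zeta>|circ. beta \<Lambda> N \<zeta> * F j \<zeta> * cnj (tm j \<zeta>))" .
  qed
  also have "\<dots> = (LINT \<zeta>|circ. (\<Sum>j<N. beta \<Lambda> N \<zeta> * F j \<zeta> * cnj (tm j \<zeta>)))"
    by (rule Bochner_Integration.integral_sum[symmetric])
      (intro circ_continuous_integrable continuous_intros c beta_continuous[OF N])
  also have "\<dots> = (LINT \<zeta>|circ. cinner (X (kvec N \<zeta>)) (kvec N \<zeta>) / of_real (angular \<Lambda> N \<zeta>))"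
    by (intro circ_integral_cong) (simp add: quad beta_eq sum_divide_distrib)
  finally show "op_trace (K N) (tto (B N) (beta \<Lambda> N) \<circ> X) =
      (LINT \<zeta>|circ. cinner (X (kvec N \<zeta>)) (kvec N \<zeta>) / of_real (angular \<Lambda> N \<zeta>))" .
qed

lemma kvec_nonzero: "N \<ge> 1 \<Longrightarrow> cmod \<zeta> = 1 \<Longrightarrow> kvec N \<zeta> \<noteq> 0"
  using norm_kvec[of \<zeta> N] angular_ge_1[of N \<zeta>] by auto

text \<open>
  Off the exceptional set the normalized kernels are approximate eigenvectors of \<open>T\<^sub>B(\<phi>)\<close> for the
  value \<open>\<phi>(\<zeta>)\<close>, so the integrand of the trace formula tends to \<open>f(\<phi>(\<zeta>))\<close>; the same estimate
  bounds it uniformly.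
\<close>

lemma trace_limit:
  assumes null: "limit_set \<Lambda> \<in> null_sets circ"
    and \<phi>: "continuous_on (sphere 0 1) \<phi>" and U: "open U" "convex hull (\<phi> ` sphere 0 1) \<subseteq> U"
    and f: "f holomorphic_on U"
  shows "(\<lambda>N. op_trace (K N) (tto (B N) (beta \<Lambda> N) \<circ> holomorphic_calculus (K N) U f (tto (B N) \<phi>)))
      \<longlonglongrightarrow> (LINT \<zeta>|circ. f (\<phi> \<zeta>))"
proof -
  let ?X = "\<lambda>N. holomorphic_calculus (K N) U f (tto (B N) \<phi>)"
  let ?G = "\<lambda>N \<zeta>. cinner (?X N (kvec N \<zeta>)) (kvec N \<zeta>) / of_real (angular \<Lambda> N \<zeta>)"
  let ?q = "\<lambda>N \<zeta>. norm (tto (B N) \<phi> (kvec N \<zeta>) - \<phi> \<zeta> *\<^sub>C kvec N \<zeta>) / norm (kvec N \<zeta>)"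
  obtain \<gamma> D where D: "D \<ge> 0" and \<gamma>: "\<And>N. surrounds \<gamma> (op_spectrum (K N) (tto (B N) \<phi>)) U"
    and approx: "\<And>N k p. k \<in> K N \<Longrightarrow> k \<noteq> 0 \<Longrightarrow> p \<in> convex hull (\<phi> ` sphere 0 1) \<Longrightarrow>
      cmod (cinner (?X N k) k / of_real ((norm k)\<^sup>2) - f p)
        \<le> D * (norm (tto (B N) \<phi> k - p *\<^sub>C k) / norm k)"
    using calculus_approximate_eigenvector[OF \<phi> U f] by metis
  have X: "lin_on (K N) (?X N)" for N
    by (rule K.holomorphic_calculus_lin_on[OF tto_lin_on U(1) f \<gamma>])
  have hull: "\<phi> \<zeta> \<in> convex hull (\<phi> ` sphere 0 1)" if "cmod \<zeta> = 1" for \<zeta>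
    using that by (intro hull_inc) auto
  have G: "cmod (?G N \<zeta> - f (\<phi> \<zeta>)) \<le> D * ?q N \<zeta>" if "N \<ge> 1" "cmod \<zeta> = 1" for N \<zeta>
    using approx[OF kvec_in kvec_nonzero[OF that] hull[OF that(2)]] by (simp add: norm_kvec[OF that(2)])
  have fc: "continuous_on (sphere 0 1) (\<lambda>\<zeta>. f (\<phi> \<zeta>))"
    by (rule continuous_on_compose2[OF holomorphic_on_imp_continuous_on[OF f] \<phi>]) (use hull U in auto)
  obtain M where M: "M > 0" "\<And>z. cmod z = 1 \<Longrightarrow> cmod (\<phi> z) \<le> M"
    using circ_continuous_bounded[OF \<phi>] by metis
  obtain M' where M': "\<And>z. cmod z = 1 \<Longrightarrow> cmod (f (\<phi> z)) \<le> M'"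
    using circ_continuous_bounded[OF fc] by metis
  have q: "?q N \<zeta> \<le> 2 * M" if \<zeta>: "cmod \<zeta> = 1" for N \<zeta>
  proof -
    let ?k = "kernel N \<zeta>"
    have kc: "continuous_on (sphere 0 1) ?k" by (intro disc_algebra_sphere kernel_disc_algebra)
    have "(norm (tto (B N) \<phi> (kvec N \<zeta>) - \<phi> \<zeta> *\<^sub>C kvec N \<zeta>))\<^sup>2
        \<le> (LINT z|circ. (cmod (\<phi> z - \<phi> \<zeta>))\<^sup>2 * (cmod (?k z))\<^sup>2)"
      by (rule tto_defect[OF \<phi> kvec_in kvec_l2 kernel_disc_algebra])
    also have "\<dots> \<le> (LINT z|circ. (2 * M)\<^sup>2 * (cmod (?k z))\<^sup>2)"
    proof (intro circ_integral_mono circ_continuous_integrable continuous_intros \<phi> kc mult_right_mono power_mono)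
      fix z :: complex assume "cmod z = 1"
      then show "cmod (\<phi> z - \<phi> \<zeta>) \<le> 2 * M"
        using norm_triangle_ineq4[of "\<phi> z" "\<phi> \<zeta>"] M(2)[of z] M(2)[OF \<zeta>] by linarith
    qed auto
    also have "\<dots> = (2 * M * norm (kvec N \<zeta>))\<^sup>2"
      using norm_l2_sq[OF disc_algebra_sq_int[OF kernel_disc_algebra], of N \<zeta>]
      by (simp add: kvec_l2 power_mult_distrib)
    finally have "norm (tto (B N) \<phi> (kvec N \<zeta>) - \<phi> \<zeta> *\<^sub>C kvec N \<zeta>) \<le> 2 * M * norm (kvec N \<zeta>)"
      by (rule power2_le_imp_le) (use M in simp)
    then show ?thesis
      using M by (cases "kvec N \<zeta> = 0") (simp_all add: divide_le_eq)
  qed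
  have "(\<lambda>n. LINT \<zeta>|circ. ?G (Suc n) \<zeta>) \<longlonglongrightarrow> (LINT \<zeta>|circ. f (\<phi> \<zeta>))"
  proof (rule integral_dominated_convergence[where w = "\<lambda>_. M' + D * (2 * M)"])
    show "(\<lambda>\<zeta>. f (\<phi> \<zeta>)) \<in> borel_measurable circ"
      by (rule circ_continuous_measurable[OF fc])
    show "?G (Suc n) \<in> borel_measurable circ" for n
      by (rule circ_continuous_measurable[OF trace_tto_beta(2)[OF _ X]]) simp
    have "AE \<zeta> in circ. \<zeta> \<notin> limit_set \<Lambda>"
      by (rule AE_not_in[OF null])
    then show "AE \<zeta> in circ. (\<lambda>n. ?G (Suc n) \<zeta>) \<longlonglongrightarrow> f (\<phi> \<zeta>)"
      using AE_space
    proof eventually_elim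
      case (elim \<zeta>)
      then have \<zeta>: "cmod \<zeta> = 1" by simp
      have "(\<lambda>n. ?q (Suc n) \<zeta>) \<longlonglongrightarrow> 0"
        by (rule LIMSEQ_Suc[OF tto_kernel_defect_tendsto[OF \<phi> \<zeta> angular_at_top[OF \<zeta> elim(1)]]])
      then have "(\<lambda>n. D * ?q (Suc n) \<zeta>) \<longlonglongrightarrow> 0"
        by (rule tendsto_mult_right_zero)
      then have "(\<lambda>n. ?G (Suc n) \<zeta> - f (\<phi> \<zeta>)) \<longlonglongrightarrow> 0"
        by (rule Lim_null_comparison[rotated]) (use G \<zeta> in auto)
      then show ?case by (rule LIM_zero_cancel)
    qed
    show "AE \<zeta> in circ. norm (?G (Suc n) \<zeta>) \<le> M' + D * (2 * M)" for n
    proof (rule circ_AE_I)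
      fix \<zeta> :: complex assume \<zeta>: "cmod \<zeta> = 1"
      have "norm (?G (Suc n) \<zeta>) \<le> cmod (f (\<phi> \<zeta>)) + cmod (?G (Suc n) \<zeta> - f (\<phi> \<zeta>))"
        using norm_triangle_ineq[of "f (\<phi> \<zeta>)" "?G (Suc n) \<zeta> - f (\<phi> \<zeta>)"] by simp
      also have "\<dots> \<le> M' + D * ?q (Suc n) \<zeta>"
        using \<zeta> by (intro add_mono M' G) auto
      also have "\<dots> \<le> M' + D * (2 * M)"
        using D q[OF \<zeta>] by (intro add_left_mono mult_left_mono) auto
      finally show "norm (?G (Suc n) \<zeta>) \<le> M' + D * (2 * M)" .
    qed
  qed simp
  then have "(\<lambda>n. op_trace (K (Suc n)) (tto (B (Suc n)) (beta \<Lambda> (Suc n)) \<circ> ?X (Suc n)))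
      \<longlonglongrightarrow> (LINT \<zeta>|circ. f (\<phi> \<zeta>))"
    by (simp only: trace_tto_beta(1)[OF _ X] le_add1 Suc_eq_plus1_left)
  then show ?thesis
    by (rule LIMSEQ_imp_Suc)
qed

text \<open>
  For \<open>\<phi> = z + z\<^sup>*\<close> the form of \<open>T(\<phi>\<^sup>2) - T(\<phi>)\<^sup>2\<close> at \<open>k\<^sub>\<zeta>\<close> is \<open>\<parallel>(1-P) \<phi> k\<^sub>\<zeta>\<parallel>\<^sup>2\<close>. The component of
  \<open>\<phi> k\<^sub>\<zeta>\<close> along \<open>z\<^sup>*\<close>, which is orthogonal to \<open>K\<^sub>B\<close>, is \<open>k\<^sub>\<zeta>(0) = 1\<close>.
\<close>

lemma compression_square_defect:
  assumes N: "N \<ge> 1" and \<zeta>: "cmod \<zeta> = 1"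
  defines "\<phi> \<equiv> \<lambda>z. z + cnj z" and "k \<equiv> kvec N \<zeta>"
  obtains r where "r \<ge> 1"
    "cinner (tto (B N) (\<lambda>z. (\<phi> z)\<^sup>2) k) k - cinner (tto (B N) \<phi> (tto (B N) \<phi> k)) k = of_real r"
proof -
  have \<phi>c: "continuous_on (sphere 0 1) \<phi>"
    unfolding \<phi>_def by (intro continuous_intros)
  have \<phi>2c: "continuous_on (sphere 0 1) (\<lambda>z. (\<phi> z)\<^sup>2)"
    by (intro continuous_intros \<phi>c)
  have L: "\<phi> \<in> L_inf" "(\<lambda>z. (\<phi> z)\<^sup>2) \<in> L_inf"
    using \<phi>c \<phi>2c by (auto intro: continuous_L_inf)
  have kK: "k \<in> K N" by (simp add: k_def)
  have self: "cinner (mult_op \<phi> g) h = cinner g (mult_op \<phi> h)" for g h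
    by (rule mult_op_selfadjoint[OF L(1)]) (simp add: \<phi>_def add.commute)
  define v where "v = mult_op \<phi> k"
  define y where "y = tto (B N) \<phi> k"
  have y: "y \<in> K N" by (simp add: y_def)
  have vy: "cinner v h = cinner y h" if "h \<in> K N" for h
    unfolding v_def y_def cinner_tto[OF that] ..
  have k0: "kernel N \<zeta> 0 = 1"
    using kernel_eq[of \<zeta> 0 N] \<zeta> by (simp add: blaschke_at_0[OF N])
  have kS: "kernel N \<zeta> \<in> sq_int" by auto
  have vl: "v = l2 (\<lambda>z. \<phi> z * kernel N \<zeta> z)"
    unfolding v_def k_def kvec_l2 by (rule mult_op_l2[OF L(1) kS])
  have vS: "(\<lambda>z. \<phi> z * kernel N \<zeta> z) \<in> sq_int"
    by (rule sq_int_mult[OF L(1) kS])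
  have "cinner (tto (B N) (\<lambda>z. (\<phi> z)\<^sup>2) k) k = cinner (mult_op (\<lambda>z. (\<phi> z)\<^sup>2) k) k"
    by (rule cinner_tto[OF kK])
  also have "mult_op (\<lambda>z. (\<phi> z)\<^sup>2) k = mult_op \<phi> v"
    unfolding vl mult_op_l2[OF L(1) vS] k_def kvec_l2 mult_op_l2[OF L(2) kS]
    by (simp add: power2_eq_square mult.assoc)
  also have "cinner (mult_op \<phi> v) k = cinner v v"
    by (simp add: self v_def)
  finally have T1: "cinner (tto (B N) (\<lambda>z. (\<phi> z)\<^sup>2) k) k = cinner v v" .
  have yv: "cinner y v = cinner y y"
    by (metis vy[OF y] cinner_commute)
  have "cinner (tto (B N) \<phi> y) k = cinner (mult_op \<phi> y) k"
    by (rule cinner_tto[OF kK])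
  also have "\<dots> = cinner y y"
    by (simp add: self v_def[symmetric] yv)
  finally have T2: "cinner (tto (B N) \<phi> y) k = cinner y y" .
  have diff: "cinner (v - y) (v - y) = cinner v v - cinner y y"
    using vy[OF y] yv by (simp add: cinner_diff_left cinner_diff_right)
  define q where "q = l2 (\<lambda>z. cnj (z * 1))"
  have qc: "continuous_on (sphere 0 1) (\<lambda>z::complex. cnj (z * 1))"
    by (intro continuous_intros)
  have "y \<in> hardy_space"
    using y by (simp add: model_space_def)
  then have yq: "cinner y q = 0"
    unfolding q_def by (rule hardy_orthogonal_coanalytic) (rule disc_algebra_const)
  have vq: "cinner v q = 1"
  proof -
    have A: "(\<lambda>z. z * z * kernel N \<zeta> z + kernel N \<zeta> z) \<in> disc_algebra"
      by (intro disc_algebra_add disc_algebra_mult disc_algebra_id kernel_disc_algebra)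
    have "cinner v q = (LINT z|circ. \<phi> z * kernel N \<zeta> z * cnj (cnj (z * 1)))"
      unfolding vl q_def by (rule cinner_l2[OF vS continuous_sq_int[OF qc]])
    also have "\<dots> = (LINT z|circ. z * z * kernel N \<zeta> z + kernel N \<zeta> z)"
    proof (intro circ_integral_cong)
      fix z :: complex assume z: "cmod z = 1"
      have "\<phi> z * kernel N \<zeta> z * cnj (cnj (z * 1)) = z * z * kernel N \<zeta> z + (z * cnj z) * kernel N \<zeta> z"
        by (simp add: \<phi>_def algebra_simps)
      then show "\<phi> z * kernel N \<zeta> z * cnj (cnj (z * 1)) = z * z * kernel N \<zeta> z + kernel N \<zeta> z"
        by (simp add: cnj_mult_on_sphere[OF z])
    qed
    also have "\<dots> = 1"
      using disc_algebra_mean_value[OF A] by (simp add: k0)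
    finally show ?thesis .
  qed
  have "(norm q)\<^sup>2 = (LINT z|circ. (cmod (cnj (z * 1)))\<^sup>2)"
    unfolding q_def by (rule norm_l2_sq[OF continuous_sq_int[OF qc]])
  also have "\<dots> = (LINT z|circ. 1)"
    by (intro circ_integral_cong) simp
  finally have "norm q = 1 \<or> norm q = -1"
    by (simp add: measure_circ power2_eq_1_iff[symmetric])
  then have "norm q = 1"
    using norm_ge_zero[of q] by linarith
  then have "1 \<le> norm (v - y)"
    using cinner_Cauchy_Schwarz[of "v - y" q] by (simp add: cinner_diff_left vq yq)
  then have "1 \<le> (norm (v - y))\<^sup>2"
    by (rule one_le_power)
  moreover have "cinner (tto (B N) (\<lambda>z. (\<phi> z)\<^sup>2) k) k - cinner (tto (B N) \<phi> (tto (B N) \<phi> k)) k =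
      of_real ((norm (v - y))\<^sup>2)"
    unfolding y_def[symmetric] T1 T2 diff[symmetric] by (rule cinner_self)
  ultimately show ?thesis
    by (rule that)
qed

text \<open>
  The trace condition for \<open>\<phi>\<^sup>2\<close> with \<open>f(w) = w\<close> and for \<open>\<phi>\<close> with \<open>f(w) = w\<^sup>2\<close> has the same limit. The
  difference of the traces dominates the mean of \<open>\<beta>\<^sub>N\<close>, which therefore tends to zero although
  \<open>\<beta>\<^sub>N \<ge> 1/c\<close> on \<open>{\<bar>B\<^sub>N'\<bar> \<le> c for all N}\<close>.
\<close>

lemma limit_set_null_if_traces:
  assumes H: "\<And>\<phi> f. continuous_on (sphere 0 1) \<phi> \<Longrightarrow> f holomorphic_on UNIV \<Longrightarrow>
      (\<lambda>N. op_trace (K N) (tto (B N) (beta \<Lambda> N) \<circ> holomorphic_calculus (K N) UNIV f (tto (B N) \<phi>)))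
        \<longlonglongrightarrow> (LINT \<zeta>|circ. f (\<phi> \<zeta>))"
  shows "limit_set \<Lambda> \<in> null_sets circ"
proof -
  define \<phi> :: "complex \<Rightarrow> complex" where "\<phi> z = z + cnj z" for z
  have \<phi>c: "continuous_on (sphere 0 1) \<phi>"
    unfolding \<phi>_def by (intro continuous_intros)
  have \<phi>2c: "continuous_on (sphere 0 1) (\<lambda>z. (\<phi> z)\<^sup>2)"
    by (intro continuous_intros \<phi>c)
  let ?T1 = "\<lambda>N. tto (B N) (\<lambda>z. (\<phi> z)\<^sup>2)" and ?T2 = "\<lambda>N. tto (B N) \<phi>"
  let ?X1 = "\<lambda>N. holomorphic_calculus (K N) UNIV (\<lambda>w. w) (?T1 N)"
  let ?X2 = "\<lambda>N. holomorphic_calculus (K N) UNIV (\<lambda>w. w\<^sup>2) (?T2 N)"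
  let ?tr = "\<lambda>N X. op_trace (K N) (tto (B N) (beta \<Lambda> N) \<circ> X)"
  have hol: "(\<lambda>w::complex. w) holomorphic_on UNIV" "(\<lambda>w::complex. w\<^sup>2) holomorphic_on UNIV"
    by (intro holomorphic_intros)+
  obtain \<gamma>1 where \<gamma>1: "\<And>N. surrounds \<gamma>1 (op_spectrum (K N) (?T1 N)) UNIV"
    using calculus_approximate_eigenvector[OF \<phi>2c open_UNIV subset_UNIV hol(1)] by metis
  obtain \<gamma>2 where \<gamma>2: "\<And>N. surrounds \<gamma>2 (op_spectrum (K N) (?T2 N)) UNIV"
    using calculus_approximate_eigenvector[OF \<phi>c open_UNIV subset_UNIV hol(2)] by metis
  have X1: "lin_on (K N) (?X1 N)" for N
    by (rule K.holomorphic_calculus_lin_on[OF tto_lin_on open_UNIV hol(1) \<gamma>1])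
  have X2: "lin_on (K N) (?X2 N)" for N
    by (rule K.holomorphic_calculus_lin_on[OF tto_lin_on open_UNIV hol(2) \<gamma>2])
  have "(\<lambda>N. ?tr N (?X1 N) - ?tr N (?X2 N)) \<longlonglongrightarrow> (LINT \<zeta>|circ. (\<phi> \<zeta>)\<^sup>2) - (LINT \<zeta>|circ. (\<phi> \<zeta>)\<^sup>2)"
    by (intro tendsto_diff H[OF \<phi>2c hol(1)] H[OF \<phi>c hol(2)])
  then have "(\<lambda>N. Re (?tr N (?X1 N) - ?tr N (?X2 N))) \<longlonglongrightarrow> Re ((LINT \<zeta>|circ. (\<phi> \<zeta>)\<^sup>2) - (LINT \<zeta>|circ. (\<phi> \<zeta>)\<^sup>2))"
    by (rule tendsto_Re)
  then have lim: "(\<lambda>N. Re (?tr N (?X1 N) - ?tr N (?X2 N))) \<longlonglongrightarrow> 0" by simp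
  have lower: "(LINT \<zeta>|circ. 1 / angular \<Lambda> N \<zeta>) \<le> Re (?tr N (?X1 N) - ?tr N (?X2 N))" if N: "N \<ge> 1" for N
  proof -
    let ?G = "\<lambda>X \<zeta>. cinner (X (kvec N \<zeta>)) (kvec N \<zeta>) / of_real (angular \<Lambda> N \<zeta>)"
    have cG: "continuous_on (sphere 0 1) (?G (?X1 N))" "continuous_on (sphere 0 1) (?G (?X2 N))"
      by (rule trace_tto_beta(2)[OF N X1], rule trace_tto_beta(2)[OF N X2])
    have i: "integrable circ (\<lambda>\<zeta>. ?G (?X1 N) \<zeta> - ?G (?X2 N) \<zeta>)"
      by (intro circ_continuous_integrable continuous_on_diff cG)
    have "?tr N (?X1 N) - ?tr N (?X2 N) = (LINT \<zeta>|circ. ?G (?X1 N) \<zeta> - ?G (?X2 N) \<zeta>)"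
      unfolding trace_tto_beta(1)[OF N X1] trace_tto_beta(1)[OF N X2]
      by (rule Bochner_Integration.integral_diff[symmetric]) (intro circ_continuous_integrable cG)+
    then have "Re (?tr N (?X1 N) - ?tr N (?X2 N)) = (LINT \<zeta>|circ. Re (?G (?X1 N) \<zeta> - ?G (?X2 N) \<zeta>))"
      using integral_bounded_linear[OF bounded_linear_Re i] by simp
    also have "\<dots> \<ge> (LINT \<zeta>|circ. 1 / angular \<Lambda> N \<zeta>)"
    proof (rule circ_integral_mono)
      show "integrable circ (\<lambda>\<zeta>. 1 / angular \<Lambda> N \<zeta>)"
        using angular_ge_1[OF N]
        by (intro circ_continuous_integrable continuous_intros angular_continuous) force
      show "integrable circ (\<lambda>\<zeta>. Re (?G (?X1 N) \<zeta> - ?G (?X2 N) \<zeta>))"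
        by (rule integrable_bounded_linear[OF bounded_linear_Re i])
      fix \<zeta> :: complex assume \<zeta>: "cmod \<zeta> = 1"
      let ?k = "kvec N \<zeta>"
      have A: "1 \<le> angular \<Lambda> N \<zeta>" by (rule angular_ge_1[OF N \<zeta>])
      obtain r where r: "r \<ge> 1" "cinner (?T1 N ?k) ?k - cinner (?T2 N (?T2 N ?k)) ?k = of_real r"
        using compression_square_defect[OF N \<zeta>] unfolding \<phi>_def by metis
      have "?X1 N ?k = ?T1 N ?k"
        by (rule K.holomorphic_calculus_id_square(1)[OF tto_lin_on kvec_in \<gamma>1])
      moreover have "?X2 N ?k = ?T2 N (?T2 N ?k)"
        by (rule K.holomorphic_calculus_id_square(2)[OF tto_lin_on kvec_in \<gamma>2])
      ultimately have "?G (?X1 N) \<zeta> - ?G (?X2 N) \<zeta> = of_real (r / angular \<Lambda> N \<zeta>)"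
        using r(2) by (simp add: diff_divide_distrib[symmetric])
      then have "Re (?G (?X1 N) \<zeta> - ?G (?X2 N) \<zeta>) = r / angular \<Lambda> N \<zeta>"
        by (simp only: Re_complex_of_real)
      then show "1 / angular \<Lambda> N \<zeta> \<le> Re (?G (?X1 N) \<zeta> - ?G (?X2 N) \<zeta>)"
        using r(1) A by (simp add: divide_right_mono)
    qed
    finally show ?thesis .
  qed
  have "limit_sublevel c \<in> null_sets circ" if c: "c > 0" for c
  proof -
    have "measure circ (limit_sublevel c) / c \<le> 0"
    proof (rule LIMSEQ_le_const[OF lim], intro exI allI impI)
      fix N :: nat assume N: "N \<ge> 1"
      have "measure circ (limit_sublevel c) / c = (LINT \<zeta>|circ. indicator (limit_sublevel c) \<zeta> / c)"
        using sublevel_sphere(2)[of c] by (simp add: Int_absorb2)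
      also have "\<dots> \<le> (LINT \<zeta>|circ. 1 / angular \<Lambda> N \<zeta>)"
      proof (rule circ_integral_mono)
        show "integrable circ (\<lambda>\<zeta>. 1 / angular \<Lambda> N \<zeta>)"
          using angular_ge_1[OF N]
          by (intro circ_continuous_integrable continuous_intros angular_continuous) force
        show "integrable circ (\<lambda>\<zeta>. indicator (limit_sublevel c) \<zeta> / c :: real)"
          by (intro integrable_divide_zero integrable_real_indicator) (auto simp: circ.emeasure_eq_measure)
        fix \<zeta> :: complex assume \<zeta>: "cmod \<zeta> = 1"
        have A: "1 \<le> angular \<Lambda> N \<zeta>" by (rule angular_ge_1[OF N \<zeta>])
        show "indicator (limit_sublevel c) \<zeta> / c \<le> 1 / angular \<Lambda> N \<zeta>"
        proof (cases "\<zeta> \<in> limit_sublevel c")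
          case True
          then have "angular \<Lambda> N \<zeta> \<le> c" by (auto simp: limit_sublevel_def sublevel_def)
          then show ?thesis using True A by (simp add: frac_le)
        qed (use A in simp)
      qed
      also have "\<dots> \<le> Re (?tr N (?X1 N) - ?tr N (?X2 N))"
        by (rule lower[OF N])
      finally show "measure circ (limit_sublevel c) / c \<le> Re (?tr N (?X1 N) - ?tr N (?X2 N))" .
    qed
    then have "measure circ (limit_sublevel c) \<le> 0"
      using c by (simp add: divide_le_0_iff)
    then have "measure circ (limit_sublevel c) = 0"
      using measure_nonneg[of circ "limit_sublevel c"] by linarith
    then show ?thesis
      by (auto simp: null_sets_def circ.emeasure_eq_measure)
  qed
  then show ?thesis
    unfolding limit_set_eq_Union by (intro null_sets_UN) simp
qed

end

section \<open>The three equivalent conditions\<close>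

theorem theorem2p3:
  fixes \<Lambda> :: "nat \<Rightarrow> complex"
  assumes "\<And>j. \<Lambda> j \<in> ball 0 1" and "\<Lambda> 0 = 0"
  shows "((AE \<alpha> in circ.
            (\<lambda>N. op_norm (model_space (blaschke \<Lambda> N))
                   (unitary_calculus (model_space (blaschke \<Lambda> N)) (beta \<Lambda> N)
                      (clark_op (blaschke \<Lambda> N) \<alpha>))) \<longlonglongrightarrow> 0)
          \<longleftrightarrow> limit_set \<Lambda> \<in> null_sets circ) \<and>
         (limit_set \<Lambda> \<in> null_sets circ
          \<longleftrightarrow> (AE \<zeta> in circ.
            (\<Sum>j. ennreal ((1 - (cmod (\<Lambda> (Suc j)))\<^sup>2) / (cmod (\<zeta> - \<Lambda> (Suc j)))\<^sup>2)) = \<infinity>)) \<and>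
         (limit_set \<Lambda> \<in> null_sets circ
          \<longleftrightarrow> (\<forall>\<phi> f U. continuous_on (sphere 0 1) \<phi> \<longrightarrow>
            open U \<longrightarrow> closure (convex hull (ess_range \<phi>)) \<subseteq> U \<longrightarrow> f holomorphic_on U \<longrightarrow>
            (\<lambda>N. op_trace (model_space (blaschke \<Lambda> N))
                   (tto (blaschke \<Lambda> N) (beta \<Lambda> N) \<circ>
                    holomorphic_calculus (model_space (blaschke \<Lambda> N)) U f
                      (tto (blaschke \<Lambda> N) \<phi>)))
              \<longlonglongrightarrow> (LINT \<zeta>|circ. f (\<phi> \<zeta>))))"
proof -
  interpret blaschke_zeros_0 \<Lambda>
    using assms by unfold_locales auto
  have hull: "convex hull (\<phi> ` sphere 0 1) \<subseteq> U"
    if "continuous_on (sphere 0 1) \<phi>" "closure (convex hull (ess_range \<phi>)) \<subseteq> U" for \<phi> U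
  proof -
    have "\<phi> ` sphere 0 1 \<subseteq> ess_range \<phi>"
      using continuous_values_in_ess_range[OF that(1)] by auto
    then have "convex hull (\<phi> ` sphere 0 1) \<subseteq> convex hull (ess_range \<phi>)"
      by (rule hull_mono)
    then show ?thesis
      using that(2) closure_subset by blast
  qed
  show ?thesis
    using limit_set_null_if_norms norms_if_limit_set_null limit_set_null_iff_AE
      trace_limit[OF _ _ _ hull] limit_set_null_if_traces open_UNIV
    by (intro conjI iffI allI impI) (assumption | blast)+
qed

end
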